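(* Let $a=(a_1,\dots,a_n)$ be an anisotropy. For $0<p<1$ and $0<q\le1$ the space $A^{|a|(\frac1p-1),a}_{p,q}(\mathbb{R}^n)$ is neither a Besov space $B^{s',a}_{p',q'}(\mathbb{R}^n)$ nor a Lizorkin--Triebel space $F^{s',a}_{p',q'}(\mathbb{R}^n)$ for any admissible $(s',p',q')$, i.e. for any $s'\in\mathbb{R}$, $p',q'\in\,]0,\infty]$ (with $p'<\infty$ in the Lizorkin--Triebel case).
   Context: An anisotropy is a vector $a=(a_1,\dots,a_n)$ of real numbers with $\min(a_1,\dots,a_n)=1$; $|a|=a_1+\dots+a_n$. For $t>0$ let $t^ax=(t^{a_1}x_1,\dots,t^{a_n}x_n)$, and $2^{ka}x=(2^k)^ax$. For $x\ne0$, $|x|_a$ is the unique $t>0$ with $\sum_{i=1}^n x_i^2/t^{2a_i}=1$, and $|0|_a=0$. $\mathcal{F}$ is the Fourier transform on $\mathcal{S}'(\mathbb{R}^n)$. Fix $\psi\in C_0^\infty(\mathbb{R}^n)$ with $\psi(x)=1$ for $|x|_a\le1$ and $\psi(x)=0$ for $|x|_a\ge2$; set $\varphi_0=\psi$ and $\varphi_j(x)=\varphi_0(2^{-ja}x)-\varphi_0(2^{(-j+1)a}x)$ for $j\ge1$. For $s\in\mathbb{R}$, $p,q\in\,]0,\infty]$, $B^{s,a}_{p,q}(\mathbb{R}^n)$ is the set of $f\in\mathcal{S}'(\mathbb{R}^n)$ with finite quasi-norm $\bigl(\sum_{j\ge0}2^{jsq}\|\mathcal{F}^{-1}(\varphi_j\mathcal{F}f)\|_{L_p}^q\bigr)^{1/q}$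 and, for $p<\infty$, $F^{s,a}_{p,q}(\mathbb{R}^n)$ is the set of $f\in\mathcal{S}'(\mathbb{R}^n)$ with finite quasi-norm $\bigl\|\bigl(\sum_{j\ge0}2^{jsq}|\mathcal{F}^{-1}(\varphi_j\mathcal{F}f)(\cdot)|^q\bigr)^{1/q}\bigr\|_{L_p}$ (usual modification for $q=\infty$). For $0<p<1$, $0<q\le1$ and $s=|a|(\frac1p-1)$, $A^{s,a}_{p,q}(\mathbb{R}^n)$ is the set of $f\in\mathcal{S}'(\mathbb{R}^n)$ for which there are $h_j\in L_p(\mathbb{R}^n)\cap\mathcal{S}'(\mathbb{R}^n)$, $j\ge0$, with $\operatorname{supp}\mathcal{F}h_j\subset\{\xi:|\xi|_a\le2^j\}$, $f=\sum_{j\ge0}h_j$ in $\mathcal{S}'$ and $\bigl(\sum_j2^{jsq}\|h_j\|_{L_p}^q\bigr)^{1/q}<\infty$; its quasi-norm is the infimum of the latter expression over all such representations. *)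

theory Defs
  imports "HOL-Analysis.Analysis" "HOL-Probability.Essential_Supremum"
begin

section \<open>Anisotropies\<close>

definition anisotropy :: "real ^ 'n \<Rightarrow> bool"
  where "anisotropy a \<longleftrightarrow> Min (range (\<lambda>i. a $ i)) = 1"

definition aniso_size :: "real ^ 'n \<Rightarrow> real"
  where "aniso_size a = (\<Sum>i\<in>UNIV. a $ i)"

definition aniso_dil :: "real ^ 'n \<Rightarrow> real \<Rightarrow> real ^ 'n \<Rightarrow> real ^ 'n"
  where "aniso_dil a t x = (\<chi> i. t powr (a $ i) * x $ i)"

definition aniso_norm :: "real ^ 'n \<Rightarrow> real ^ 'n \<Rightarrow> real"
  where "aniso_norm a x =
    (if x = 0 then 0
     else (THE t. t > 0 \<and> (\<Sum>i\<in>UNIV. (x $ i)\<^sup>2 / t powr (2 * a $ i)) = 1))"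


section \<open>Smooth functions, test functions, Schwartz functions\<close>

definition pderiv_at :: "'n \<Rightarrow> (real ^ 'n \<Rightarrow> complex) \<Rightarrow> real ^ 'n \<Rightarrow> complex"
  where "pderiv_at i f x = frechet_derivative f (at x) (axis i 1)"

text \<open>Iterated partial derivatives are indexed by lists of coordinates instead of
  multi-indices; the list records the order of differentiation.\<close>

definition pderivs :: "'n list \<Rightarrow> (real ^ 'n \<Rightarrow> complex) \<Rightarrow> real ^ 'n \<Rightarrow> complex"
  where "pderivs is f = foldr pderiv_at is f"

text \<open>If all iterated partial derivatives are (Frechet) differentiable, they are in
  particular continuous, so this is the class of \<open>C\<^sup>\<infinity>\<close> functions.\<close>

definition smooth :: "(real ^ 'n \<Rightarrow> complex) \<Rightarrow> bool"
  where "smooth f \<longleftrightarrow> (\<forall>is x. pderivs is f differentiable (at x))"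

definition fun_supp :: "(real ^ 'n \<Rightarrow> complex) \<Rightarrow> (real ^ 'n) set"
  where "fun_supp f = closure {x. f x \<noteq> 0}"

definition test_functions :: "(real ^ 'n \<Rightarrow> complex) set"
  where "test_functions = {f. smooth f \<and> compact (fun_supp f)}"

definition schwartz :: "(real ^ 'n \<Rightarrow> complex) set"
  where "schwartz = {f. smooth f \<and>
    (\<forall>k is. bdd_above (range (\<lambda>x. (1 + norm x) ^ k * norm (pderivs is f x))))}"

definition schwartz_seminorm :: "nat \<Rightarrow> (real ^ 'n \<Rightarrow> complex) \<Rightarrow> real"
  where "schwartz_seminorm N f =
    (\<Sum>is | length is \<le> N. SUP x. (1 + norm x) ^ N * norm (pderivs is f x))"


section \<open>Tempered distributions\<close>

text \<open>A tempered distribution is a functional on Schwartz functions; it is made a total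
  function by the value \<open>undefined\<close> elsewhere, so that equality of functionals is equality
  on Schwartz functions.\<close>

type_synonym 'n functional = "(real ^ 'n \<Rightarrow> complex) \<Rightarrow> complex"

definition tempered :: "'n::finite functional set"
  where "tempered = {u \<in> extensional schwartz.
    (\<forall>f\<in>schwartz. \<forall>g\<in>schwartz. u (\<lambda>x. f x + g x) = u f + u g) \<and>
    (\<forall>c. \<forall>f\<in>schwartz. u (\<lambda>x. c * f x) = c * u f) \<and>
    (\<exists>C N. \<forall>f\<in>schwartz. norm (u f) \<le> C * schwartz_seminorm N f)}"

definition fourier :: "(real ^ 'n \<Rightarrow> complex) \<Rightarrow> real ^ 'n \<Rightarrow> complex"
  where "fourier f \<xi> = (LINT x|lborel. exp (- \<i> * of_real (x \<bullet> \<xi>)) * f x)"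

definition inv_fourier :: "(real ^ 'n \<Rightarrow> complex) \<Rightarrow> real ^ 'n \<Rightarrow> complex"
  where "inv_fourier f x =
    of_real (1 / (2 * pi) ^ CARD('n)) * (LINT \<xi>|lborel. exp (\<i> * of_real (x \<bullet> \<xi>)) * f \<xi>)"

definition dist_fourier :: "'n::finite functional \<Rightarrow> 'n functional"
  where "dist_fourier u = (\<lambda>f\<in>schwartz. u (fourier f))"

definition dist_inv_fourier :: "'n::finite functional \<Rightarrow> 'n functional"
  where "dist_inv_fourier u = (\<lambda>f\<in>schwartz. u (inv_fourier f))"

definition dist_mult :: "(real ^ 'n \<Rightarrow> complex) \<Rightarrow> 'n functional \<Rightarrow> 'n functional"
  where "dist_mult g u = (\<lambda>f\<in>schwartz. u (\<lambda>x. g x * f x))"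

definition dist_supp :: "'n::finite functional \<Rightarrow> (real ^ 'n) set"
  where "dist_supp u = {x. \<forall>U. open U \<and> x \<in> U \<longrightarrow>
    (\<exists>f\<in>test_functions. fun_supp f \<subseteq> U \<and> u f \<noteq> 0)}"

text \<open>Convergence in the weak-* topology. (For sequences this agrees with convergence in
  the strong topology.)\<close>

definition dist_sums :: "(nat \<Rightarrow> 'n::finite functional) \<Rightarrow> 'n functional \<Rightarrow> bool"
  where "dist_sums v u \<longleftrightarrow> (\<forall>f\<in>schwartz. (\<lambda>j. v j f) sums u f)"

text \<open>The tempered distribution \<open>u\<close> is the locally integrable function \<open>h\<close>. Only test
  functions are paired with \<open>h\<close>, since the product of \<open>h\<close> with a Schwartz function need not
  be integrable; test functions are dense, so \<open>h\<close> determines \<open>u\<close>.\<close>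

definition represents :: "(real ^ 'n \<Rightarrow> complex) \<Rightarrow> 'n functional \<Rightarrow> bool"
  where "represents h u \<longleftrightarrow>
    h \<in> borel_measurable borel \<and>
    (\<forall>K. compact K \<longrightarrow> set_integrable lborel K h) \<and>
    (\<forall>f\<in>test_functions. u f = (LINT x|lborel. h x * f x))"

text \<open>The function representing a distribution is unique up to null sets. Below, this is
  applied to distributions with compactly supported Fourier transform, which always are
  functions by the Paley--Wiener--Schwartz theorem.\<close>

definition dist_fun :: "'n::finite functional \<Rightarrow> real ^ 'n \<Rightarrow> complex"
  where "dist_fun u = (SOME h. represents h u)"


section \<open>Lebesgue and sequence space quasi-norms\<close>

text \<open>Real powers on the extended half-line, for exponents \<open>r > 0\<close>.\<close>

definition epowr :: "ennreal \<Rightarrow> real \<Rightarrow> ennreal"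
  where "epowr x r = (if x = \<infinity> then \<infinity> else ennreal (enn2real x powr r))"

definition Lp_qnorm :: "ennreal \<Rightarrow> (real ^ 'n \<Rightarrow> ennreal) \<Rightarrow> ennreal"
  where "Lp_qnorm p g =
    (if p = \<infinity> then esssup lborel g
     else epowr (\<integral>\<^sup>+ x. epowr (g x) (enn2real p) \<partial>lborel) (1 / enn2real p))"

definition lq_qnorm :: "ennreal \<Rightarrow> (nat \<Rightarrow> ennreal) \<Rightarrow> ennreal"
  where "lq_qnorm q c =
    (if q = \<infinity> then (SUP j. c j)
     else epowr (\<Sum>j. epowr (c j) (enn2real q)) (1 / enn2real q))"


section \<open>The function spaces\<close>

definition cutoff :: "real ^ 'n \<Rightarrow> (real ^ 'n \<Rightarrow> complex) \<Rightarrow> bool"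
  where "cutoff a \<psi> \<longleftrightarrow> \<psi> \<in> test_functions \<and>
    (\<forall>x. aniso_norm a x \<le> 1 \<longrightarrow> \<psi> x = 1) \<and>
    (\<forall>x. aniso_norm a x \<ge> 2 \<longrightarrow> \<psi> x = 0)"

definition lp_window ::
    "real ^ 'n \<Rightarrow> (real ^ 'n \<Rightarrow> complex) \<Rightarrow> nat \<Rightarrow> real ^ 'n \<Rightarrow> complex"
  where "lp_window a \<psi> j x =
    (if j = 0 then \<psi> x
     else \<psi> (aniso_dil a (2 powr (- real j)) x) - \<psi> (aniso_dil a (2 powr (- real j + 1)) x))"

definition lp_block ::
    "real ^ 'n \<Rightarrow> (real ^ 'n \<Rightarrow> complex) \<Rightarrow> nat \<Rightarrow> 'n functional \<Rightarrow> real ^ 'n \<Rightarrow> complex"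
  where "lp_block a \<psi> j u =
    dist_fun (dist_inv_fourier (dist_mult (lp_window a \<psi> j) (dist_fourier u)))"

definition besov_qnorm ::
    "real ^ 'n \<Rightarrow> (real ^ 'n \<Rightarrow> complex) \<Rightarrow> real \<Rightarrow> ennreal \<Rightarrow> ennreal \<Rightarrow> 'n functional \<Rightarrow> ennreal"
  where "besov_qnorm a \<psi> s p q u =
    lq_qnorm q (\<lambda>j. ennreal (2 powr (real j * s)) *
      Lp_qnorm p (\<lambda>x. ennreal (norm (lp_block a \<psi> j u x))))"

definition besov_space ::
    "real ^ 'n \<Rightarrow> (real ^ 'n \<Rightarrow> complex) \<Rightarrow> real \<Rightarrow> ennreal \<Rightarrow> ennreal \<Rightarrow> 'n functional set"
  where "besov_space a \<psi> s p q = {u \<in> tempered. besov_qnorm a \<psi> s p q u < \<infinity>}"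

definition triebel_qnorm ::
    "real ^ 'n \<Rightarrow> (real ^ 'n \<Rightarrow> complex) \<Rightarrow> real \<Rightarrow> ennreal \<Rightarrow> ennreal \<Rightarrow> 'n functional \<Rightarrow> ennreal"
  where "triebel_qnorm a \<psi> s p q u =
    Lp_qnorm p (\<lambda>x. lq_qnorm q (\<lambda>j. ennreal (2 powr (real j * s)) *
      ennreal (norm (lp_block a \<psi> j u x))))"

definition triebel_space ::
    "real ^ 'n \<Rightarrow> (real ^ 'n \<Rightarrow> complex) \<Rightarrow> real \<Rightarrow> ennreal \<Rightarrow> ennreal \<Rightarrow> 'n functional set"
  where "triebel_space a \<psi> s p q = {u \<in> tempered. triebel_qnorm a \<psi> s p q u < \<infinity>}"

text \<open>A representation consists of the tempered distributions \<open>v j\<close> together with the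
  \<open>L\<^sub>p\<close> functions \<open>h j\<close> which they are; for \<open>p < 1\<close>, an \<open>L\<^sub>p\<close> function
  alone need not define a distribution.\<close>

definition A_representation ::
    "real ^ 'n \<Rightarrow> ennreal \<Rightarrow> 'n functional \<Rightarrow> (nat \<Rightarrow> 'n functional) \<Rightarrow>
      (nat \<Rightarrow> real ^ 'n \<Rightarrow> complex) \<Rightarrow> bool"
  where "A_representation a p u v h \<longleftrightarrow>
    (\<forall>j. v j \<in> tempered \<and> represents (h j) (v j) \<and>
      Lp_qnorm p (\<lambda>x. ennreal (norm (h j x))) < \<infinity> \<and>
      dist_supp (dist_fourier (v j)) \<subseteq> {\<xi>. aniso_norm a \<xi> \<le> 2 ^ j}) \<and>
    dist_sums v u"

definition A_cost ::
    "real \<Rightarrow> ennreal \<Rightarrow> ennreal \<Rightarrow> (nat \<Rightarrow> real ^ 'n \<Rightarrow> complex) \<Rightarrow> ennreal"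
  where "A_cost s p q h =
    lq_qnorm q (\<lambda>j. ennreal (2 powr (real j * s)) * Lp_qnorm p (\<lambda>x. ennreal (norm (h j x))))"

definition A_space ::
    "real ^ 'n \<Rightarrow> real \<Rightarrow> ennreal \<Rightarrow> ennreal \<Rightarrow> 'n functional set"
  where "A_space a s p q =
    {u \<in> tempered. \<exists>v h. A_representation a p u v h \<and> A_cost s p q h < \<infinity>}"

definition A_qnorm ::
    "real ^ 'n \<Rightarrow> real \<Rightarrow> ennreal \<Rightarrow> ennreal \<Rightarrow> 'n functional \<Rightarrow> ennreal"
  where "A_qnorm a s p q u = Inf {A_cost s p q h |v h. A_representation a p u v h}"

lemma A_space_eq_A_qnorm:
  "A_space a s p q = {u \<in> tempered. A_qnorm a s p q u < \<infinity>}"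
  by (auto simp: A_space_def A_qnorm_def Inf_less_iff)

end

theory Submission
  imports Defs "HOL-Probability.Probability"
begin

text \<open>
  The spaces are distinguished by the Dirac distribution \<open>\<delta>\<close>. It never lies in the space
  \<open>A\<close>: by the Nikolskii inequality \<open>\<parallel>h\<parallel>\<^sub>1 \<le> C 2^{j|a|(1/p - 1)} \<parallel>h\<parallel>\<^sub>p\<close> for functions with spectrum in
  \<open>|\<xi>|\<^sub>a \<le> 2^j\<close> and \<open>q \<le> 1\<close>, every element of \<open>A\<close> is an integrable function. So a Besov or
  Lizorkin--Triebel space containing \<open>\<delta>\<close> differs from \<open>A\<close>.

  If such a space does not contain \<open>\<delta>\<close>, consider \<open>u = \<Sum>\<^sub>m 2^{-m} \<F>\<^sup>-\<^sup>1 \<psi>(2^{(1 - j\<^sub>m)a} \<cdot>)\<close>. The summands are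
  dilates of one Schwartz function that are bounded in \<open>A\<close> exactly because of the critical smoothness, so
  \<open>u \<in> A\<close>. For frequencies \<open>k\<close> between \<open>j\<^sub>m\<close> and \<open>j\<^sub>m\<^sub>+\<^sub>1\<close> the Littlewood--Paley block of \<open>u\<close> is that
  of \<open>\<delta>\<close> times a constant \<open>\<ge> 2^{-m-1}\<close>. As the blocks of \<open>\<delta>\<close> have infinite quasi-norm, the \<open>j\<^sub>m\<close> can
  be chosen so sparse that the blocks of \<open>u\<close> have infinite quasi-norm as well. No quasi-norm of
  \<open>\<delta>\<close> has to be computed.
\<close>

section \<open>Calculus of Schwartz functions\<close>

text \<open>The delicate point is the start of the Nikolskii inequality. With D the essential
  supremum of |h| and I the integral of |h|^p, the L1 norm is at most D^(1-p) I, and D is at most a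
  constant times the L1 norm; together D <= c D^(1-p). This says nothing while D may be infinite,
  and a band-limited tempered distribution is a priori only of polynomial growth. So the argument is
  run first for the damped functions |h| / (1 + |x|/(m+1))^N, with c independent of m.

  \<open>represents\<close> and \<open>dist_supp\<close> speak only of test functions, whereas the
  Fourier calculus lives on Schwartz functions; cutting off at radius m + 1 bridges the two. The
  given \<open>\<psi>\<close> supplies all bumps for this; as it is complex valued, squared moduli
  replace it where positivity matters.

  In the second case each single block of the Dirac distribution is a Schwartz function, so every
  tail of the blocks already has infinite quasi-norm. The coefficients 2^(-m) lie in l_q for all q >
  0, and gaps on which the Dirac blocks have quasi-norm at least 4^(m+1) outweigh them.\<close>

lemma pderivs_Nil [simp]: "pderivs [] f = f"
  by (simp add: pderivs_def)

lemma pderivs_Cons [simp]: "pderivs (i # is) f = pderiv_at i (pderivs is f)"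
  by (simp add: pderivs_def)

lemma pderivs_append: "pderivs (is @ js) f = pderivs is (pderivs js f)"
  by (simp add: pderivs_def)

lemma pderiv_at_eq: "(f has_derivative D) (at x) \<Longrightarrow> pderiv_at i f x = D (axis i 1)"
  by (simp add: pderiv_at_def frechet_derivative_at[symmetric])

text \<open>Coinduction, because \<open>smooth\<close> is a greatest fixed point under
  differentiation. Constants, coordinates, conjugates, affine substitutions and Fourier transforms
  are then handled by naming a suitable closed class, without formulas for higher
  derivatives.\<close>

lemma smooth_coinduct:
  assumes "f \<in> X" "\<And>g x. g \<in> X \<Longrightarrow> g differentiable (at x)" "\<And>g i. g \<in> X \<Longrightarrow> pderiv_at i g \<in> X"
  shows "smooth f"
proof -
  have "pderivs is f \<in> X" for "is"
    using assms by (induct "is") auto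
  then show ?thesis using assms(2) by (auto simp: smooth_def)
qed

lemma smooth_differentiable: "smooth f \<Longrightarrow> f differentiable (at x)"
  unfolding smooth_def using pderivs_Nil by metis

lemma smooth_pderivs: "smooth f \<Longrightarrow> smooth (pderivs is f)"
  unfolding smooth_def by (metis pderivs_append)

lemma smooth_pderiv_at: "smooth f \<Longrightarrow> smooth (pderiv_at i f)"
  using smooth_pderivs[of f "[i]"] by simp

text \<open>The family estimates control only partial derivatives; linearity of the differential
  turns them into control of the full derivative, as the mean value inequality requires.\<close>

lemma smooth_has_derivative:
  fixes f :: "real ^ 'n \<Rightarrow> complex"
  assumes "smooth f"
  shows "(f has_derivative (\<lambda>h. \<Sum>i\<in>UNIV. h $ i *\<^sub>R pderiv_at i f x)) (at x)"
proof -
  let ?D = "frechet_derivative f (at x)"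
  have D: "(f has_derivative ?D) (at x)"
    using smooth_differentiable[OF assms] frechet_derivative_works by blast
  then have lin: "linear ?D" by (rule has_derivative_linear)
  have "?D h = (\<Sum>i\<in>UNIV. h $ i *\<^sub>R pderiv_at i f x)" for h
  proof -
    have "h = (\<Sum>i\<in>UNIV. h $ i *\<^sub>R axis i 1)"
      using basis_expansion[of h] by (simp add: scalar_mult_eq_scaleR)
    then have "?D h = ?D (\<Sum>i\<in>UNIV. h $ i *\<^sub>R axis i 1)" by simp
    also have "\<dots> = (\<Sum>i\<in>UNIV. h $ i *\<^sub>R ?D (axis i 1))"
      by (simp add: linear_sum[OF lin] linear_scale[OF lin])
    finally show ?thesis by (simp add: pderiv_at_def)
  qed
  with D show ?thesis by (metis (no_types, lifting) ext)
qed

lemma smooth_continuous: "smooth f \<Longrightarrow> continuous_on A f"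
  by (meson smooth_differentiable differentiable_imp_continuous_within continuous_at_imp_continuous_on)

lemma smooth_measurable [measurable_dest]: "smooth f \<Longrightarrow> f \<in> borel_measurable borel"
  by (intro borel_measurable_continuous_onI smooth_continuous)

lemma diff_frechet: "f differentiable (at x) \<Longrightarrow> (f has_derivative frechet_derivative f (at x)) (at x)"
  using frechet_derivative_works by blast

lemma pderiv_at_add:
  assumes "\<And>x. f differentiable (at x)" "\<And>x. g differentiable (at x)"
  shows "pderiv_at i (\<lambda>x. f x + g x) = (\<lambda>x. pderiv_at i f x + pderiv_at i g x)"
  by (rule ext, subst pderiv_at_eq[OF has_derivative_add[OF diff_frechet diff_frechet]])
     (use assms in \<open>auto simp: pderiv_at_def\<close>)

lemma pderiv_at_mult:
  assumes "\<And>x. f differentiable (at x)" "\<And>x. g differentiable (at x)"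
  shows "pderiv_at i (\<lambda>x. f x * g x) = (\<lambda>x. f x * pderiv_at i g x + pderiv_at i f x * g x)"
  by (rule ext, subst pderiv_at_eq[OF has_derivative_mult[OF diff_frechet diff_frechet]])
     (use assms in \<open>auto simp: pderiv_at_def\<close>)

lemma pderiv_at_const [simp]: "pderiv_at i (\<lambda>x. c) = (\<lambda>x. 0)"
  by (rule ext, subst pderiv_at_eq[OF has_derivative_const]) simp

lemma pderivs_zero [simp]: "pderivs is (\<lambda>x. 0) = (\<lambda>x. 0)"
  by (induct "is") auto

lemma smooth_const [simp]: "smooth (\<lambda>x. c)"
  by (rule smooth_coinduct[where X = "range (\<lambda>c x. c)"]) auto

lemma has_derivative_coord:
  "((\<lambda>x::real ^ 'n. of_real (x $ i) :: complex) has_derivative (\<lambda>h. of_real (h $ i))) (at x)"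
  by (intro bounded_linear_imp_has_derivative bounded_linear_compose[OF bounded_linear_of_real bounded_linear_vec_nth])

lemma pderiv_at_coord:
  "pderiv_at j (\<lambda>x::real ^ 'n. of_real (x $ i) :: complex) = (\<lambda>x. if i = j then 1 else 0)"
  by (rule ext, subst pderiv_at_eq[OF has_derivative_coord]) (auto simp: axis_def)

lemma smooth_coord: "smooth (\<lambda>x::real ^ 'n. of_real (x $ i) :: complex)"
proof (rule smooth_coinduct[where X = "insert (\<lambda>x. of_real (x $ i)) (range (\<lambda>c x. c))"])
  fix g :: "real ^ 'n \<Rightarrow> complex" and x
  assume "g \<in> insert (\<lambda>x. of_real (x $ i)) (range (\<lambda>c x. c))"
  then show "g differentiable (at x)"
    using differentiableI[OF has_derivative_coord[of i x]] by auto
qed (auto simp: pderiv_at_coord)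

text \<open>Closure of \<open>smooth\<close> under products is an induction on the order of differentiation,
  with the order as a parameter.\<close>

definition ksmooth :: "nat \<Rightarrow> (real ^ 'n \<Rightarrow> complex) \<Rightarrow> bool"
  where "ksmooth n f \<longleftrightarrow> (\<forall>is x. length is \<le> n \<longrightarrow> pderivs is f differentiable (at x))"

lemma smooth_iff_ksmooth: "smooth f \<longleftrightarrow> (\<forall>n. ksmooth n f)"
  by (auto simp: smooth_def ksmooth_def)

lemma ksmooth_0: "ksmooth 0 f \<longleftrightarrow> (\<forall>x. f differentiable (at x))"
  by (auto simp: ksmooth_def)

lemma ksmooth_Suc:
  "ksmooth (Suc n) f \<longleftrightarrow> (\<forall>x. f differentiable (at x)) \<and> (\<forall>i. ksmooth n (pderiv_at i f))"
proof safe
  assume f: "ksmooth (Suc n) f"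
  show "f differentiable (at x)" for x
    using f[unfolded ksmooth_def, rule_format, of "[]"] by simp
  show "ksmooth n (pderiv_at i f)" for i
    unfolding ksmooth_def
  proof safe
    fix "is" :: "'a list" and x assume "length is \<le> n"
    then show "pderivs is (pderiv_at i f) differentiable at x"
      using f[unfolded ksmooth_def, rule_format, of "is @ [i]" x] by (simp add: pderivs_append)
  qed
next
  assume f: "\<forall>x. f differentiable (at x)" "\<forall>i. ksmooth n (pderiv_at i f)"
  show "ksmooth (Suc n) f" unfolding ksmooth_def
  proof safe
    fix "is" :: "'a list" and x assume "length is \<le> Suc n"
    then show "pderivs is f differentiable at x"
      using f by (cases "is" rule: rev_cases) (auto simp: pderivs_append ksmooth_def)
  qed
qed

lemma ksmooth_mono: "ksmooth (Suc n) f \<Longrightarrow> ksmooth n f"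
  by (simp add: ksmooth_def)

lemma ksmooth_add: "ksmooth n f \<Longrightarrow> ksmooth n g \<Longrightarrow> ksmooth n (\<lambda>x. f x + g x)"
proof (induct n arbitrary: f g)
  case (Suc n)
  then show ?case
    by (auto simp: ksmooth_Suc pderiv_at_add intro!: derivative_intros)
qed (auto simp: ksmooth_0 intro!: derivative_intros)

lemma ksmooth_mult: "ksmooth n f \<Longrightarrow> ksmooth n g \<Longrightarrow> ksmooth n (\<lambda>x. f x * g x)"
proof (induct n arbitrary: f g)
  case (Suc n)
  have "ksmooth n f" "ksmooth n g" using Suc.prems ksmooth_mono by auto
  with Suc show ?case
    by (auto simp: ksmooth_Suc pderiv_at_mult intro!: derivative_intros ksmooth_add)
qed (auto simp: ksmooth_0 intro!: derivative_intros)

lemma smooth_add: "smooth f \<Longrightarrow> smooth g \<Longrightarrow> smooth (\<lambda>x. f x + g x)"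
  by (auto simp: smooth_iff_ksmooth ksmooth_add)

lemma smooth_mult: "smooth f \<Longrightarrow> smooth g \<Longrightarrow> smooth (\<lambda>x. f x * g x)"
  by (auto simp: smooth_iff_ksmooth ksmooth_mult)

lemma smooth_diff: "smooth f \<Longrightarrow> smooth g \<Longrightarrow> smooth (\<lambda>x. f x - g x)"
  using smooth_add[of f "\<lambda>x. - 1 * g x"] smooth_mult[of "\<lambda>x. - 1" g] by simp

lemma smooth_prod: "finite I \<Longrightarrow> (\<And>i. i \<in> I \<Longrightarrow> smooth (f i)) \<Longrightarrow> smooth (\<lambda>x. \<Prod>i\<in>I. f i x)"
  by (induct rule: finite_induct) (auto intro: smooth_mult)

lemma smooth_power: "smooth f \<Longrightarrow> smooth (\<lambda>x. f x ^ n)"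
  by (induct n) (auto intro: smooth_mult)

lemma pderivs_add:
  assumes "smooth f" "smooth g"
  shows "pderivs is (\<lambda>x. f x + g x) = (\<lambda>x. pderivs is f x + pderivs is g x)"
  using assms by (induct "is") (auto simp: pderiv_at_add smooth_differentiable smooth_pderivs)

lemma pderivs_cmult:
  assumes "smooth f"
  shows "pderivs is (\<lambda>x. c * f x) = (\<lambda>x. c * pderivs is f x)"
  using assms by (induct "is") (auto simp: pderiv_at_mult smooth_differentiable smooth_pderivs)

lemma pderivs_diff:
  assumes "smooth f" "smooth g"
  shows "pderivs is (\<lambda>x. f x - g x) = (\<lambda>x. pderivs is f x - pderivs is g x)"
  using pderivs_add[of f "\<lambda>x. - 1 * g x" "is"] pderivs_cmult[of g "is" "- 1"] smooth_mult[of "\<lambda>x. - 1" g] assms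
  by simp

lemma pderiv_at_cnj:
  assumes "\<And>x. f differentiable (at x)"
  shows "pderiv_at i (\<lambda>x. cnj (f x)) = (\<lambda>x. cnj (pderiv_at i f x))"
  by (rule ext, subst pderiv_at_eq[OF has_derivative_cnj[OF diff_frechet]])
     (use assms in \<open>auto simp: pderiv_at_def\<close>)

lemma smooth_cnj:
  assumes "smooth f" shows "smooth (\<lambda>x. cnj (f x))"
proof (rule smooth_coinduct[where X = "{(\<lambda>x. cnj (f x)) | f. smooth f}"])
  fix g :: "real ^ 'a \<Rightarrow> complex" and x assume "g \<in> {(\<lambda>x. cnj (f x)) | f. smooth f}"
  then show "g differentiable (at x)"
    using has_derivative_cnj[OF diff_frechet[OF smooth_differentiable]] by (auto simp: differentiable_def)
qed (use assms in \<open>auto simp: pderiv_at_cnj smooth_differentiable intro: smooth_pderiv_at\<close>)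

text \<open>Reflections, isotropic scalings and anisotropic dilations are all diagonal maps, so one
  chain rule and one change of variables serve for all of them.\<close>

definition diag :: "real ^ 'n \<Rightarrow> real ^ 'n \<Rightarrow> real ^ 'n"
  where "diag d x = (\<chi> i. d $ i * x $ i)"

lemma diag_nth [simp]: "diag d x $ i = d $ i * x $ i"
  by (simp add: diag_def)

lemma diag_const: "diag (\<chi> i. c) x = c *\<^sub>R x"
  by (vector diag_def)

lemma linear_diag: "linear (diag d)"
  by (rule linearI; vector diag_def; simp add: algebra_simps)

lemma bounded_linear_diag: "bounded_linear (diag d)"
  using linear_diag linear_conv_bounded_linear by blast

lemma continuous_diag [continuous_intros]: "continuous_on A (diag d)"
  by (rule linear_continuous_on[OF bounded_linear_diag])

lemma measurable_diag [measurable]: "diag d \<in> borel_measurable borel"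
  by (intro borel_measurable_continuous_onI continuous_diag)

lemma affine_has_derivative:
  assumes "\<And>x. f differentiable (at x)"
  shows "((\<lambda>x. f (b + diag d x)) has_derivative (\<lambda>h. frechet_derivative f (at (b + diag d x)) (diag d h))) (at x)"
proof -
  have *: "((\<lambda>x. b + diag d x) has_derivative diag d) (at x)"
    using bounded_linear_imp_has_derivative[OF bounded_linear_diag]
    by (auto intro!: derivative_eq_intros)
  show ?thesis
    using has_derivative_compose[OF * diff_frechet[OF assms]] by simp
qed

lemma pderiv_at_affine:
  fixes f :: "real ^ 'n \<Rightarrow> complex"
  assumes "\<And>x. f differentiable (at x)"
  shows "pderiv_at i (\<lambda>x. f (b + diag d x)) = (\<lambda>x. of_real (d $ i) * pderiv_at i f (b + diag d x))"
proof
  fix x :: "real ^ 'n"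
  have ax: "diag d (axis i 1) = d $ i *\<^sub>R axis i 1"
    by (vector diag_def axis_def)
  show "pderiv_at i (\<lambda>x. f (b + diag d x)) x = of_real (d $ i) * pderiv_at i f (b + diag d x)"
    using linear_scale[OF has_derivative_linear[OF diff_frechet[OF assms, of "b + diag d x"]], of "d $ i" "axis i 1"]
    unfolding pderiv_at_eq[OF affine_has_derivative[OF assms]] ax pderiv_at_def
    by (simp add: scaleR_conv_of_real)
qed

lemma smooth_affine:
  assumes "smooth f" shows "smooth (\<lambda>x. f (b + diag d x))"
proof (rule smooth_coinduct[where X = "{(\<lambda>x. c * f (b + diag d x)) | c f. smooth f}"])
  show "(\<lambda>x. f (b + diag d x)) \<in> {(\<lambda>x. c * f (b + diag d x)) | c f. smooth f}"
    using assms by (auto intro!: exI[of _ 1] exI[of _ f])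
next
  fix g x assume "g \<in> {(\<lambda>x. c * f (b + diag d x)) | c f. smooth f}"
  then obtain c f where g: "g = (\<lambda>x. c * f (b + diag d x))" "smooth f" by auto
  show "g differentiable (at x)"
    unfolding g(1)
    by (intro differentiable_mult differentiable_const
        differentiableI[OF affine_has_derivative[OF smooth_differentiable[OF g(2)]]])
  fix i
  have "(\<lambda>x. f (b + diag d x)) differentiable at x" for x
    using affine_has_derivative[OF smooth_differentiable[OF g(2)]] by (rule differentiableI)
  then have "pderiv_at i g = (\<lambda>x. (c * of_real (d $ i)) * pderiv_at i f (b + diag d x))"
    unfolding g(1) by (subst pderiv_at_mult) (simp_all add: pderiv_at_affine smooth_differentiable g(2) mult.assoc)
  then show "pderiv_at i g \<in> {(\<lambda>x. c * f (b + diag d x)) | c f. smooth f}"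
    using smooth_pderiv_at[OF g(2)] by blast
qed

lemma pderivs_affine:
  assumes "smooth f"
  shows "pderivs is (\<lambda>x. f (b + diag d x)) = (\<lambda>x. of_real (\<Prod>i\<leftarrow>is. d $ i) * pderivs is f (b + diag d x))"
proof (induct "is")
  case (Cons i "is")
  have s: "smooth (pderivs is f)" using assms by (rule smooth_pderivs)
  show ?case
    by (simp add: Cons pderiv_at_mult pderiv_at_affine smooth_differentiable s smooth_affine mult.assoc mult.left_commute)
qed simp

text \<open>The factor \<open>CARD('n)\<close> comes from bounding each coordinate of the increment
  by its full norm. Derivatives are bounded on \<open>S\<close> only, so that \<open>B\<close> may
  depend on a base point through a small ball.\<close>

lemma smooth_mean_value:
  fixes f :: "real ^ 'n \<Rightarrow> complex"
  assumes "smooth f" "convex S" "x \<in> S" "y \<in> S" "\<And>i z. z \<in> S \<Longrightarrow> norm (pderiv_at i f z) \<le> B"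
  shows "norm (f x - f y) \<le> real CARD('n) * B * norm (x - y)"
proof (rule differentiable_bound[OF assms(2) _ _ assms(3,4)])
  fix z assume z: "z \<in> S"
  show "(f has_derivative (\<lambda>h. \<Sum>i\<in>UNIV. h $ i *\<^sub>R pderiv_at i f z)) (at z within S)"
    using smooth_has_derivative[OF assms(1)] by (rule has_derivative_at_withinI)
  show "onorm (\<lambda>h. \<Sum>i\<in>UNIV. h $ i *\<^sub>R pderiv_at i f z) \<le> real CARD('n) * B"
  proof (rule onorm_le)
    fix h :: "real ^ 'n"
    have "norm (\<Sum>i\<in>UNIV. h $ i *\<^sub>R pderiv_at i f z) \<le> (\<Sum>i\<in>(UNIV::'n set). norm h * B)"
      by (rule sum_norm_le) (auto intro!: mult_mono simp: component_le_norm_cart assms(5)[OF z])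
    then show "norm (\<Sum>i\<in>UNIV. h $ i *\<^sub>R pderiv_at i f z) \<le> real CARD('n) * B * norm h"
      by (simp add: mult_ac)
  qed
qed

section \<open>Bounded families of Schwartz functions\<close>

text \<open>Continuity of operators on the Schwartz space is expressed as preservation of bounded families
  (\<open>sbdd\<close>). The families in \<open>modb\<close>, uniformly of polynomial growth, are their multipliers.\<close>

definition sbdd :: "('b \<Rightarrow> real ^ 'n \<Rightarrow> complex) \<Rightarrow> bool"
  where "sbdd F \<longleftrightarrow> (\<forall>b. smooth (F b)) \<and>
    (\<forall>k is. \<exists>C. \<forall>b x. (1 + norm x) ^ k * norm (pderivs is (F b) x) \<le> C)"

definition modb :: "('b \<Rightarrow> real ^ 'n \<Rightarrow> complex) \<Rightarrow> bool"
  where "modb F \<longleftrightarrow> (\<forall>b. smooth (F b)) \<and>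
    (\<forall>is. \<exists>k C. \<forall>b x. norm (pderivs is (F b) x) \<le> C * (1 + norm x) ^ k)"

lemma sbdd_smooth: "sbdd F \<Longrightarrow> smooth (F b)" and modb_smooth: "modb F \<Longrightarrow> smooth (F b)"
  by (auto simp: sbdd_def modb_def)

lemma schwartz_iff_sbdd: "f \<in> schwartz \<longleftrightarrow> sbdd (\<lambda>b::unit. f)"
  by (auto simp: schwartz_def sbdd_def bdd_above_def)

lemma sbdd_schwartz: "sbdd F \<Longrightarrow> F b \<in> schwartz"
  unfolding schwartz_iff_sbdd sbdd_def by metis

lemma schwartz_smooth: "f \<in> schwartz \<Longrightarrow> smooth f"
  by (simp add: schwartz_def)

lemma sbdd_reindex: "sbdd F \<Longrightarrow> sbdd (\<lambda>c. F (g c))"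
  unfolding sbdd_def by metis

lemma sbdd_of_schwartz: "f \<in> schwartz \<Longrightarrow> sbdd (\<lambda>b. f)"
  using sbdd_reindex[of "\<lambda>b::unit. f" "\<lambda>_. ()"] by (simp add: schwartz_iff_sbdd)

lemma sbdd_bound:
  assumes "sbdd F"
  obtains C where "C > 0" "\<And>b x. norm (pderivs is (F b) x) \<le> C / (1 + norm x) ^ k"
proof -
  obtain C where C: "\<And>b x. (1 + norm x) ^ k * norm (pderivs is (F b) x) \<le> C"
    using assms unfolding sbdd_def by blast
  have "norm (pderivs is (F b) x) \<le> max C 1 / (1 + norm x) ^ k" for b x
    using C[of x b] by (auto simp: field_simps add_pos_nonneg max_def intro: order_trans)
  then show thesis by (intro that[of "max C 1"]) auto
qed

lemma sbdd_bound0: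
  assumes "sbdd F"
  obtains C where "C > 0" "\<And>b x. norm (F b x) \<le> C / (1 + norm x) ^ k"
  using sbdd_bound[OF assms, of "[]" k] by auto

lemma sbdd_modb:
  assumes "sbdd F" shows "modb F"
  unfolding modb_def
proof (intro conjI allI)
  fix "is"
  obtain C where "\<And>b x. norm (pderivs is (F b) x) \<le> C / (1 + norm x) ^ 0"
    using sbdd_bound[OF assms, of "is" 0] by metis
  then show "\<exists>k C. \<forall>b x. norm (pderivs is (F b) x) \<le> C * (1 + norm x) ^ k"
    by (intro exI[of _ 0] exI[of _ C]) auto
qed (use assms in \<open>simp add: sbdd_smooth\<close>)

lemma sbdd_pderiv_at: "sbdd F \<Longrightarrow> sbdd (\<lambda>b. pderiv_at i (F b))"
  unfolding sbdd_def
proof (intro conjI allI)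
  fix k "is"
  assume *: "(\<forall>b. smooth (F b)) \<and> (\<forall>k is. \<exists>C. \<forall>b x. (1 + norm x) ^ k * norm (pderivs is (F b) x) \<le> C)"
  show "\<exists>C. \<forall>b x. (1 + norm x) ^ k * norm (pderivs is (pderiv_at i (F b)) x) \<le> C"
    using *[THEN conjunct2, rule_format, of k "is @ [i]"] by (simp add: pderivs_append)
qed (auto intro: smooth_pderiv_at)

lemma modb_pderiv_at: "modb F \<Longrightarrow> modb (\<lambda>b. pderiv_at i (F b))"
  unfolding modb_def
proof (intro conjI allI)
  fix "is"
  assume *: "(\<forall>b. smooth (F b)) \<and> (\<forall>is. \<exists>k C. \<forall>b x. norm (pderivs is (F b) x) \<le> C * (1 + norm x) ^ k)"
  show "\<exists>k C. \<forall>b x. norm (pderivs is (pderiv_at i (F b)) x) \<le> C * (1 + norm x) ^ k"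
    using *[THEN conjunct2, rule_format, of "is @ [i]"] by (simp add: pderivs_append)
qed (auto intro: smooth_pderiv_at)

lemma sbdd_add:
  assumes "sbdd F" "sbdd G" shows "sbdd (\<lambda>b x. F b x + G b x)"
  unfolding sbdd_def
proof (intro conjI allI)
  fix k "is"
  obtain C where C: "\<And>b x. (1 + norm x) ^ k * norm (pderivs is (F b) x) \<le> C"
    using assms unfolding sbdd_def by blast
  obtain D where D: "\<And>b x. (1 + norm x) ^ k * norm (pderivs is (G b) x) \<le> D"
    using assms unfolding sbdd_def by blast
  have "(1 + norm x) ^ k * norm (pderivs is (\<lambda>x. F b x + G b x) x) \<le> C + D" for b x
  proof -
    have "(1 + norm x) ^ k * norm (pderivs is (\<lambda>x. F b x + G b x) x)
      \<le> (1 + norm x) ^ k * (norm (pderivs is (F b) x) + norm (pderivs is (G b) x))"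
      by (intro mult_left_mono) (auto simp: pderivs_add sbdd_smooth assms norm_triangle_ineq)
    with C[of x b] D[of x b] show ?thesis by (simp add: distrib_left)
  qed
  then show "\<exists>C. \<forall>b x. (1 + norm x) ^ k * norm (pderivs is (\<lambda>x. F b x + G b x) x) \<le> C" by blast
qed (use assms in \<open>simp add: smooth_add sbdd_smooth\<close>)

lemma sbdd_mult:
  assumes "modb F" "sbdd G" shows "sbdd (\<lambda>b x. F b x * G b x)"
proof -
  have "\<exists>C. \<forall>b x. (1 + norm x) ^ k * norm (pderivs is (\<lambda>x. F b x * G b x) x) \<le> C" for k "is"
    using assms
  \<comment> \<open>The induction removes the derivative that is applied first: the product rule
    then yields two products of the same kind, and the hypothesis for arbitrary \<open>F\<close> and
    \<open>G\<close> applies to both.\<close>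
  proof (induct "is" arbitrary: F G rule: rev_induct)
    case Nil
    obtain l C where C: "\<And>b x. norm (F b x) \<le> C * (1 + norm x) ^ l"
      using Nil(1) unfolding modb_def by (metis pderivs_Nil)
    \<comment> \<open>Decay of order \<open>k + l\<close> pays both for the weight and for the
      growth of the multiplier.\<close>
    obtain D where D: "D > 0" "\<And>b x. norm (G b x) \<le> D / (1 + norm x) ^ (k + l)"
      using sbdd_bound0[OF Nil(2), of "k + l"] by blast
    have "(1 + norm x) ^ k * norm (pderivs [] (\<lambda>x. F b x * G b x) x) \<le> C * D" for b x
    proof -
      have "(1 + norm x) ^ k * norm (F b x * G b x)
        \<le> (1 + norm x) ^ k * ((C * (1 + norm x) ^ l) * (D / (1 + norm x) ^ (k + l)))"
        unfolding norm_mult using C[of b x] D(2)[of b x]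
        by (intro mult_left_mono mult_mono) (auto intro: order_trans[OF norm_ge_zero])
      also have "\<dots> = C * D"
      proof -
        have "1 + norm x \<noteq> 0" using norm_ge_zero[of x] by linarith
        then show ?thesis by (simp add: power_add)
      qed
      finally show ?thesis by simp
    qed
    then show ?case by blast
  next
    case (snoc i "is")
    obtain C where C: "\<And>b x. (1 + norm x) ^ k * norm (pderivs is (\<lambda>x. F b x * pderiv_at i (G b) x) x) \<le> C"
      using snoc(1)[OF snoc(2) sbdd_pderiv_at[OF snoc(3)]] by blast
    obtain D where D: "\<And>b x. (1 + norm x) ^ k * norm (pderivs is (\<lambda>x. pderiv_at i (F b) x * G b x) x) \<le> D"
      using snoc(1)[OF modb_pderiv_at[OF snoc(2)] snoc(3)] by blast
    note s = modb_smooth[OF snoc(2)] sbdd_smooth[OF snoc(3)]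
    have "(1 + norm x) ^ k * norm (pderivs (is @ [i]) (\<lambda>x. F b x * G b x) x) \<le> C + D" for b x
    proof -
      have "pderivs (is @ [i]) (\<lambda>x. F b x * G b x) x =
        pderivs is (\<lambda>x. F b x * pderiv_at i (G b) x) x + pderivs is (\<lambda>x. pderiv_at i (F b) x * G b x) x"
        by (simp add: pderivs_append pderiv_at_mult smooth_differentiable s pderivs_add smooth_mult smooth_pderiv_at)
      then have "(1 + norm x) ^ k * norm (pderivs (is @ [i]) (\<lambda>x. F b x * G b x) x) \<le>
        (1 + norm x) ^ k * (norm (pderivs is (\<lambda>x. F b x * pderiv_at i (G b) x) x) +
          norm (pderivs is (\<lambda>x. pderiv_at i (F b) x * G b x) x))"
        by (intro mult_left_mono) (auto simp: norm_triangle_ineq)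
      with C[of x b] D[of x b] show ?thesis by (simp add: distrib_left)
    qed
    then show ?case by blast
  qed
  then show ?thesis
    using assms by (auto simp: sbdd_def smooth_mult modb_smooth)
qed

lemma modb_const: "(\<And>b. norm (c b) \<le> C) \<Longrightarrow> modb (\<lambda>b x. c b)"
  unfolding modb_def
proof (intro conjI allI)
  fix "is" :: "'b list"
  assume C: "\<And>b. norm (c b) \<le> C"
  have "0 \<le> C" using C[of undefined] norm_ge_zero order_trans by blast
  then have "norm (pderivs is (\<lambda>x. c b) x) \<le> C * (1 + norm x) ^ 0" for b and x :: "real ^ 'b"
    using C[of b] by (cases "is" rule: rev_cases) (auto simp: pderivs_append)
  then show "\<exists>k C. \<forall>b (x :: real ^ 'b). norm (pderivs is (\<lambda>x. c b) x) \<le> C * (1 + norm x) ^ k" by blast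
qed simp

lemma modb_coord: "modb (\<lambda>b (x::real ^ 'n). of_real (x $ i))"
  unfolding modb_def
proof (intro conjI allI)
  fix "is" :: "'n list"
  let ?f = "\<lambda>x::real ^ 'n. of_real (x $ i) :: complex"
  have "norm (pderivs is ?f x) \<le> 1 * (1 + norm x) ^ 1" for x
  proof (cases "is" rule: rev_cases)
    case Nil then show ?thesis using component_le_norm_cart[of x i] by simp
  next
    case (snoc js j)
    have "pderivs js (\<lambda>x. c) x = (if js = [] then c else 0)" for c
      by (cases js rule: rev_cases) (auto simp: pderivs_append)
    then show ?thesis by (auto simp: snoc pderivs_append pderiv_at_coord)
  qed
  then show "\<exists>k C. \<forall>b x. norm (pderivs is ?f x) \<le> C * (1 + norm x) ^ k" by blast
qed (rule smooth_coord)

lemma sbdd_cmult: "(\<And>b. norm (c b) \<le> C) \<Longrightarrow> sbdd F \<Longrightarrow> sbdd (\<lambda>b x. c b * F b x)"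
  by (rule sbdd_mult[OF modb_const])

lemma sbdd_coord_mult: "sbdd F \<Longrightarrow> sbdd (\<lambda>b x. of_real (x $ i) * F b x)"
  by (rule sbdd_mult[OF modb_coord])

lemma schwartz_add: "f \<in> schwartz \<Longrightarrow> g \<in> schwartz \<Longrightarrow> (\<lambda>x. f x + g x) \<in> schwartz"
  unfolding schwartz_iff_sbdd by (rule sbdd_add)

lemma schwartz_cmult: "f \<in> schwartz \<Longrightarrow> (\<lambda>x. c * f x) \<in> schwartz"
  unfolding schwartz_iff_sbdd by (rule sbdd_cmult[of "\<lambda>_. c" "norm c"]) auto

lemma schwartz_diff: "f \<in> schwartz \<Longrightarrow> g \<in> schwartz \<Longrightarrow> (\<lambda>x. f x - g x) \<in> schwartz"
  using schwartz_add[of f "\<lambda>x. - 1 * g x"] schwartz_cmult[of g "- 1"] by simp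

lemma schwartz_mult: "f \<in> schwartz \<Longrightarrow> g \<in> schwartz \<Longrightarrow> (\<lambda>x. f x * g x) \<in> schwartz"
  unfolding schwartz_iff_sbdd by (rule sbdd_mult[OF sbdd_modb])

text \<open>The complement of the closed support is open, so the function vanishes near each of its
  points and not merely at them; this passes to every derivative.\<close>

lemma pderivs_outside_fun_supp: "f \<in> test_functions \<Longrightarrow> x \<notin> fun_supp f \<Longrightarrow> pderivs is f x = 0"
proof -
  assume f: "f \<in> test_functions" and x: "x \<notin> fun_supp f"
  have "\<forall>x. x \<in> - fun_supp f \<longrightarrow> pderivs is f x = 0"
  proof (induct "is")
    case Nil
    then show ?case using closure_subset[of "{x. f x \<noteq> 0}"] by (auto simp: fun_supp_def)
  next
    case (Cons i "is")
    show ?case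
    proof safe
      fix x assume x: "x \<notin> fun_supp f"
      have "(pderivs is f has_derivative (\<lambda>h. 0)) (at x)"
      proof (rule has_derivative_transform_within_open[where f = "\<lambda>x. 0" and s = "- fun_supp f"])
        show "open (- fun_supp f)" by (simp add: fun_supp_def open_Compl)
      qed (use x Cons in auto)
      then show "pderivs (i # is) f x = 0" by (simp add: pderiv_at_eq)
    qed
  qed
  then show ?thesis using x by blast
qed

lemma test_functions_schwartz: "f \<in> test_functions \<Longrightarrow> f \<in> schwartz"
  unfolding schwartz_def
proof safe
  assume f: "f \<in> test_functions"
  then show s: "smooth f" by (simp add: test_functions_def)
  fix k :: nat and "is" :: "'a list"
  let ?g = "\<lambda>x. (1 + norm x) ^ k * norm (pderivs is f x)"
  have "compact (fun_supp f)" using f by (simp add: test_functions_def)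
  moreover have "continuous_on (fun_supp f) ?g"
    by (intro continuous_intros smooth_continuous smooth_pderivs s)
  ultimately have "bounded (?g ` fun_supp f)"
    using compact_continuous_image compact_imp_bounded by blast
  then obtain B where B: "\<And>x. x \<in> fun_supp f \<Longrightarrow> ?g x \<le> B"
    unfolding bounded_iff by (force simp: abs_le_iff)
  have "?g x \<le> max B 0" for x
    using B[of x] pderivs_outside_fun_supp[OF f, of x "is"] by (cases "x \<in> fun_supp f") auto
  then show "bdd_above (range ?g)" by (auto simp: bdd_above_def)
qed

lemma seminorm_le:
  fixes f :: "real ^ 'n \<Rightarrow> complex"
  assumes "\<And>is x. length is \<le> N \<Longrightarrow> (1 + norm x) ^ N * norm (pderivs is f x) \<le> B"
  shows "schwartz_seminorm N f \<le> real (card {is :: 'n list. length is \<le> N}) * B"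
  unfolding schwartz_seminorm_def
  by (rule sum_bounded_above) (auto intro!: cSUP_least assms)

lemma seminorm_sbdd:
  fixes F :: "'b \<Rightarrow> real ^ 'n \<Rightarrow> complex"
  assumes "sbdd F"
  obtains C where "\<And>b. schwartz_seminorm N (F b) \<le> C"
proof -
  have "\<forall>is. \<exists>C. \<forall>b x. (1 + norm x) ^ N * norm (pderivs is (F b) x) \<le> C"
    using assms unfolding sbdd_def by blast
  then obtain C where C: "\<And>is b x. (1 + norm x) ^ N * norm (pderivs is (F b) x) \<le> C is"
    by metis
  have fin: "finite {is :: 'n list. length is \<le> N}"
    using finite_lists_length_le[of "UNIV :: 'n set"] by simp
  let ?B = "\<Sum>is | length is \<le> N. \<bar>C is\<bar>"
  have "(1 + norm x) ^ N * norm (pderivs is (F b) x) \<le> ?B" if "length is \<le> N" for "is" b x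
    using C[of x "is" b] member_le_sum[of "is" "{is. length is \<le> N}" "\<lambda>is. \<bar>C is\<bar>"] fin that by force
  then show thesis using seminorm_le that by blast
qed

lemma seminorm_nonneg:
  fixes f :: "real ^ 'n \<Rightarrow> complex"
  assumes "f \<in> schwartz" shows "0 \<le> schwartz_seminorm N f"
  unfolding schwartz_seminorm_def
proof (rule sum_nonneg)
  fix "is" :: "'n list"
  have "bdd_above (range (\<lambda>x. (1 + norm x) ^ N * norm (pderivs is f x)))"
    using assms by (auto simp: schwartz_def)
  then show "0 \<le> (SUP x. (1 + norm x) ^ N * norm (pderivs is f x))"
    by (intro cSUP_upper2[of _ _ 0]) auto
qed

text \<open>Continuity in the form used for limits: an error written as a null sequence times a
  bounded family is sent to a null sequence by \<open>u\<close>.\<close>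

lemma tempered_bounded:
  fixes u :: "'n::finite functional"
  assumes "u \<in> tempered" "sbdd F"
  obtains C where "\<And>b. norm (u (F b)) \<le> C"
proof -
  obtain C N where C: "\<forall>f\<in>schwartz. norm (u f) \<le> C * schwartz_seminorm N f"
    using assms(1) unfolding tempered_def by blast
  obtain D where D: "\<And>b. schwartz_seminorm N (F b) \<le> D" using seminorm_sbdd[OF assms(2)] by blast
  have nn: "0 \<le> schwartz_seminorm N (F b)" for b
    by (rule seminorm_nonneg[OF sbdd_schwartz[OF assms(2)]])
  have "norm (u (F b)) \<le> \<bar>C\<bar> * D" for b
  proof -
    have "norm (u (F b)) \<le> C * schwartz_seminorm N (F b)"
      using C sbdd_schwartz[OF assms(2)] by blast
    also have "\<dots> \<le> \<bar>C\<bar> * D" using nn[of b] D[of b] by (intro mult_mono) auto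
    finally show ?thesis .
  qed
  then show thesis by (rule that)
qed

section \<open>The Fourier transform of Schwartz functions\<close>

lemma integrable_inverse_one_plus_square: "integrable lborel (\<lambda>x::real. 1 / (1 + x\<^sup>2))"
proof -
  let ?f = "\<lambda>x::real. 1 / (1 + x\<^sup>2)"
  have "set_integrable lborel {0<..} ?f"
    using integrable_I0i_1_div_plus_square
    by (simp add: interval_lebesgue_integrable_def zero_ereal_def)
  then have p: "integrable lborel (\<lambda>x. indicator {0<..} x *\<^sub>R ?f x)"
    by (simp add: set_integrable_def)
  have "integrable lborel (\<lambda>x. indicator {0<..} (0 + (- 1) * x) *\<^sub>R ?f (0 + (- 1) * x))"
    by (rule lborel_integrable_real_affine[OF p]) simp
  then have "integrable lborel (\<lambda>x. indicator {0<..} x *\<^sub>R ?f x + indicator {0<..} (- x) *\<^sub>R ?f x)"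
    using p by (intro Bochner_Integration.integrable_add) auto
  moreover have "AE x in lborel. indicator {0<..} x *\<^sub>R ?f x + indicator {0<..} (- x) *\<^sub>R ?f x = ?f x"
    using AE_lborel_singleton[of "0::real"] by eventually_elim (auto simp: indicator_def)
  ultimately show ?thesis
    by (subst integrable_cong_AE[symmetric]) auto
qed

text \<open>The weight \<open>(1 + |x|)^{-2n}\<close> is dominated by a product of one-dimensional integrable functions.\<close>

lemma integrable_weight:
  "integrable lborel (\<lambda>x::real ^ 'n. 1 / (1 + norm x) ^ (2 * CARD('n)))"
proof (rule integrableI_bounded)
  have "(\<integral>\<^sup>+x. ennreal (norm (1 / (1 + norm x) ^ (2 * CARD('n)))) \<partial>(lborel :: (real ^ 'n) measure))
    \<le> (\<integral>\<^sup>+x. (\<Prod>b\<in>Basis. ennreal (1 / (1 + (x \<bullet> b)\<^sup>2))) \<partial>(lborel :: (real ^ 'n) measure))"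
  proof (rule nn_integral_mono)
    fix x :: "real ^ 'n"
    have "(\<Prod>b\<in>(Basis :: (real ^ 'n) set). (1 + (x \<bullet> b)\<^sup>2)) \<le> (\<Prod>b\<in>(Basis :: (real ^ 'n) set). (1 + norm x)\<^sup>2)"
    proof (rule prod_mono, safe)
      fix b :: "real ^ 'n" assume "b \<in> Basis"
      then have "(x \<bullet> b)\<^sup>2 \<le> (norm x)\<^sup>2"
        using Basis_le_norm[of b x] using power_mono[of "\<bar>x \<bullet> b\<bar>" "norm x" 2] by simp
      then show "1 + (x \<bullet> b)\<^sup>2 \<le> (1 + norm x)\<^sup>2"
        using norm_ge_zero[of x] unfolding power2_sum one_power2 by linarith
    qed (auto intro: add_nonneg_nonneg)
    also have "\<dots> = (1 + norm x) ^ (2 * CARD('n))"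
      by (simp add: power_mult)
    finally have "1 / (1 + norm x) ^ (2 * CARD('n)) \<le> 1 / (\<Prod>b\<in>(Basis :: (real ^ 'n) set). (1 + (x \<bullet> b)\<^sup>2))"
      by (intro divide_left_mono mult_pos_pos prod_pos) (auto intro!: add_pos_nonneg zero_less_power)
    then have "ennreal (norm (1 / (1 + norm x) ^ (2 * CARD('n)))) \<le> ennreal (\<Prod>b\<in>(Basis :: (real ^ 'n) set). 1 / (1 + (x \<bullet> b)\<^sup>2))"
      by (intro ennreal_leI) (simp add: prod_dividef)
    also have "\<dots> = (\<Prod>b\<in>Basis. ennreal (1 / (1 + (x \<bullet> b)\<^sup>2)))"
      by (rule prod_ennreal[symmetric]) auto
    finally show "ennreal (norm (1 / (1 + norm x) ^ (2 * CARD('n)))) \<le> (\<Prod>b\<in>Basis. ennreal (1 / (1 + (x \<bullet> b)\<^sup>2)))" .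
  qed
  also have "\<dots> = (\<Prod>b\<in>(Basis :: (real ^ 'n) set). \<integral>\<^sup>+x. ennreal (1 / (1 + x\<^sup>2)) \<partial>lborel)"
    by (rule nn_integral_lborel_prod) auto
  also have "\<dots> < \<infinity>"
    using integrable_inverse_one_plus_square
    by (auto simp: integrable_iff_bounded ennreal_prod_eq_top power_eq_top_ennreal less_top[symmetric])
  finally show "(\<integral>\<^sup>+x. ennreal (norm (1 / (1 + norm x) ^ (2 * CARD('n)))) \<partial>(lborel :: (real ^ 'n) measure)) < \<infinity>" .
qed simp

lemma integrable_decay:
  fixes f :: "real ^ 'n \<Rightarrow> 'b :: {banach, second_countable_topology}"
  assumes "f \<in> borel_measurable borel" "\<And>x. norm (f x) \<le> C / (1 + norm x) ^ (2 * CARD('n))"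
  shows "integrable lborel f"
proof (rule Bochner_Integration.integrable_bound)
  show "integrable lborel (\<lambda>x::real ^ 'n. C * (1 / (1 + norm x) ^ (2 * CARD('n))))"
    by (intro integrable_mult_right integrable_weight)
  show "AE x in lborel. norm (f x) \<le> norm (C * (1 / (1 + norm x) ^ (2 * CARD('n))))"
    using order_trans[OF assms(2) abs_ge_self] by (intro AE_I2) simp
qed (use assms in simp)

lemma integral_norm_decay:
  fixes f :: "real ^ 'n \<Rightarrow> 'b :: {banach, second_countable_topology}"
  assumes "f \<in> borel_measurable borel" "\<And>x. norm (f x) \<le> C / (1 + norm x) ^ (2 * CARD('n))"
  shows "(LINT x|lborel. norm (f x)) \<le> C * (LINT x|(lborel :: (real ^ 'n) measure). 1 / (1 + norm x) ^ (2 * CARD('n)))"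
proof -
  have "(LINT x|lborel. norm (f x)) \<le> (LINT x|(lborel :: (real ^ 'n) measure). C * (1 / (1 + norm x) ^ (2 * CARD('n))))"
    using assms(2)
    by (intro integral_mono integrable_norm integrable_decay[OF assms] integrable_mult_right integrable_weight) auto
  also have "\<dots> = C * (LINT x|(lborel :: (real ^ 'n) measure). 1 / (1 + norm x) ^ (2 * CARD('n)))"
    by (rule integral_mult_right_zero)
  finally show ?thesis .
qed

lemma schwartz_measurable [measurable_dest]: "f \<in> schwartz \<Longrightarrow> f \<in> borel_measurable borel"
  by (simp add: schwartz_smooth smooth_measurable)

lemma schwartz_integrable: "f \<in> schwartz \<Longrightarrow> integrable lborel f"
  using sbdd_bound0[OF sbdd_of_schwartz, of f] integrable_decay[OF schwartz_measurable] by metis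

lemma sbdd_integral_bound:
  fixes F :: "'b \<Rightarrow> real ^ 'n \<Rightarrow> complex"
  assumes "sbdd F"
  obtains C where "\<And>b. (LINT x|lborel. norm (F b x)) \<le> C"
proof -
  obtain C where "\<And>b x. norm (F b x) \<le> C / (1 + norm x) ^ (2 * CARD('n))"
    using sbdd_bound0[OF assms] by metis
  then show thesis
    using integral_norm_decay[OF schwartz_measurable[OF sbdd_schwartz[OF assms]]] that by blast
qed

lemma norm_iexp [simp]: "norm (exp (- \<i> * complex_of_real t)) = 1" "norm (exp (\<i> * complex_of_real t)) = 1"
  by (simp_all add: norm_exp_eq_Re)

lemma measurable_iexp [measurable]:
  "(\<lambda>x::real ^ 'n. exp (- \<i> * complex_of_real (x \<bullet> \<xi>))) \<in> borel_measurable borel"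
  "(\<lambda>x::real ^ 'n. exp (\<i> * complex_of_real (x \<bullet> \<xi>))) \<in> borel_measurable borel"
  by (auto intro!: borel_measurable_continuous_onI continuous_intros)

lemma integrable_iexp_mult:
  fixes f :: "real ^ 'n \<Rightarrow> complex"
  assumes "integrable lborel f"
  shows "integrable lborel (\<lambda>x. exp (- \<i> * complex_of_real (x \<bullet> \<xi>)) * f x)"
    and "integrable lborel (\<lambda>x. exp (\<i> * complex_of_real (x \<bullet> \<xi>)) * f x)"
  using borel_measurable_integrable[OF assms]
  by (auto intro!: Bochner_Integration.integrable_bound[OF assms] simp: norm_mult)

lemma fourier_bound:
  assumes "integrable lborel f"
  shows "norm (fourier f \<xi>) \<le> (LINT x|lborel. norm (f x))"
proof -
  have "norm (fourier f \<xi>) \<le> (LINT x|lborel. norm (exp (- \<i> * complex_of_real (x \<bullet> \<xi>)) * f x))"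
    unfolding fourier_def by (rule integral_norm_bound)
  also have "\<dots> = (LINT x|lborel. norm (f x))" by (simp only: norm_mult norm_iexp) simp
  finally show ?thesis .
qed

text \<open>The first-order Taylor remainder of the phase is quadratic in its argument. Integrated
  against \<open>f\<close>, it gives an error of at most a second moment of \<open>f\<close> times
  \<open>(norm \<eta>)\<^sup>2\<close>, so no limit has to be taken under the integral.\<close>

lemma fourier_has_derivative:
  fixes f :: "real ^ 'n \<Rightarrow> complex"
  assumes "f \<in> schwartz"
  shows "(fourier f has_derivative (\<lambda>\<eta>. \<Sum>i\<in>UNIV. \<eta> $ i *\<^sub>R fourier (\<lambda>x. - \<i> * (of_real (x $ i) * f x)) \<xi>)) (at \<xi>)"
proof -
  have "sbdd (\<lambda>b::unit. \<lambda>x. of_real (x $ i) * f x)" for i :: 'n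
    by (intro sbdd_coord_mult sbdd_of_schwartz assms)
  then have xs: "(\<lambda>x. - \<i> * (of_real (x $ i) * f x)) \<in> schwartz" for i :: 'n
    by (intro schwartz_cmult) (simp add: schwartz_iff_sbdd)
  let ?g = "\<lambda>i x. - \<i> * (of_real (x $ i) * f x)"
  let ?D = "\<lambda>\<eta>. \<Sum>i\<in>UNIV. \<eta> $ i *\<^sub>R fourier (?g i) \<xi>"
  \<comment> \<open>Two powers more than the integrable weight: they absorb the factor
    \<open>(norm x)\<^sup>2\<close> of the second moment.\<close>
  obtain C where C: "C > 0" "\<And>x. norm (f x) \<le> C / (1 + norm x) ^ (2 * CARD('n) + 2)"
    using sbdd_bound0[OF sbdd_of_schwartz[OF assms]] by metis
  let ?h = "\<lambda>x. (norm x)\<^sup>2 * norm (f x)"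
  note [measurable] = schwartz_measurable[OF assms]
  have hint: "integrable lborel ?h"
  proof (rule integrable_decay)
    fix x :: "real ^ 'n"
    have "(norm x)\<^sup>2 * norm (f x) \<le> (1 + norm x)\<^sup>2 * (C / (1 + norm x) ^ (2 * CARD('n) + 2))"
      using C(2)[of x] by (intro mult_mono power_mono) auto
    also have "\<dots> = C / (1 + norm x) ^ (2 * CARD('n))"
    proof -
      have "1 + norm x \<noteq> 0" using norm_ge_zero[of x] by linarith
      then show ?thesis by (simp add: power_add power2_eq_square)
    qed
    finally show "norm (?h x) \<le> C / (1 + norm x) ^ (2 * CARD('n))" by simp
  qed simp
  define K where "K = (LINT x|lborel. ?h x)"
  have main: "norm (fourier f (\<xi> + \<eta>) - fourier f \<xi> - ?D \<eta>) \<le> K * (norm \<eta>)\<^sup>2" for \<eta>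
  proof -
    let ?e = "\<lambda>x. exp (- \<i> * complex_of_real (x \<bullet> \<xi>))"
    have i1: "integrable lborel (\<lambda>x. exp (- \<i> * complex_of_real (x \<bullet> (\<xi> + \<eta>))) * f x)"
      and i2: "integrable lborel (\<lambda>x. ?e x * f x)"
      by (intro integrable_iexp_mult schwartz_integrable assms)+
    have i3: "integrable lborel (\<lambda>x. \<eta> $ i *\<^sub>R (?e x * ?g i x))" for i
      by (intro integrable_scaleR_right integrable_iexp_mult schwartz_integrable xs)
    have "?D \<eta> = (LINT x|lborel. (\<Sum>i\<in>UNIV. \<eta> $ i *\<^sub>R (?e x * ?g i x)))"
      unfolding fourier_def using i3 by (subst Bochner_Integration.integral_sum) auto
    then have eq: "fourier f (\<xi> + \<eta>) - fourier f \<xi> - ?D \<eta> =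
      (LINT x|lborel. exp (- \<i> * complex_of_real (x \<bullet> (\<xi> + \<eta>))) * f x - ?e x * f x - (\<Sum>i\<in>UNIV. \<eta> $ i *\<^sub>R (?e x * ?g i x)))"
      unfolding fourier_def using i1 i2 i3 by (simp only: Bochner_Integration.integral_diff Bochner_Integration.integrable_diff Bochner_Integration.integrable_sum)
    have pt: "norm (exp (- \<i> * complex_of_real (x \<bullet> (\<xi> + \<eta>))) * f x - ?e x * f x - (\<Sum>i\<in>UNIV. \<eta> $ i *\<^sub>R (?e x * ?g i x)))
      \<le> ?h x * (norm \<eta>)\<^sup>2" for x
    proof -
      have s: "(\<Sum>i\<in>UNIV. \<eta> $ i *\<^sub>R (?e x * ?g i x)) = ?e x * f x * (\<i> * of_real (- (x \<bullet> \<eta>)))"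
        by (simp add: inner_vec_def scaleR_conv_of_real sum_distrib_left sum_distrib_right sum_negf[symmetric] mult_ac)
      have e: "exp (- \<i> * complex_of_real (x \<bullet> (\<xi> + \<eta>))) = ?e x * exp (\<i> * of_real (- (x \<bullet> \<eta>)))"
        by (simp add: inner_add_right exp_add[symmetric] algebra_simps)
      have "exp (- \<i> * complex_of_real (x \<bullet> (\<xi> + \<eta>))) * f x - ?e x * f x - (\<Sum>i\<in>UNIV. \<eta> $ i *\<^sub>R (?e x * ?g i x))
        = ?e x * f x * (exp (\<i> * of_real (- (x \<bullet> \<eta>))) - (1 + \<i> * of_real (- (x \<bullet> \<eta>))))"
        unfolding s e by (simp add: algebra_simps)
      also have "norm \<dots> = norm (f x) * norm (exp (\<i> * of_real (- (x \<bullet> \<eta>))) - (1 + \<i> * of_real (- (x \<bullet> \<eta>))))"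
        by (simp only: norm_mult norm_iexp mult_1_left)
      also have "\<dots> \<le> norm (f x) * (\<bar>- (x \<bullet> \<eta>)\<bar>\<^sup>2 / 2)"
        using iexp_approx1[of "- (x \<bullet> \<eta>)" 1] by (intro mult_left_mono) (auto simp: numeral_2_eq_2)
      also have "\<dots> \<le> norm (f x) * ((norm x * norm \<eta>)\<^sup>2)"
      proof (intro mult_left_mono)
        have "\<bar>x \<bullet> \<eta>\<bar>\<^sup>2 \<le> (norm x * norm \<eta>)\<^sup>2" by (intro power_mono Cauchy_Schwarz_ineq2) auto
        then show "\<bar>- (x \<bullet> \<eta>)\<bar>\<^sup>2 / 2 \<le> (norm x * norm \<eta>)\<^sup>2"
          using zero_le_power2[of "norm x * norm \<eta>"] unfolding abs_minus_cancel by (smt (verit) field_sum_of_halves)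
      qed auto
      finally show ?thesis by (simp add: power_mult_distrib mult_ac)
    qed
    have "norm (fourier f (\<xi> + \<eta>) - fourier f \<xi> - ?D \<eta>) \<le> (LINT x|lborel. ?h x * (norm \<eta>)\<^sup>2)"
      unfolding eq
    proof (rule Bochner_Integration.integral_norm_bound_integral)
      show "integrable lborel (\<lambda>x. exp (- \<i> * complex_of_real (x \<bullet> (\<xi> + \<eta>))) * f x - ?e x * f x - (\<Sum>i\<in>UNIV. \<eta> $ i *\<^sub>R (?e x * ?g i x)))"
        by (intro Bochner_Integration.integrable_diff Bochner_Integration.integrable_sum i1 i2 i3)
      show "integrable lborel (\<lambda>x. ?h x * (norm \<eta>)\<^sup>2)"
        by (intro integrable_mult_left hint)
    qed (rule pt)
    then show ?thesis by (simp add: K_def)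
  qed
  show ?thesis
  proof (rule has_derivativeI_sandwich[where e = 1 and H = "\<lambda>y. K * norm (y - \<xi>)"])
    show "bounded_linear ?D"
      by (auto intro!: bounded_linear_sum bounded_linear_scaleR_const bounded_linear_vec_nth)
    fix y assume "y \<noteq> \<xi>"
    then show "norm (fourier f y - fourier f \<xi> - ?D (y - \<xi>)) / norm (y - \<xi>) \<le> K * norm (y - \<xi>)"
      using main[of "y - \<xi>"] by (simp add: divide_le_eq power2_eq_square mult_ac)
  next
    have "((\<lambda>y. K * norm (y - \<xi>)) \<longlongrightarrow> K * norm (\<xi> - \<xi>)) (at \<xi>)"
      by (intro tendsto_intros)
    then show "((\<lambda>y. K * norm (y - \<xi>)) \<longlongrightarrow> 0) (at \<xi>)" by simp
  qed auto
qed

lemma pderiv_at_fourier: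
  fixes f :: "real ^ 'n \<Rightarrow> complex"
  assumes "f \<in> schwartz"
  shows "pderiv_at i (fourier f) = fourier (\<lambda>x. - \<i> * (of_real (x $ i) * f x))"
proof
  fix \<xi>
  have "(\<Sum>j\<in>UNIV. axis i 1 $ j *\<^sub>R fourier (\<lambda>x. - \<i> * (of_real (x $ j) * f x)) \<xi>)
    = (\<Sum>j\<in>UNIV. if j = i then fourier (\<lambda>x. - \<i> * (of_real (x $ i) * f x)) \<xi> else 0)"
    by (rule sum.cong) (auto simp: axis_def)
  then show "pderiv_at i (fourier f) \<xi> = fourier (\<lambda>x. - \<i> * (of_real (x $ i) * f x)) \<xi>"
    by (simp add: pderiv_at_eq[OF fourier_has_derivative[OF assms]])
qed

lemma sbdd_coord_mult': "sbdd F \<Longrightarrow> sbdd (\<lambda>b x. - \<i> * (of_real (x $ i) * F b x))"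
  by (rule sbdd_cmult[OF _ sbdd_coord_mult, of "\<lambda>b. - \<i>" 1]) auto

lemma smooth_fourier:
  assumes "f \<in> schwartz"
  shows "smooth (fourier f)"
proof (rule smooth_coinduct[where X = "fourier ` schwartz"])
  fix g :: "real ^ 'a \<Rightarrow> complex" and x i assume "g \<in> fourier ` schwartz"
  then obtain f where f: "f \<in> schwartz" "g = fourier f" by auto
  show "g differentiable (at x)"
    using fourier_has_derivative[OF f(1)] unfolding f(2) by (rule differentiableI)
  have "(\<lambda>x. - \<i> * (of_real (x $ i) * f x)) \<in> schwartz"
    using sbdd_coord_mult'[OF sbdd_of_schwartz[OF f(1), where ?'b = unit]] by (simp add: schwartz_iff_sbdd)
  then show "pderiv_at i g \<in> fourier ` schwartz"
    unfolding f(2) pderiv_at_fourier[OF f(1)] by blast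
qed (use assms in auto)

lemma pderivs_fourier:
  assumes "sbdd F"
  shows "\<exists>G. sbdd G \<and> (\<forall>b. pderivs is (fourier (F b)) = fourier (G b))"
proof (induct "is")
  case Nil
  then show ?case using assms by auto
next
  case (Cons i "is")
  then obtain G where G: "sbdd G" "\<And>b. pderivs is (fourier (F b)) = fourier (G b)" by blast
  then show ?case
    using sbdd_coord_mult'[OF G(1), of i] pderiv_at_fourier[OF sbdd_schwartz[OF G(1)]]
    by (intro exI[of _ "\<lambda>b x. - \<i> * (of_real (x $ i) * G b x)"]) simp
qed

lemma lborel_integral_translate:
  fixes f :: "'a::euclidean_space \<Rightarrow> 'b::{banach, second_countable_topology}"
  assumes [measurable]: "f \<in> borel_measurable borel"
  shows "(LINT x|lborel. f (c + x)) = (LINT x|lborel. f x)"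
proof -
  have "(LINT x|lborel. f x) = (LINT x|distr lborel borel ((+) c). f x)"
    by (simp add: lborel_distr_plus)
  also have "\<dots> = (LINT x|lborel. f (c + x))"
    by (rule integral_distr) auto
  finally show ?thesis by simp
qed

text \<open>For difference quotients: the mean value inequality on a unit ball sees derivatives at
  points \<open>z\<close> near \<open>x\<close>, whose decay has to be restated at
  \<open>x\<close>.\<close>

lemma weight_shift:
  fixes x z :: "real ^ 'n"
  assumes "norm (z - x) \<le> 1"
  shows "1 / (1 + norm z) ^ k \<le> 2 ^ k / (1 + norm x) ^ k"
proof -
  have "1 + norm x \<le> 2 * (1 + norm z)"
  proof -
    have "norm x \<le> norm z + norm (z - x)" using norm_triangle_ineq4[of z "z - x"] by simp
    also have "\<dots> \<le> norm z + 1" using assms by simp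
    finally show ?thesis using norm_ge_zero[of z] by (smt (verit, best))
  qed
  then have "(1 + norm x) ^ k \<le> 2 ^ k * (1 + norm z) ^ k"
    using power_mono[of "1 + norm x" "2 * (1 + norm z)" k] norm_ge_zero[of x] unfolding power_mult_distrib by (smt (verit))
  then show ?thesis by (simp add: field_simps add_pos_nonneg)
qed

text \<open>Integration by parts, in the guise of differentiating the translation invariance of the integral.\<close>

lemma fourier_pderiv_at:
  fixes f :: "real ^ 'n \<Rightarrow> complex"
  assumes "f \<in> schwartz"
  shows "fourier (pderiv_at i f) \<xi> = \<i> * of_real (\<xi> $ i) * fourier f \<xi>"
proof -
  define t where "t m = 1 / real (Suc m)" for m
  have t: "0 < t m" "t m \<le> 1" for m by (auto simp: t_def)
  have t0: "t \<longlonglongrightarrow> 0" unfolding t_def by (rule LIMSEQ_Suc[OF lim_1_over_n])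
  let ?e = "\<lambda>x. exp (- \<i> * complex_of_real (x \<bullet> \<xi>))"
  let ?a = "axis i 1 :: real ^ 'n"
  let ?W = "2 * CARD('n)"
  note sm = schwartz_smooth[OF assms]
  note [measurable] = schwartz_measurable[OF assms]
  have [measurable]: "pderiv_at i f \<in> borel_measurable borel" for i
    using sm smooth_pderiv_at smooth_measurable by blast
  define g where "g m x = (f (t m *\<^sub>R ?a + x) - f x) / of_real (t m)" for m x
  have "sbdd (\<lambda>i::'n. pderiv_at i f)"
  proof -
    have "\<exists>C. \<forall>i x. (1 + norm x) ^ k * norm (pderivs is (pderiv_at i f) x) \<le> C" for k "is"
    proof -
      have "\<forall>i. \<exists>C. \<forall>x. (1 + norm x) ^ k * norm (pderivs is (pderiv_at i f) x) \<le> C"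
        using sbdd_pderiv_at[OF sbdd_of_schwartz[OF assms, where ?'b = unit]] unfolding sbdd_def by blast
      then obtain C where C: "\<And>i x. (1 + norm x) ^ k * norm (pderivs is (pderiv_at i f) x) \<le> C i" by metis
      have "C i \<le> (\<Sum>i\<in>UNIV. \<bar>C i\<bar>)" for i
        using member_le_sum[of i UNIV "\<lambda>i. \<bar>C i\<bar>"] by force
      then show ?thesis using C order_trans by blast
    qed
    then show ?thesis using sm by (auto simp: sbdd_def smooth_pderiv_at)
  qed
  then obtain C where C: "C > 0" "\<And>i x. norm (pderiv_at i f x) \<le> C / (1 + norm x) ^ ?W"
    using sbdd_bound0 by metis
  define K where "K = real CARD('n) * (C * 2 ^ ?W)"
  \<comment> \<open>Domination uniform in \<open>m\<close>: the step \<open>t m\<close> is at most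
    1, so the segment stays in the unit ball around \<open>x\<close>.\<close>
  have gb: "norm (g m x) \<le> K / (1 + norm x) ^ ?W" for m x
  proof -
    have "norm (f (t m *\<^sub>R ?a + x) - f x) \<le> real CARD('n) * (C * 2 ^ ?W / (1 + norm x) ^ ?W) * norm (t m *\<^sub>R ?a + x - x)"
    proof (rule smooth_mean_value[OF sm, where S = "cball x 1"])
      show "t m *\<^sub>R ?a + x \<in> cball x 1" using t[of m] by (simp add: dist_norm norm_minus_commute)
      fix j z assume "z \<in> cball x 1"
      then have "norm (z - x) \<le> 1" by (simp add: dist_norm norm_minus_commute)
      from mult_left_mono[OF weight_shift[OF this, of ?W], of C] C(1) C(2)[of j z]
      show "norm (pderiv_at j f z) \<le> C * 2 ^ ?W / (1 + norm x) ^ ?W" by simp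
    qed auto
    also have "\<dots> = K / (1 + norm x) ^ ?W * t m" using t[of m] by (simp add: K_def)
    finally show ?thesis using t[of m] by (simp add: g_def norm_divide divide_le_eq)
  qed
  have lim: "(\<lambda>m. g m x) \<longlonglongrightarrow> pderiv_at i f x" for x
  proof -
    let ?D = "frechet_derivative f (at x)"
    have D: "(f has_derivative ?D) (at x)"
      using smooth_differentiable[OF sm] by (rule diff_frechet)
    have "filterlim (\<lambda>m. x + t m *\<^sub>R ?a) (at x) sequentially"
    proof (rule filterlim_atI)
      have "(\<lambda>m. x + t m *\<^sub>R ?a) \<longlonglongrightarrow> x + 0 *\<^sub>R ?a" by (intro tendsto_intros t0)
      then show "(\<lambda>m. x + t m *\<^sub>R ?a) \<longlonglongrightarrow> x" by simp
      show "\<forall>\<^sub>F m in sequentially. x + t m *\<^sub>R ?a \<noteq> x"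
        using t by (intro always_eventually) (auto simp: less_le axis_eq_0_iff)
    qed
    from filterlim_compose[OF has_derivative_iff_norm[THEN iffD1, OF D, THEN conjunct2] this]
    have "(\<lambda>m. norm (f (x + t m *\<^sub>R ?a) - f x - ?D (t m *\<^sub>R ?a)) / norm (t m *\<^sub>R ?a)) \<longlonglongrightarrow> 0"
      by simp
    also have "(\<lambda>m. norm (f (x + t m *\<^sub>R ?a) - f x - ?D (t m *\<^sub>R ?a)) / norm (t m *\<^sub>R ?a)) =
       (\<lambda>m. norm (g m x - pderiv_at i f x))"
    proof
      fix m
      have "?D (t m *\<^sub>R ?a) = of_real (t m) * pderiv_at i f x"
        using linear_scale[OF has_derivative_linear[OF D], of "t m" ?a] by (simp add: pderiv_at_def scaleR_conv_of_real)
      then have "g m x - pderiv_at i f x = (f (x + t m *\<^sub>R ?a) - f x - ?D (t m *\<^sub>R ?a)) / of_real (t m)"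
        using t[of m] by (simp add: g_def field_simps)
      then show "norm (f (x + t m *\<^sub>R ?a) - f x - ?D (t m *\<^sub>R ?a)) / norm (t m *\<^sub>R ?a) = norm (g m x - pderiv_at i f x)"
        using t[of m] by (simp add: norm_divide)
    qed
    finally show ?thesis by (simp add: LIM_zero_iff tendsto_norm_zero_iff)
  qed
  have gm [measurable]: "g m \<in> borel_measurable borel" for m
    unfolding g_def by measurable
  have "(\<lambda>m. LINT x|lborel. ?e x * g m x) \<longlonglongrightarrow> (LINT x|lborel. ?e x * pderiv_at i f x)"
  proof (rule integral_dominated_convergence)
    show "integrable lborel (\<lambda>x::real ^ 'n. K * (1 / (1 + norm x) ^ ?W))"
      by (intro integrable_mult_right integrable_weight)
    show "AE x in lborel. (\<lambda>m. ?e x * g m x) \<longlonglongrightarrow> ?e x * pderiv_at i f x"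
      by (intro AE_I2 tendsto_intros lim)
    show "AE x in lborel. norm (?e x * g m x) \<le> K * (1 / (1 + norm x) ^ ?W)" for m
    proof (rule AE_I2)
      fix x show "norm (?e x * g m x) \<le> K * (1 / (1 + norm x) ^ ?W)"
        using gb[of m x] unfolding norm_mult norm_iexp by simp
    qed
  qed measurable
  \<comment> \<open>Translating the integral moves the shift from \<open>f\<close> to the
    exponential, where it becomes a scalar phase; the integrals are thus difference quotients of an
    exponential at 0, times the transform of \<open>f\<close>.\<close>
  moreover have "(LINT x|lborel. ?e x * g m x) = (exp (of_real (t m) * (\<i> * of_real (\<xi> $ i))) - 1) / of_real (t m) * fourier f \<xi>" for m
  proof -
    let ?c = "exp (of_real (t m) * (\<i> * of_real (\<xi> $ i)))"
    have i1: "integrable lborel (\<lambda>x. ?e x * f x)"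
      by (intro integrable_iexp_mult schwartz_integrable assms)
    have tr: "?e x * f (t m *\<^sub>R ?a + x) = ?c * (?e (t m *\<^sub>R ?a + x) * f (t m *\<^sub>R ?a + x))" for x
    proof -
      have "?c * ?e (t m *\<^sub>R ?a + x) = ?e x"
        by (simp add: inner_add_left inner_axis' exp_add[symmetric] algebra_simps)
      then show ?thesis by (simp only: mult.assoc[symmetric])
    qed
    have i2: "integrable lborel (\<lambda>x. ?e x * f (t m *\<^sub>R ?a + x))"
    proof -
      have "(\<lambda>x. f (t m *\<^sub>R ?a + x)) = (\<lambda>x. f x + of_real (t m) * g m x)"
        using t[of m] by (auto simp: g_def)
      moreover have "integrable lborel (\<lambda>x. f x + of_real (t m) * g m x)"
        by (intro Bochner_Integration.integrable_add schwartz_integrable[OF assms] integrable_mult_right integrable_decay[OF gm gb])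
      ultimately show ?thesis by (intro integrable_iexp_mult) simp
    qed
    have "(LINT x|lborel. ?e x * f (t m *\<^sub>R ?a + x)) = ?c * (LINT x|lborel. ?e (t m *\<^sub>R ?a + x) * f (t m *\<^sub>R ?a + x))"
      unfolding tr by simp
    also have "\<dots> = ?c * fourier f \<xi>"
      unfolding fourier_def by (subst lborel_integral_translate[where f = "\<lambda>x. ?e x * f x"]) auto
    finally have e1: "(LINT x|lborel. ?e x * f (t m *\<^sub>R ?a + x)) = ?c * fourier f \<xi>" .
    have "(LINT x|lborel. ?e x * g m x) = (LINT x|lborel. (?e x * f (t m *\<^sub>R ?a + x) - ?e x * f x) / of_real (t m))"
      by (simp add: g_def algebra_simps diff_divide_distrib)
    also have "\<dots> = ((LINT x|lborel. ?e x * f (t m *\<^sub>R ?a + x)) - (LINT x|lborel. ?e x * f x)) / of_real (t m)"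
      by (simp only: integral_divide_zero Bochner_Integration.integral_diff[OF i2 i1])
    also have "\<dots> = (?c - 1) / of_real (t m) * fourier f \<xi>"
      unfolding e1 by (simp add: fourier_def algebra_simps diff_divide_distrib)
    finally show ?thesis .
  qed
  moreover have "(\<lambda>m. (exp (of_real (t m) * (\<i> * of_real (\<xi> $ i))) - 1) / of_real (t m) * fourier f \<xi>)
    \<longlonglongrightarrow> \<i> * of_real (\<xi> $ i) * fourier f \<xi>"
  proof (intro tendsto_intros)
    let ?w = "\<i> * complex_of_real (\<xi> $ i)"
    have "((\<lambda>z. exp (z * ?w)) has_field_derivative ?w) (at 0)"
      by (auto intro!: derivative_eq_intros)
    then have d: "((\<lambda>h. (exp (h * ?w) - 1) / h) \<longlongrightarrow> ?w) (at 0)"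
      by (simp add: DERIV_def)
    have "filterlim (\<lambda>m. complex_of_real (t m)) (at 0) sequentially"
      using t tendsto_of_real[OF t0] by (intro filterlim_atI always_eventually) (auto simp: less_le)
    from filterlim_compose[OF d this]
    show "(\<lambda>m. (exp (of_real (t m) * ?w) - 1) / of_real (t m)) \<longlonglongrightarrow> ?w" .
  qed
  ultimately show ?thesis
    unfolding fourier_def[of "pderiv_at i f"] using LIMSEQ_unique by simp
qed

text \<open>Each power of the weight is traded for one derivative of the function by
  \<open>fourier_pderiv_at\<close>, and derivatives of the transform for coordinate factors by
  \<open>pderivs_fourier\<close>. Both operations preserve bounded families, and at order zero the
  L1 norm bounds the transform.\<close>

lemma sbdd_fourier:
  fixes F :: "'b \<Rightarrow> real ^ 'n \<Rightarrow> complex"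
  assumes "sbdd F" shows "sbdd (\<lambda>b. fourier (F b))"
proof -
  \<comment> \<open>The l1 weight is used because \<open>\<bar>\<xi> $ i\<bar>\<close> times the
    modulus of the transform is exactly the modulus of another transform, so the induction step
    starts from an identity; the Euclidean weight is dominated at the end.\<close>
  have w: "\<exists>C. \<forall>b \<xi>. (1 + (\<Sum>i\<in>UNIV. \<bar>\<xi> $ i\<bar>)) ^ k * norm (fourier (G b) \<xi>) \<le> C"
    if "sbdd G" for k and G :: "'b \<Rightarrow> real ^ 'n \<Rightarrow> complex"
    using that
  proof (induct k arbitrary: G)
    case 0
    obtain C where "\<And>b. (LINT x|lborel. norm (G b x)) \<le> C" using sbdd_integral_bound[OF 0] by blast
    then have "norm (fourier (G b) \<xi>) \<le> C" for b \<xi>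
      using order_trans[OF fourier_bound[OF schwartz_integrable[OF sbdd_schwartz[OF 0]]]] by blast
    then show ?case by auto
  next
    case (Suc k)
    obtain C where C: "\<And>b \<xi>. (1 + (\<Sum>i\<in>UNIV. \<bar>\<xi> $ i\<bar>)) ^ k * norm (fourier (G b) \<xi>) \<le> C"
      using Suc by blast
    have "\<forall>i. \<exists>D. \<forall>b \<xi>. (1 + (\<Sum>i\<in>UNIV. \<bar>\<xi> $ i\<bar>)) ^ k * norm (fourier (pderiv_at i (G b)) \<xi>) \<le> D"
      using Suc(1)[OF sbdd_pderiv_at[OF Suc(2)]] by blast
    then obtain D where D: "\<And>i b \<xi>. (1 + (\<Sum>i\<in>UNIV. \<bar>\<xi> $ i\<bar>)) ^ k * norm (fourier (pderiv_at i (G b)) \<xi>) \<le> D i"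
      by metis
    have "(1 + (\<Sum>i\<in>UNIV. \<bar>\<xi> $ i\<bar>)) ^ Suc k * norm (fourier (G b) \<xi>) \<le> C + (\<Sum>i\<in>UNIV. D i)" for b \<xi>
    proof -
      let ?w = "(1 + (\<Sum>i\<in>UNIV. \<bar>\<xi> $ i\<bar>)) ^ k"
      have "(1 + (\<Sum>i\<in>UNIV. \<bar>\<xi> $ i\<bar>)) ^ Suc k * norm (fourier (G b) \<xi>) =
        ?w * norm (fourier (G b) \<xi>) + (\<Sum>i\<in>UNIV. ?w * norm (fourier (pderiv_at i (G b)) \<xi>))"
        by (simp add: fourier_pderiv_at sbdd_schwartz[OF Suc(2)] norm_mult distrib_right distrib_left
            sum_distrib_left sum_distrib_right mult_ac)
      also have "\<dots> \<le> C + (\<Sum>i\<in>UNIV. D i)"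
        by (intro add_mono sum_mono C D)
      finally show ?thesis .
    qed
    then show ?case by blast
  qed
  show ?thesis
    unfolding sbdd_def
  proof (intro conjI allI)
    show "smooth (fourier (F b))" for b
      using smooth_fourier sbdd_schwartz[OF assms] by blast
    fix k "is"
    obtain G where G: "sbdd G" "\<And>b. pderivs is (fourier (F b)) = fourier (G b)"
      using pderivs_fourier[OF assms] by metis
    obtain C where C: "\<And>b \<xi>. (1 + (\<Sum>i\<in>UNIV. \<bar>\<xi> $ i\<bar>)) ^ k * norm (fourier (G b) \<xi>) \<le> C"
      using w[OF G(1)] by blast
    have "(1 + norm \<xi>) ^ k * norm (fourier (G b) \<xi>) \<le> C" for b \<xi>
      using norm_le_l1_cart[of \<xi>] by (intro order_trans[OF _ C[of \<xi> b]] mult_right_mono power_mono) auto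
    then show "\<exists>C. \<forall>b x. (1 + norm x) ^ k * norm (pderivs is (fourier (F b)) x) \<le> C"
      using G(2) by auto
  qed
qed

section \<open>Fourier inversion\<close>

lemma Basis_cart: "(Basis :: (real ^ 'n) set) = (\<lambda>i. axis i 1) ` UNIV"
  by (auto simp: Basis_vec_def)

lemma diag_affine_eq:
  "t + (\<Sum>j\<in>Basis. ((d \<bullet> j) * (x \<bullet> j)) *\<^sub>R j) = t + diag d (x :: real ^ 'n)"
proof -
  have "(\<Sum>j\<in>Basis. ((d \<bullet> j) * (x \<bullet> j)) *\<^sub>R j) = diag d x"
  proof (rule euclidean_eqI)
    fix b :: "real ^ 'n" assume b: "b \<in> Basis"
    then obtain i where i: "b = axis i 1" by (auto simp: Basis_cart)
    have "(\<Sum>j\<in>Basis. ((d \<bullet> j) * (x \<bullet> j)) *\<^sub>R j) \<bullet> b = (d \<bullet> b) * (x \<bullet> b)"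
      using b by (simp add: inner_sum_left_Basis)
    then show "(\<Sum>j\<in>Basis. ((d \<bullet> j) * (x \<bullet> j)) *\<^sub>R j) \<bullet> b = diag d x \<bullet> b"
      by (simp add: i inner_axis)
  qed
  then show ?thesis by simp
qed

lemma lborel_diag:
  fixes d t :: "real ^ 'n"
  assumes "\<And>i. d $ i \<noteq> 0"
  shows "lborel = density (distr lborel borel (\<lambda>x. t + diag d x)) (\<lambda>_. ennreal (\<Prod>i\<in>UNIV. \<bar>d $ i\<bar>))"
proof -
  have "(\<Prod>j\<in>(Basis :: (real ^ 'n) set). \<bar>d \<bullet> j\<bar>) = (\<Prod>i\<in>UNIV. \<bar>d $ i\<bar>)"
    unfolding Basis_cart by (subst prod.reindex) (auto simp: inj_on_def axis_eq_axis inner_axis)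
  moreover have "d \<bullet> j \<noteq> 0" if "j \<in> Basis" for j
    using that assms by (auto simp: Basis_cart inner_axis)
  ultimately show ?thesis
    using lborel_affine_euclidean[of "\<lambda>j. d \<bullet> j" t] by (simp add: diag_affine_eq)
qed

lemma nn_integral_diag:
  fixes d t :: "real ^ 'n"
  assumes d: "\<And>i. d $ i \<noteq> 0" and [measurable]: "f \<in> borel_measurable borel"
  shows "ennreal (\<Prod>i\<in>UNIV. \<bar>d $ i\<bar>) * (\<integral>\<^sup>+x. f (t + diag d x) \<partial>lborel) = (\<integral>\<^sup>+x. f x \<partial>lborel)"
proof -
  have "(\<integral>\<^sup>+x. f x \<partial>lborel) = (\<integral>\<^sup>+x. f x \<partial>density (distr lborel borel (\<lambda>x. t + diag d x)) (\<lambda>_. ennreal (\<Prod>i\<in>UNIV. \<bar>d $ i\<bar>)))"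
    by (subst lborel_diag[OF d, of t]) rule
  then show ?thesis
    by (simp add: nn_integral_density nn_integral_distr nn_integral_cmult)
qed

lemma lborel_integral_diag:
  fixes d t :: "real ^ 'n" and f :: "real ^ 'n \<Rightarrow> complex"
  assumes d: "\<And>i. d $ i \<noteq> 0" and [measurable]: "f \<in> borel_measurable borel"
  shows "of_real (\<Prod>i\<in>UNIV. \<bar>d $ i\<bar>) * (LINT x|lborel. f (t + diag d x)) = (LINT x|lborel. f x)"
proof -
  have "(LINT x|lborel. f x) = (LINT x|density (distr lborel borel (\<lambda>x. t + diag d x)) (\<lambda>_. ennreal (\<Prod>i\<in>UNIV. \<bar>d $ i\<bar>)). f x)"
    by (subst lborel_diag[OF d, of t]) rule
  also have "\<dots> = (LINT x|distr lborel borel (\<lambda>x. t + diag d x). (\<Prod>i\<in>UNIV. \<bar>d $ i\<bar>) *\<^sub>R f x)"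
    by (rule integral_density) (auto simp: prod_nonneg)
  also have "\<dots> = (LINT x|lborel. (\<Prod>i\<in>UNIV. \<bar>d $ i\<bar>) *\<^sub>R f (t + diag d x))"
    by (rule integral_distr) auto
  finally show ?thesis by (simp add: scaleR_conv_of_real)
qed

lemma lborel_integral_reflect:
  fixes f :: "real ^ 'n \<Rightarrow> complex"
  assumes [measurable]: "f \<in> borel_measurable borel"
  shows "(LINT x|lborel. f (t - x)) = (LINT x|lborel. f x)"
  using lborel_integral_diag[of "\<chi> i. - 1" f t] by (simp add: diag_const)

text \<open>Fubini for a symmetric kernel; the modulus of the integrand is a product of two
  integrable functions.\<close>

lemma fourier_integral_exchange:
  fixes f g :: "real ^ 'n \<Rightarrow> complex"
  assumes f: "integrable lborel f" and g: "integrable lborel g"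
  shows "(LINT \<xi>|lborel. fourier f \<xi> * g \<xi>) = (LINT x|lborel. f x * fourier g x)"
proof -
  note [measurable] = borel_measurable_integrable[OF f] borel_measurable_integrable[OF g]
  let ?h = "\<lambda>x \<xi>. exp (- \<i> * complex_of_real (x \<bullet> \<xi>)) * f x * g \<xi>"
  have [measurable]: "(\<lambda>p::(real ^ 'n) \<times> (real ^ 'n). exp (- \<i> * complex_of_real (fst p \<bullet> snd p))) \<in> borel_measurable borel"
    by (intro borel_measurable_continuous_onI continuous_intros)
  then have [measurable]: "(\<lambda>p::(real ^ 'n) \<times> (real ^ 'n). exp (- \<i> * complex_of_real (fst p \<bullet> snd p))) \<in> borel_measurable (lborel \<Otimes>\<^sub>M lborel)"
    by (simp add: lborel_prod)
  have m: "case_prod ?h \<in> borel_measurable (lborel \<Otimes>\<^sub>M lborel)"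
    unfolding split_beta' by measurable
  have n: "norm (?h x \<xi>) = norm (f x) * norm (g \<xi>)" for x \<xi>
    unfolding norm_mult norm_iexp by simp
  have i: "integrable (lborel \<Otimes>\<^sub>M lborel) (case_prod ?h)"
  proof (rule lborel_pair.Fubini_integrable[OF m])
    show "integrable lborel (\<lambda>x. LINT y|lborel. norm (case_prod ?h (x, y)))"
      unfolding split_conv n using f g by (simp add: integrable_norm)
    have "integrable lborel (?h x)" for x
      using integrable_mult_right[OF integrable_iexp_mult(1)[OF g, of x], of "f x"] by (simp add: inner_commute mult_ac)
    then show "AE x in lborel. integrable lborel (\<lambda>y. case_prod ?h (x, y))" by simp
  qed
  have "(LINT \<xi>|lborel. fourier f \<xi> * g \<xi>) = (LINT \<xi>|lborel. LINT x|lborel. ?h x \<xi>)"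
    by (simp add: fourier_def)
  also have "\<dots> = (LINT x|lborel. LINT \<xi>|lborel. ?h x \<xi>)"
    by (rule lborel_pair.Fubini_integral[OF i])
  also have "\<dots> = (LINT x|lborel. f x * fourier g x)"
    by (simp add: fourier_def inner_commute mult_ac)
  finally show ?thesis .
qed

section \<open>The Gaussian and its Fourier transform\<close>

lemma lborel_integral_prod:
  fixes f :: "real ^ 'n \<Rightarrow> real \<Rightarrow> complex"
  assumes "\<And>b. b \<in> Basis \<Longrightarrow> integrable lborel (f b)"
  shows "integrable lborel (\<lambda>x. \<Prod>b\<in>Basis. f b (x \<bullet> b))"
    and "(LINT x|lborel. (\<Prod>b\<in>Basis. f b (x \<bullet> b))) = (\<Prod>b\<in>Basis. (LINT t|lborel. f b t))"
proof -
  interpret product_sigma_finite "\<lambda>b::real ^ 'n. lborel :: real measure" by standard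
  have [measurable]: "f b \<in> borel_measurable borel" if "b \<in> Basis" for b
    using borel_measurable_integrable[OF assms[OF that]] by simp
  have T: "(\<lambda>f. \<Sum>b\<in>Basis. f b *\<^sub>R b) \<in> measurable (\<Pi>\<^sub>M b\<in>(Basis::(real ^ 'n) set). lborel) borel"
    by measurable
  have eq: "(\<Prod>b\<in>Basis. f b ((\<Sum>b\<in>Basis. x b *\<^sub>R b) \<bullet> b)) = (\<Prod>b\<in>Basis. f b (x b))" for x :: "real ^ 'n \<Rightarrow> real"
    by (rule prod.cong) auto
  have m: "(\<lambda>x. \<Prod>b\<in>Basis. f b (x \<bullet> b)) \<in> borel_measurable borel"
    by measurable
  show "integrable lborel (\<lambda>x. \<Prod>b\<in>Basis. f b (x \<bullet> b))"
    unfolding lborel_eq[where 'a = "real ^ 'n"] integrable_distr_eq[OF T m] eq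
    by (rule product_integrable_prod) (auto intro: assms)
  show "(LINT x|lborel. (\<Prod>b\<in>Basis. f b (x \<bullet> b))) = (\<Prod>b\<in>Basis. (LINT t|lborel. f b t))"
    unfolding lborel_eq[where 'a = "real ^ 'n"] integral_distr[OF T m] eq
    by (rule product_integral_prod) (auto intro: assms)
qed

text \<open>Read off from the characteristic function of the standard normal distribution, taken at
  \<open>- s\<close> because of the sign convention of \<open>fourier\<close>;
  \<open>sqrt (2 * pi)\<close> undoes the normalisation of the density.\<close>

lemma gaussian_fourier_1d:
  "integrable lborel (\<lambda>t. exp (- \<i> * of_real (t * s)) * complex_of_real (exp (- t\<^sup>2 / 2)))"
  "(LINT t|lborel. exp (- \<i> * of_real (t * s)) * complex_of_real (exp (- t\<^sup>2 / 2))) = of_real (sqrt (2 * pi) * exp (- s\<^sup>2 / 2))"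
proof -
  have c: "sqrt (2 * pi) * std_normal_density t = exp (- t\<^sup>2 / 2)" for t
    by (simp add: std_normal_density_def)
  have "integrable lborel (\<lambda>t. sqrt (2 * pi) * (std_normal_density t * t ^ 0))"
    by (intro integrable_mult_right integrable_std_normal_moment)
  then have i: "integrable lborel (\<lambda>t. exp (- t\<^sup>2 / 2) :: real)"
    by (simp add: c)
  show "integrable lborel (\<lambda>t. exp (- \<i> * of_real (t * s)) * complex_of_real (exp (- t\<^sup>2 / 2)))"
  proof (rule Bochner_Integration.integrable_bound[OF i])
    show "AE t in lborel. norm (exp (- \<i> * of_real (t * s)) * complex_of_real (exp (- t\<^sup>2 / 2))) \<le> norm (exp (- t\<^sup>2 / 2) :: real)"
      unfolding norm_mult norm_iexp by simp
  qed measurable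
  have "of_real (exp (- (- s)\<^sup>2 / 2)) = char std_normal_distribution (- s)"
    by (simp add: char_std_normal_distribution)
  also have "\<dots> = (LINT t|lborel. std_normal_density t *\<^sub>R exp (\<i> * of_real (- s * t)))"
    unfolding char_def by (subst integral_density) auto
  finally have e: "of_real (exp (- s\<^sup>2 / 2)) = (LINT t|lborel. std_normal_density t *\<^sub>R exp (- \<i> * of_real (t * s)))"
    by (simp add: mult_ac)
  have "(LINT t|lborel. exp (- \<i> * of_real (t * s)) * complex_of_real (exp (- t\<^sup>2 / 2)))
    = (LINT t|lborel. of_real (sqrt (2 * pi)) * (std_normal_density t *\<^sub>R exp (- \<i> * of_real (t * s))))"
    unfolding c[symmetric] by (simp add: scaleR_conv_of_real mult_ac)
  also have "\<dots> = of_real (sqrt (2 * pi)) * of_real (exp (- s\<^sup>2 / 2))"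
    unfolding e by (rule integral_mult_right_zero)
  finally show "(LINT t|lborel. exp (- \<i> * of_real (t * s)) * complex_of_real (exp (- t\<^sup>2 / 2))) = of_real (sqrt (2 * pi) * exp (- s\<^sup>2 / 2))"
    by simp
qed

definition gaussian :: "real ^ 'n \<Rightarrow> complex"
  where "gaussian x = of_real (exp (- (norm x)\<^sup>2 / 2))"

lemma gaussian_measurable [measurable]: "gaussian \<in> borel_measurable borel"
  unfolding gaussian_def by measurable

lemma gaussian_prod:
  "exp (- \<i> * of_real (x \<bullet> \<xi>)) * gaussian x
    = (\<Prod>b\<in>Basis. exp (- \<i> * of_real ((x \<bullet> b) * (\<xi> \<bullet> b))) * complex_of_real (exp (- (x \<bullet> b)\<^sup>2 / 2)))"
proof -
  have "(norm x)\<^sup>2 = (\<Sum>b\<in>Basis. (x \<bullet> b)\<^sup>2)"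
    by (subst power2_norm_eq_inner, subst euclidean_inner) (simp add: power2_eq_square)
  moreover have "x \<bullet> \<xi> = (\<Sum>b\<in>Basis. (x \<bullet> b) * (\<xi> \<bullet> b))"
    by (rule euclidean_inner)
  ultimately show ?thesis
    by (simp add: gaussian_def prod.distrib exp_sum[symmetric] of_real_prod[symmetric] sum_negf[symmetric]
        sum_divide_distrib sum_distrib_left del: of_real_prod of_real_exp)
qed

lemma gaussian_integrable: "integrable lborel (gaussian :: real ^ 'n \<Rightarrow> complex)"
  and fourier_gaussian: "fourier gaussian (\<xi> :: real ^ 'n) = of_real (sqrt (2 * pi) ^ CARD('n)) * gaussian \<xi>"
proof -
  have i: "integrable lborel (\<lambda>x. exp (- \<i> * of_real (x \<bullet> \<xi>)) * gaussian x)" for \<xi> :: "real ^ 'n"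
    unfolding gaussian_prod by (rule lborel_integral_prod(1)) (rule gaussian_fourier_1d(1))
  from i[of 0] show "integrable lborel (gaussian :: real ^ 'n \<Rightarrow> complex)" by simp
  have "fourier gaussian \<xi> = (\<Prod>b\<in>(Basis :: (real ^ 'n) set). of_real (sqrt (2 * pi) * exp (- (\<xi> \<bullet> b)\<^sup>2 / 2)))"
    unfolding fourier_def gaussian_prod
    by (subst lborel_integral_prod(2)) (simp_all only: gaussian_fourier_1d)
  also have "\<dots> = of_real (sqrt (2 * pi) ^ CARD('n)) * (exp (- \<i> * of_real (\<xi> \<bullet> 0)) * gaussian \<xi>)"
    unfolding gaussian_prod by (simp add: prod.distrib)
  finally show "fourier gaussian \<xi> = of_real (sqrt (2 * pi) ^ CARD('n)) * gaussian \<xi>" by simp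
qed

lemma integral_fourier_gaussian:
  "(LINT \<xi>|lborel. fourier gaussian (\<xi> :: real ^ 'n)) = of_real ((2 * pi) ^ CARD('n))"
proof -
  have "(LINT x|lborel. gaussian (x :: real ^ 'n)) = fourier gaussian (0 :: real ^ 'n)"
    by (simp add: fourier_def)
  also have "\<dots> = of_real (sqrt (2 * pi) ^ CARD('n))"
    by (simp add: fourier_gaussian gaussian_def)
  finally have "(LINT x|lborel. gaussian (x :: real ^ 'n)) = of_real (sqrt (2 * pi) ^ CARD('n))" .
  then have "(LINT \<xi>|lborel. fourier gaussian (\<xi> :: real ^ 'n)) = of_real (sqrt (2 * pi) ^ CARD('n) * sqrt (2 * pi) ^ CARD('n))"
    unfolding fourier_gaussian integral_mult_right_zero by simp
  also have "sqrt (2 * pi) ^ CARD('n) * sqrt (2 * pi) ^ CARD('n) = (2 * pi) ^ CARD('n)"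
    unfolding power_mult_distrib[symmetric] by (subst real_sqrt_mult_self) simp
  finally show ?thesis .
qed

text \<open>The plain exponential is not integrable, so the transform cannot be moved onto it by
  Fubini; a Gaussian factor repairs this. After the exchange and the substitution
  \<open>y = x + t m *\<^sub>R z\<close> the integral averages \<open>f\<close> near
  \<open>x\<close> against a fixed Gaussian, and both sides converge by domination as the damping
  disappears.\<close>

lemma fourier_inversion_integral:
  fixes f :: "real ^ 'n \<Rightarrow> complex"
  assumes f: "f \<in> schwartz"
  shows "(LINT \<xi>|lborel. exp (\<i> * of_real (x \<bullet> \<xi>)) * fourier f \<xi>) = of_real ((2 * pi) ^ CARD('n)) * f x"
proof -
  define t where "t m = 1 / real (Suc m)" for m
  have t: "0 < t m" for m by (auto simp: t_def)
  have t0: "t \<longlonglongrightarrow> 0" unfolding t_def by (rule LIMSEQ_Suc[OF lim_1_over_n])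
  let ?G = "gaussian :: real ^ 'n \<Rightarrow> complex"
  let ?e = "\<lambda>\<xi>. exp (\<i> * complex_of_real (x \<bullet> \<xi>))"
  define g where "g m \<xi> = ?e \<xi> * ?G (t m *\<^sub>R \<xi>)" for m \<xi>
  have "fourier f \<in> schwartz"
    using sbdd_schwartz[OF sbdd_fourier[OF sbdd_of_schwartz[OF f]]] .
  then have fi: "integrable lborel (fourier f)" by (rule schwartz_integrable)
  note [measurable] = borel_measurable_integrable[OF fi] schwartz_measurable[OF f]
  have [measurable]: "?e \<in> borel_measurable borel"
    by (intro borel_measurable_continuous_onI continuous_intros)
  have dil: "diag (\<chi> i. t m) \<xi> = t m *\<^sub>R \<xi>" for m and \<xi> :: "real ^ 'n" by (rule diag_const)
  have Gi: "integrable lborel (\<lambda>\<xi>. ?G (t m *\<^sub>R \<xi>))" for m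
  proof (rule integrableI_bounded)
    have "ennreal (\<Prod>i\<in>(UNIV::'n set). \<bar>t m\<bar>) * (\<integral>\<^sup>+\<xi>. ennreal (norm (?G (t m *\<^sub>R \<xi>))) \<partial>lborel) = (\<integral>\<^sup>+\<xi>. ennreal (norm (?G \<xi>)) \<partial>lborel)"
      using nn_integral_diag[of "\<chi> i. t m" "\<lambda>\<xi>. ennreal (norm (?G \<xi>))" 0] t[of m] by (simp add: dil)
    also have "\<dots> < \<infinity>" using gaussian_integrable by (simp add: integrable_iff_bounded)
    finally show "(\<integral>\<^sup>+\<xi>. ennreal (norm (?G (t m *\<^sub>R \<xi>))) \<partial>lborel) < \<infinity>"
      using t[of m] by (auto simp: ennreal_mult_less_top)
  qed measurable
  have gi: "integrable lborel (g m)" for m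
    unfolding g_def using integrable_iexp_mult(2)[OF Gi[of m], of x] by (simp add: inner_commute)
  \<comment> \<open>The transform of the damped exponential is a Gaussian of width
    \<open>t m\<close> around \<open>x\<close>. The factor \<open>t m ^ CARD('n)\<close> stays on
    the left, where the substitution in \<open>step\<close> consumes it.\<close>
  have Fg: "of_real (t m ^ CARD('n)) * fourier (g m) y = fourier ?G ((y - x) /\<^sub>R t m)" for m y
  proof -
    let ?h = "\<lambda>\<xi>. exp (- \<i> * of_real (\<xi> \<bullet> ((y - x) /\<^sub>R t m))) * ?G \<xi>"
    have "of_real (\<Prod>i\<in>(UNIV::'n set). \<bar>t m\<bar>) * (LINT \<xi>|lborel. ?h (t m *\<^sub>R \<xi>)) = (LINT \<xi>|lborel. ?h \<xi>)"
      using lborel_integral_diag[of "\<chi> i. t m" ?h 0] t[of m] by (simp add: dil)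
    moreover have "?h (t m *\<^sub>R \<xi>) = exp (- \<i> * complex_of_real (\<xi> \<bullet> y)) * g m \<xi>" for \<xi>
    proof -
      have "t m *\<^sub>R \<xi> \<bullet> ((y - x) /\<^sub>R t m) = \<xi> \<bullet> y - x \<bullet> \<xi>"
        using t[of m] by (simp add: inner_diff_right inner_commute)
      then show ?thesis by (simp add: g_def exp_add[symmetric] mult.assoc[symmetric] right_diff_distrib)
    qed
    ultimately show ?thesis using t[of m] by (simp add: fourier_def)
  qed
  have [measurable]: "fourier (g m) \<in> borel_measurable borel" for m
  proof -
    have "fourier (g m) = (\<lambda>y. of_real (inverse (t m ^ CARD('n))) * fourier ?G ((y - x) /\<^sub>R t m))"
      unfolding Fg[symmetric] using t[of m] by (auto simp: fun_eq_iff)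
    also have "\<dots> \<in> borel_measurable borel"
      unfolding fourier_gaussian by measurable
    finally show ?thesis .
  qed
  have step: "(LINT \<xi>|lborel. fourier f \<xi> * g m \<xi>) = (LINT z|lborel. f (x + t m *\<^sub>R z) * fourier ?G z)" for m
  proof -
    have "(LINT \<xi>|lborel. fourier f \<xi> * g m \<xi>) = (LINT y|lborel. f y * fourier (g m) y)"
      by (rule fourier_integral_exchange[OF schwartz_integrable[OF f] gi])
    also have "\<dots> = of_real (t m ^ CARD('n)) * (LINT z|lborel. f (x + t m *\<^sub>R z) * fourier (g m) (x + t m *\<^sub>R z))"
      using lborel_integral_diag[of "\<chi> i. t m" "\<lambda>y. f y * fourier (g m) y" x] t[of m] by (simp add: dil)
    also have "\<dots> = (LINT z|lborel. f (x + t m *\<^sub>R z) * (of_real (t m ^ CARD('n)) * fourier (g m) (x + t m *\<^sub>R z)))"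
      by (subst integral_mult_right_zero[symmetric]) (simp add: mult_ac)
    also have "\<dots> = (LINT z|lborel. f (x + t m *\<^sub>R z) * fourier ?G z)"
      unfolding Fg using t[of m] by (simp add: less_imp_neq[THEN not_sym])
    finally show ?thesis .
  qed
  have "(\<lambda>m. LINT \<xi>|lborel. fourier f \<xi> * g m \<xi>) \<longlonglongrightarrow> (LINT \<xi>|lborel. fourier f \<xi> * ?e \<xi>)"
  proof (rule integral_dominated_convergence)
    show "integrable lborel (\<lambda>\<xi>. norm (fourier f \<xi>))" using fi by (rule integrable_norm)
    have "(\<lambda>m. g m \<xi>) \<longlonglongrightarrow> ?e \<xi> * of_real (exp (- (norm (0 *\<^sub>R \<xi>))\<^sup>2 / 2))" for \<xi>
      unfolding g_def gaussian_def by (intro tendsto_intros t0) auto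
    then show "AE \<xi> in lborel. (\<lambda>m. fourier f \<xi> * g m \<xi>) \<longlonglongrightarrow> fourier f \<xi> * ?e \<xi>"
      by (intro AE_I2 tendsto_intros) simp
    fix m show "AE \<xi> in lborel. norm (fourier f \<xi> * g m \<xi>) \<le> norm (fourier f \<xi>)"
      by (intro AE_I2) (simp only: g_def norm_mult norm_iexp, simp add: gaussian_def mult_left_le)
  qed (auto simp: g_def)
  moreover have "(\<lambda>m. LINT z|lborel. f (x + t m *\<^sub>R z) * fourier ?G z) \<longlonglongrightarrow> (LINT z|lborel. f x * fourier ?G z)"
  proof -
    obtain B where B: "\<And>x. norm (f x) \<le> B"
      using sbdd_bound0[OF sbdd_of_schwartz[OF f], of 0] by (metis div_by_1 power_0)
    show ?thesis
    proof (rule integral_dominated_convergence)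
      have "integrable lborel (fourier ?G)"
        unfolding fourier_gaussian[abs_def] by (intro integrable_mult_right gaussian_integrable)
      then show "integrable lborel (\<lambda>z. B * norm (fourier ?G z))" by (intro integrable_mult_right integrable_norm)
      have "(\<lambda>m. f (x + t m *\<^sub>R z)) \<longlonglongrightarrow> f (x + 0 *\<^sub>R z)" for z
        using smooth_continuous[OF schwartz_smooth[OF f], of UNIV]
        by (intro continuous_on_tendsto_compose[where f = f] tendsto_intros t0) auto
      then show "AE z in lborel. (\<lambda>m. f (x + t m *\<^sub>R z) * fourier ?G z) \<longlonglongrightarrow> f x * fourier ?G z"
        by (intro AE_I2 tendsto_intros) simp
      fix m show "AE z in lborel. norm (f (x + t m *\<^sub>R z) * fourier ?G z) \<le> B * norm (fourier ?G z)"
        using B by (intro AE_I2) (simp add: norm_mult mult_right_mono)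
    qed (auto simp: fourier_gaussian)
  qed
  ultimately have "(LINT \<xi>|lborel. fourier f \<xi> * ?e \<xi>) = (LINT z|lborel. f x * fourier ?G z)"
    unfolding step by (rule LIMSEQ_unique)
  then show ?thesis by (simp add: integral_fourier_gaussian mult_ac)
qed

text \<open>Lets the inverse transform inherit the properties of \<open>fourier\<close> through
  reflection.\<close>

lemma inv_fourier_eq:
  "inv_fourier f x = of_real (1 / (2 * pi) ^ CARD('n)) * fourier f (- (x :: real ^ 'n))"
  by (simp add: inv_fourier_def fourier_def inner_commute)

lemma inv_fourier_fourier: "f \<in> schwartz \<Longrightarrow> inv_fourier (fourier f) = f"
  by (rule ext) (simp add: inv_fourier_def fourier_inversion_integral)

lemma fourier_inv_fourier:
  fixes f :: "real ^ 'n \<Rightarrow> complex"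
  assumes "f \<in> schwartz" shows "fourier (inv_fourier f) = f"
proof
  fix x :: "real ^ 'n"
  have "fourier f \<in> schwartz"
    using sbdd_schwartz[OF sbdd_fourier[OF sbdd_of_schwartz[OF assms]]] .
  note [measurable] = schwartz_measurable[OF this]
  let ?c = "of_real (1 / (2 * pi) ^ CARD('n)) :: complex"
  let ?h = "\<lambda>y. exp (\<i> * of_real (y \<bullet> x)) * fourier f y"
  have "fourier (inv_fourier f) x = (LINT y|lborel. ?c * ?h (0 - y))"
    unfolding fourier_def[of "inv_fourier f" x]
    by (rule Bochner_Integration.integral_cong) (simp_all add: inv_fourier_eq)
  also have "\<dots> = ?c * (LINT y|lborel. ?h y)"
    unfolding integral_mult_right_zero by (subst lborel_integral_reflect) auto
  also have "\<dots> = f x"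
    using fourier_inversion_integral[OF assms, of x] by (simp add: inner_commute)
  finally show "fourier (inv_fourier f) x = f x" .
qed

lemma sbdd_reflect:
  fixes F :: "'a \<Rightarrow> real ^ 'b \<Rightarrow> complex"
  shows "sbdd F \<Longrightarrow> sbdd (\<lambda>b x. F b (- x))"
  unfolding sbdd_def
proof (intro conjI allI)
  assume *: "(\<forall>b. smooth (F b)) \<and> (\<forall>k is. \<exists>C. \<forall>b x. (1 + norm x) ^ k * norm (pderivs is (F b) x) \<le> C)"
  define d where "d = ((\<chi> i. - 1) :: real ^ 'b)"
  have d: "0 + diag d x = - x" for x by (simp add: d_def diag_const)
  have sm: "smooth (F b)" for b using * by blast
  show "smooth (\<lambda>x. F b (- x))" for b
    using smooth_affine[OF sm, of b 0 d] unfolding d .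
  fix k "is"
  obtain C where C: "\<And>b x. (1 + norm x) ^ k * norm (pderivs is (F b) x) \<le> C" using * by blast
  have p: "norm (of_real (\<Prod>i\<leftarrow>is. d $ i) :: complex) = 1"
    by (induct "is") (simp_all add: norm_mult d_def)
  have "norm (pderivs is (\<lambda>x. F b (0 + diag d x)) x) = norm (pderivs is (F b) (0 + diag d x))" for b x
    by (simp only: pderivs_affine[OF sm] norm_mult p mult_1_left)
  then have "(1 + norm x) ^ k * norm (pderivs is (\<lambda>x. F b (- x)) x) \<le> C" for b x
    using C[of "- x" b] unfolding d by simp
  then show "\<exists>C. \<forall>b x. (1 + norm x) ^ k * norm (pderivs is (\<lambda>x. F b (- x)) x) \<le> C" by blast
qed

lemma sbdd_inv_fourier:
  fixes F :: "'b \<Rightarrow> real ^ 'n \<Rightarrow> complex"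
  assumes "sbdd F" shows "sbdd (\<lambda>b. inv_fourier (F b))"
  unfolding inv_fourier_eq[abs_def]
  by (rule sbdd_cmult[OF _ sbdd_reflect[OF sbdd_fourier[OF assms]]]) (rule order_refl)

lemma schwartz_fourier: "f \<in> schwartz \<Longrightarrow> fourier f \<in> schwartz"
  and schwartz_inv_fourier: "f \<in> schwartz \<Longrightarrow> inv_fourier f \<in> schwartz"
  unfolding schwartz_iff_sbdd by (rule sbdd_fourier sbdd_inv_fourier, assumption)+

lemma inv_fourier_integral_exchange:
  fixes f g :: "real ^ 'n \<Rightarrow> complex"
  assumes f: "integrable lborel f" and g: "integrable lborel g"
    and [measurable]: "fourier f \<in> borel_measurable borel"
  shows "(LINT \<xi>|lborel. inv_fourier f \<xi> * g \<xi>) = (LINT x|lborel. f x * inv_fourier g x)"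
proof -
  note [measurable] = borel_measurable_integrable[OF f] borel_measurable_integrable[OF g]
  let ?c = "of_real (1 / (2 * pi) ^ CARD('n)) :: complex"
  have g': "integrable lborel (\<lambda>x. g (- x))"
  proof -
    have "(\<integral>\<^sup>+x. ennreal (norm (g (- x))) \<partial>lborel) = (\<integral>\<^sup>+x. ennreal (norm (g x)) \<partial>lborel)"
      using nn_integral_diag[of "\<chi> i. - 1" "\<lambda>x. ennreal (norm (g x))" 0] by (simp add: diag_const)
    then show ?thesis using g by (simp add: integrable_iff_bounded)
  qed
  have rg: "fourier (\<lambda>\<xi>. g (- \<xi>)) x = fourier g (- x)" for x
    unfolding fourier_def
    using lborel_integral_reflect[of "\<lambda>\<xi>. exp (- \<i> * of_real (\<xi> \<bullet> (- x))) * g \<xi>" 0] by simp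
  have "(LINT \<xi>|lborel. inv_fourier f \<xi> * g \<xi>) = ?c * (LINT \<xi>|lborel. (\<lambda>\<xi>. fourier f \<xi> * g (- \<xi>)) (0 - \<xi>))"
    unfolding integral_mult_right_zero[symmetric] inv_fourier_eq by (simp add: mult_ac)
  also have "\<dots> = ?c * (LINT \<xi>|lborel. fourier f \<xi> * g (- \<xi>))"
    by (subst lborel_integral_reflect) auto
  also have "\<dots> = ?c * (LINT x|lborel. f x * fourier (\<lambda>\<xi>. g (- \<xi>)) x)"
    by (simp only: fourier_integral_exchange[OF f g'])
  finally show ?thesis
    unfolding integral_mult_right_zero[symmetric] inv_fourier_eq rg by (simp add: mult_ac)
qed

text \<open>Moving the inverse transform from \<open>f\<close> onto the modulated
  \<open>\<Phi>\<close> produces a convolution of \<open>f\<close> with the transform of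
  \<open>\<Phi>\<close>. This is the origin of the kernel \<open>ker\<close> and of the reproducing
  estimates below.\<close>

lemma fourier_mult_inv_fourier:
  fixes f \<Phi> :: "real ^ 'n \<Rightarrow> complex"
  assumes f: "f \<in> schwartz" and \<Phi>: "\<Phi> \<in> schwartz"
  shows "fourier (\<lambda>\<xi>. \<Phi> \<xi> * inv_fourier f \<xi>) x =
    (LINT y|lborel. f y * (of_real (1 / (2 * pi) ^ CARD('n)) * fourier \<Phi> (x - y)))"
proof -
  let ?g = "\<lambda>\<xi>. exp (- \<i> * of_real (\<xi> \<bullet> x)) * \<Phi> \<xi>"
  have "inv_fourier ?g y = of_real (1 / (2 * pi) ^ CARD('n)) * fourier \<Phi> (x - y)" for y
  proof -
    have e: "exp (\<i> * complex_of_real (y \<bullet> \<xi>)) * ?g \<xi> = exp (- \<i> * of_real (\<xi> \<bullet> (x - y))) * \<Phi> \<xi>" for \<xi>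
      by (simp add: mult.assoc[symmetric] exp_add[symmetric] inner_diff_right inner_commute right_diff_distrib)
    show ?thesis unfolding inv_fourier_def fourier_def by (simp only: e)
  qed
  moreover have "fourier (\<lambda>\<xi>. \<Phi> \<xi> * inv_fourier f \<xi>) x = (LINT \<xi>|lborel. inv_fourier f \<xi> * ?g \<xi>)"
    by (simp add: fourier_def mult_ac)
  moreover have "\<dots> = (LINT y|lborel. f y * inv_fourier ?g y)"
    by (intro inv_fourier_integral_exchange schwartz_integrable f integrable_iexp_mult \<Phi>)
       (simp add: schwartz_measurable schwartz_fourier f)
  ultimately show ?thesis by simp
qed

section \<open>The anisotropic distance function\<close>

lemma anisotropy_ge_1: "anisotropy a \<Longrightarrow> a $ i \<ge> 1"
  unfolding anisotropy_def by (metis Min_le finite finite_imageI rangeI)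

lemma aniso_dil_eq_diag: "aniso_dil a t = diag (\<chi> i. t powr (a $ i))"
  by (rule ext) (simp add: aniso_dil_def diag_def)

lemma aniso_dil_aniso_dil: "aniso_dil a s (aniso_dil a t x) = aniso_dil a (s * t) x" if "0 \<le> s" "0 \<le> t"
  using that by (simp add: aniso_dil_def powr_mult vec_eq_iff)

lemma norm_aniso_dil:
  fixes x :: "real ^ 'n"
  assumes "t > 0"
  shows "(norm (aniso_dil a (1 / t) x))\<^sup>2 = (\<Sum>i\<in>UNIV. (x $ i)\<^sup>2 / t powr (2 * a $ i))"
proof -
  have "(norm (aniso_dil a (1 / t) x))\<^sup>2 = (\<Sum>i\<in>UNIV. ((1 / t) powr (a $ i) * x $ i)\<^sup>2)"
    by (simp add: norm_vec_def L2_set_def aniso_dil_def sum_nonneg)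
  also have "\<dots> = (\<Sum>i\<in>UNIV. (x $ i)\<^sup>2 / t powr (2 * a $ i))"
    using assms by (intro sum.cong) (auto simp: power_mult_distrib powr_divide powr_power field_simps)
  finally show ?thesis .
qed

context
  fixes a :: "real ^ 'n"
  assumes a: "anisotropy a"
begin

lemma aniso_sum_strict_antimono:
  assumes "x \<noteq> 0" "0 < s" "s < t"
  shows "(\<Sum>i\<in>UNIV. (x $ i)\<^sup>2 / t powr (2 * a $ i)) < (\<Sum>i\<in>UNIV. (x $ i)\<^sup>2 / s powr (2 * a $ i))"
proof (rule sum_strict_mono_ex1)
  have *: "s powr (2 * a $ i) < t powr (2 * a $ i)" for i
    using assms anisotropy_ge_1[OF a, of i] by (intro powr_less_mono2) auto
  show "\<forall>i\<in>UNIV. (x $ i)\<^sup>2 / t powr (2 * a $ i) \<le> (x $ i)\<^sup>2 / s powr (2 * a $ i)"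
    using assms less_imp_le[OF *] by (intro ballI divide_left_mono) auto
  obtain i where "x $ i \<noteq> 0" using assms(1) by (auto simp: vec_eq_iff)
  then show "\<exists>i\<in>UNIV. (x $ i)\<^sup>2 / t powr (2 * a $ i) < (x $ i)\<^sup>2 / s powr (2 * a $ i)"
    using assms *[of i] by (intro bexI[of _ i] divide_strict_left_mono) auto
qed simp

lemma aniso_norm_unique:
  assumes "x \<noteq> 0"
  shows "\<exists>!t. t > 0 \<and> (\<Sum>i\<in>UNIV. (x $ i)\<^sup>2 / t powr (2 * a $ i)) = 1"
proof -
  let ?S = "\<lambda>t. \<Sum>i\<in>UNIV. (x $ i)\<^sup>2 / t powr (2 * a $ i)"
  have nx: "norm x > 0" using assms by simp
  \<comment> \<open>All exponents are at least 1, so for \<open>t \<le> 1\<close> the sum dominates,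
    and for \<open>t \<ge> 1\<close> it is dominated by, its isotropic version, which equals 1 at
    \<open>norm x\<close>. The minimum and maximum with 1 make these comparisons available at both
    ends.\<close>
  define l where "l = min 1 (norm x)"
  define u where "u = max 1 (norm x)"
  have l: "0 < l" "l \<le> 1" "l \<le> norm x" using nx by (auto simp: l_def)
  have u: "1 \<le> u" "norm x \<le> u" by (auto simp: u_def)
  have n2: "(norm x)\<^sup>2 = (\<Sum>i\<in>UNIV. (x $ i)\<^sup>2)"
    by (simp add: norm_vec_def L2_set_def sum_nonneg)
  have "1 \<le> (norm x)\<^sup>2 / l\<^sup>2"
    using l by (simp add: power_mono)
  also have "\<dots> = (\<Sum>i\<in>UNIV. (x $ i)\<^sup>2 / l powr 2)"
    using l by (simp add: n2 sum_divide_distrib)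
  also have "\<dots> \<le> ?S l"
    using l anisotropy_ge_1[OF a] by (intro sum_mono divide_left_mono powr_mono') auto
  finally have 1: "1 \<le> ?S l" .
  have "?S u \<le> (\<Sum>i\<in>UNIV. (x $ i)\<^sup>2 / u powr 2)"
    using u anisotropy_ge_1[OF a] by (intro sum_mono divide_left_mono powr_mono) auto
  also have "\<dots> = (norm x)\<^sup>2 / u\<^sup>2"
    using u by (simp add: n2 sum_divide_distrib)
  also have "\<dots> \<le> 1"
    using u nx by (simp add: power_mono)
  finally have 2: "?S u \<le> 1" .
  have "continuous_on {l..u} ?S"
    using l by (intro continuous_intros) auto
  with 1 2 l u have "\<exists>t\<ge>l. t \<le> u \<and> ?S t = 1"
    by (intro IVT2') auto
  then obtain t where "l \<le> t" "?S t = 1" by blast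
  with l have t: "t > 0" "?S t = 1" by auto
  show ?thesis
  proof (rule ex1I[of _ t])
    fix s assume s: "s > 0 \<and> ?S s = 1"
    show "s = t"
      using aniso_sum_strict_antimono[OF assms, of s t] aniso_sum_strict_antimono[OF assms, of t s] s t
      by (cases s t rule: linorder_cases) auto
  qed (use t in simp)
qed

text \<open>Eliminates the definite description: the defining sum is the squared norm of a dilate
  and strictly decreasing in \<open>t\<close>, so comparisons with \<open>t\<close> become
  comparisons with 1. Openness and scaling are derived from this form.\<close>

lemma aniso_norm_compare:
  assumes "t > 0"
  shows "aniso_norm a x \<le> t \<longleftrightarrow> norm (aniso_dil a (1 / t) x) \<le> 1"
    and "t \<le> aniso_norm a x \<longleftrightarrow> 1 \<le> norm (aniso_dil a (1 / t) x)"
proof -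
  have "(aniso_norm a x \<le> t \<longleftrightarrow> norm (aniso_dil a (1 / t) x) \<le> 1) \<and>
    (t \<le> aniso_norm a x \<longleftrightarrow> 1 \<le> norm (aniso_dil a (1 / t) x))"
  proof (cases "x = 0")
    case True
    then have "aniso_dil a (1 / t) x = 0" by (simp add: aniso_dil_def vec_eq_iff)
    then show ?thesis using True assms by (simp add: aniso_norm_def)
  next
    case False
    let ?S = "\<lambda>t. \<Sum>i\<in>UNIV. (x $ i)\<^sup>2 / t powr (2 * a $ i)"
    define \<tau> where "\<tau> = aniso_norm a x"
    have \<tau>: "\<tau> > 0" "?S \<tau> = 1"
      using theI'[OF aniso_norm_unique[OF False]] False unfolding \<tau>_def aniso_norm_def by auto
    have n: "norm (aniso_dil a (1 / t) x) \<le> 1 \<longleftrightarrow> ?S t \<le> 1" "1 \<le> norm (aniso_dil a (1 / t) x) \<longleftrightarrow> 1 \<le> ?S t"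
      unfolding norm_aniso_dil[OF assms, symmetric]
      using abs_square_le_1[of "norm (aniso_dil a (1 / t) x)"] power_mono[of 1 "norm (aniso_dil a (1 / t) x)" 2]
        power_le_one[of "norm (aniso_dil a (1 / t) x)" 2] power2_le_imp_le[of 1 "norm (aniso_dil a (1 / t) x)"] by auto
    show ?thesis
      unfolding n \<tau>_def[symmetric]
      using aniso_sum_strict_antimono[OF False, of t \<tau>] aniso_sum_strict_antimono[OF False, of \<tau> t] \<tau> assms
      by (cases t \<tau> rule: linorder_cases) auto
  qed
  then show "aniso_norm a x \<le> t \<longleftrightarrow> norm (aniso_dil a (1 / t) x) \<le> 1"
    and "t \<le> aniso_norm a x \<longleftrightarrow> 1 \<le> norm (aniso_dil a (1 / t) x)" by auto
qed

lemma aniso_norm_le_1: "norm x \<le> 1 \<Longrightarrow> aniso_norm a x \<le> 1"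
  using aniso_norm_compare(1)[of 1 x] by (simp add: aniso_dil_def)

lemma aniso_norm_dil_le_iff: "0 < s \<Longrightarrow> 0 < t \<Longrightarrow> aniso_norm a (aniso_dil a s x) \<le> t \<longleftrightarrow> aniso_norm a x \<le> t / s"
  by (simp add: aniso_norm_compare aniso_dil_aniso_dil)

lemma aniso_norm_dil_ge_iff: "0 < s \<Longrightarrow> 0 < t \<Longrightarrow> t \<le> aniso_norm a (aniso_dil a s x) \<longleftrightarrow> t / s \<le> aniso_norm a x"
  by (simp add: aniso_norm_compare aniso_dil_aniso_dil)

lemma open_aniso_norm_gt: "0 < t \<Longrightarrow> open {x. t < aniso_norm a x}"
proof -
  assume t: "0 < t"
  have "{x. t < aniso_norm a x} = {x. 1 < norm (aniso_dil a (1 / t) x)}"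
    using aniso_norm_compare(1)[OF t] by (auto simp: not_le[symmetric])
  also have "open \<dots>"
    unfolding aniso_dil_eq_diag by (intro open_Collect_less continuous_intros)
  finally show ?thesis .
qed

end

section \<open>Test functions\<close>

lemma test_functions_iff: "f \<in> test_functions \<longleftrightarrow> smooth f \<and> bounded {x. f x \<noteq> 0}"
proof -
  have "compact (closure {x. f x \<noteq> 0}) \<longleftrightarrow> bounded {x. f x \<noteq> 0}"
    by (metis bounded_closure bounded_subset closed_closure closure_subset compact_eq_bounded_closed)
  then show ?thesis by (simp add: test_functions_def fun_supp_def)
qed

lemma test_functions_mult: "smooth f \<Longrightarrow> g \<in> test_functions \<Longrightarrow> (\<lambda>x. f x * g x) \<in> test_functions"
  by (auto simp: test_functions_iff smooth_mult elim!: bounded_subset)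

lemma test_functions_affine:
  fixes f :: "real ^ 'n \<Rightarrow> complex"
  assumes f: "f \<in> test_functions" and d: "\<And>i. d $ i \<noteq> 0"
  shows "(\<lambda>x. f (b + diag d x)) \<in> test_functions"
  unfolding test_functions_iff
proof
  show "smooth (\<lambda>x. f (b + diag d x))"
    using f by (intro smooth_affine) (simp add: test_functions_iff)
  have inv: "x = diag (\<chi> i. 1 / d $ i) ((b + diag d x) - b)" for x
    using d by (vector diag_def)
  have "bounded ((\<lambda>y. y - b) ` {x. f x \<noteq> 0})"
    using f by (simp add: test_functions_iff bounded_translation_minus)
  then have "bounded (diag (\<chi> i. 1 / d $ i) ` ((\<lambda>y. y - b) ` {x. f x \<noteq> 0}))"
    by (rule bounded_linear_image[OF _ bounded_linear_diag])
  moreover have "{x. f (b + diag d x) \<noteq> 0} \<subseteq> diag (\<chi> i. 1 / d $ i) ` ((\<lambda>y. y - b) ` {x. f x \<noteq> 0})"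
    using inv by (force simp: image_iff)
  ultimately show "bounded {x. f (b + diag d x) \<noteq> 0}" by (rule bounded_subset)
qed

text \<open>A Euclidean abstraction of the given cutoff, of which \<open>\<psi>\<close> is an
  instance by \<open>ex_bump\<close>. Values are complex and may exceed 1 in modulus, which
  constructions based on positivity have to correct.\<close>

locale bump =
  fixes \<rho> :: "real ^ 'n \<Rightarrow> complex" and R :: real
  assumes bump_test: "\<rho> \<in> test_functions"
    and bump_one: "norm x \<le> 1 \<Longrightarrow> \<rho> x = 1"
    and bump_zero: "R \<le> norm x \<Longrightarrow> \<rho> x = 0"
    and R_gt_1: "1 < R"
begin

definition bump_at :: "real ^ 'n \<Rightarrow> real \<Rightarrow> real ^ 'n \<Rightarrow> complex"
  where "bump_at x0 r x = \<rho> ((x - x0) /\<^sub>R r)"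

lemma bump_at_diag: "bump_at x0 r x = \<rho> (- (x0 /\<^sub>R r) + diag (\<chi> i. 1 / r) x)"
  by (simp add: bump_at_def diag_const scaleR_diff_right divide_inverse_commute)

lemma bump_at_test: "r > 0 \<Longrightarrow> bump_at x0 r \<in> test_functions"
  unfolding bump_at_diag[abs_def] by (rule test_functions_affine[OF bump_test]) simp

lemma norm_scaleR_inverse: "r > 0 \<Longrightarrow> norm ((x :: real ^ 'n) /\<^sub>R r) = norm x / r"
  by (simp add: divide_inverse_commute)

lemma bump_at_one: "r > 0 \<Longrightarrow> norm (x - x0) \<le> r \<Longrightarrow> bump_at x0 r x = 1"
  unfolding bump_at_def by (rule bump_one) (simp only: norm_scaleR_inverse, simp)

lemma bump_at_zero: "r > 0 \<Longrightarrow> R * r \<le> norm (x - x0) \<Longrightarrow> bump_at x0 r x = 0"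
  unfolding bump_at_def by (rule bump_zero) (simp only: norm_scaleR_inverse pos_le_divide_eq)

lemma bump_bounded: obtains B where "B \<ge> 1" "\<And>x. norm (\<rho> x) \<le> B"
proof -
  obtain C where C: "\<And>x. norm (\<rho> x) \<le> C / (1 + norm x) ^ 0"
    using sbdd_bound0[OF sbdd_of_schwartz[OF test_functions_schwartz[OF bump_test]]] by metis
  show thesis by (rule that[of "max 1 C"]) (use C in \<open>auto simp: le_max_iff_disj\<close>)
qed

abbreviation cut :: "nat \<Rightarrow> real ^ 'n \<Rightarrow> complex"
  where "cut m \<equiv> bump_at 0 (real (Suc m))"

lemma cut_test: "cut m \<in> test_functions"
  by (rule bump_at_test) simp

lemma cut_tendsto: "(\<lambda>m. cut m x) \<longlonglongrightarrow> 1"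
proof (rule tendsto_eventually)
  obtain N where "norm x \<le> real N" using real_arch_simple by blast
  then show "\<forall>\<^sub>F m in sequentially. cut m x = 1"
    by (intro eventually_sequentiallyI[of N] bump_at_one) auto
qed

lemma cut_bounded: obtains B where "B \<ge> 1" "\<And>m x. norm (cut m x) \<le> B"
  using bump_bounded unfolding bump_at_def by metis

text \<open>The factor \<open>m + 1\<close> expresses that the error of cutting off at radius \<open>m + 1\<close> is of order
  \<open>1 / (m + 1)\<close> in the Schwartz topology.\<close>

lemma modb_cut: "modb (\<lambda>m x. of_nat (Suc m) * (1 - cut m x))"
  unfolding modb_def
proof (intro conjI allI)
  fix m :: nat
  have sc: "smooth (cut m)" for m using cut_test by (simp add: test_functions_iff)
  show "smooth (\<lambda>x. of_nat (Suc m) * (1 - cut m x))"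
    by (intro smooth_mult smooth_diff smooth_const sc)
next
  fix "is" :: "'n list"
  have sc: "smooth (cut m)" for m using cut_test by (simp add: test_functions_iff)
  have s\<rho>: "smooth \<rho>" using bump_test by (simp add: test_functions_iff)
  have sb: "sbdd (\<lambda>_::unit. \<rho>)" by (intro sbdd_of_schwartz test_functions_schwartz bump_test)
  show "\<exists>k C. \<forall>m x. norm (pderivs is (\<lambda>x. of_nat (Suc m) * (1 - cut m x)) x) \<le> C * (1 + norm x) ^ k"
  proof (cases "is" rule: rev_cases)
    \<comment> \<open>Without derivatives, the mean value inequality between 0 and
      \<open>x /\<^sub>R real (Suc m)\<close> yields the factor 1/(m+1) at the price of linear
      growth in \<open>x\<close>.\<close>
    case Nil
    have "\<forall>i. \<exists>B. \<forall>z. norm (pderiv_at i \<rho> z) \<le> B"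
      using sbdd_bound0[OF sbdd_pderiv_at[OF sb], of _ 0] by (metis div_by_1 power_0)
    then obtain B where B: "\<And>i z. norm (pderiv_at i \<rho> z) \<le> B i" by metis
    have "B i \<le> (\<Sum>i\<in>UNIV. \<bar>B i\<bar>)" for i
      using member_le_sum[of i UNIV "\<lambda>i. \<bar>B i\<bar>"] by force
    then have B': "norm (pderiv_at i \<rho> z) \<le> (\<Sum>i\<in>UNIV. \<bar>B i\<bar>)" for i z using B order_trans by blast
    let ?C = "real CARD('n) * (\<Sum>i\<in>UNIV. \<bar>B i\<bar>)"
    have "norm (of_nat (Suc m) * (1 - cut m x)) \<le> ?C * (1 + norm x) ^ 1" for m x
    proof -
      have "norm (\<rho> 0 - \<rho> (x /\<^sub>R real (Suc m))) \<le> ?C * norm (0 - x /\<^sub>R real (Suc m))"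
        by (rule smooth_mean_value[OF s\<rho>, of UNIV]) (auto intro: B')
      also have "\<dots> = ?C * norm x / real (Suc m)" by (simp add: divide_inverse_commute)
      finally have "norm (1 - cut m x) \<le> ?C * norm x / real (Suc m)"
        by (simp add: bump_one bump_at_def)
      then have "real (Suc m) * norm (1 - cut m x) \<le> ?C * norm x"
        by (simp add: field_simps del: of_nat_Suc)
      also have "\<dots> \<le> ?C * (1 + norm x) ^ 1"
        by (intro mult_left_mono mult_nonneg_nonneg sum_nonneg) auto
      finally show ?thesis by (simp add: norm_mult del: of_nat_Suc)
    qed
    then show ?thesis unfolding Nil pderivs_Nil by blast
  next
    \<comment> \<open>With at least one derivative the chain rule supplies a factor
      \<open>1 / real (Suc m)\<close>, which cancels the normalisation.\<close>
    case (snoc js j)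
    have ne: "is \<noteq> []" using snoc by simp
    obtain C where C: "C > 0" "\<And>x. norm (pderivs is \<rho> x) \<le> C / (1 + norm x) ^ 0"
      using sbdd_bound[OF sb, of "is" 0] by metis
    have "norm (pderivs is (\<lambda>x. of_nat (Suc m) * (1 - cut m x)) x) \<le> C * (1 + norm x) ^ 0" for m x
    proof -
      have p1: "pderivs is (\<lambda>x. 1 :: complex) = (\<lambda>x::real ^ 'n. 0)"
        using snoc by (simp add: pderivs_append)
      have pr: "(\<Prod>i\<leftarrow>is. (\<chi> i. 1 / real (Suc m)) $ i) = (1 / real (Suc m)) ^ length is"
        by (induct "is") auto
      have "pderivs is (cut m) x = of_real ((1 / real (Suc m)) ^ length is) * pderivs is \<rho> (- (0 /\<^sub>R real (Suc m)) + diag (\<chi> i. 1 / real (Suc m)) x)"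
        unfolding bump_at_diag[abs_def] pderivs_affine[OF s\<rho>] pr ..
      from arg_cong[OF this, of norm] have n: "norm (pderivs is (cut m) x) = (1 / real (Suc m)) ^ length is * norm (pderivs is \<rho> (- (0 /\<^sub>R real (Suc m)) + diag (\<chi> i. 1 / real (Suc m)) x))"
        unfolding norm_mult norm_of_real by simp
      have "(1 / real (Suc m)) ^ length is \<le> (1 / real (Suc m)) ^ 1"
        using ne by (intro power_decreasing) (auto simp: Suc_le_eq)
      then have "norm (pderivs is (cut m) x) \<le> 1 / real (Suc m) * C"
        unfolding n using C(2) by (intro mult_mono) auto
      moreover have "pderivs is (\<lambda>x. of_nat (Suc m) * (1 - cut m x)) x = - (of_nat (Suc m) * pderivs is (cut m) x)"
        by (simp add: pderivs_cmult pderivs_diff smooth_diff sc p1 del: of_nat_Suc)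
      ultimately show ?thesis
        by (simp add: norm_mult field_simps del: of_nat_Suc)
    qed
    then show ?thesis by blast
  qed
qed

text \<open>The error of cutting off is \<open>1 / (m + 1)\<close> times a bounded family. This persists under every linear
  \<open>T\<close> preserving bounded families; besides the identity, the Fourier transform is such a \<open>T\<close>.\<close>

lemma tempered_cut_limit:
  assumes u: "u \<in> tempered" and T: "\<And>F :: nat \<Rightarrow> real ^ 'n \<Rightarrow> complex. sbdd F \<Longrightarrow> sbdd (\<lambda>m. T (F m))"
    and lin: "\<And>f g. f \<in> schwartz \<Longrightarrow> g \<in> schwartz \<Longrightarrow> T (\<lambda>x. f x + g x) = (\<lambda>x. T f x + T g x)"
      "\<And>c f. f \<in> schwartz \<Longrightarrow> T (\<lambda>x. c * f x) = (\<lambda>x. c * T f x)"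
    and f: "f \<in> schwartz"
  shows "(\<lambda>m. u (T (\<lambda>x. cut m x * f x))) \<longlonglongrightarrow> u (T f)"
proof -
  have u_add: "\<And>f g. f \<in> schwartz \<Longrightarrow> g \<in> schwartz \<Longrightarrow> u (\<lambda>x. f x + g x) = u f + u g"
    and u_cmult: "\<And>c f. f \<in> schwartz \<Longrightarrow> u (\<lambda>x. c * f x) = c * u f"
    using u by (auto simp: tempered_def)
  let ?E = "\<lambda>m x. (of_nat (Suc m) * (1 - cut m x)) * f x"
  have E: "sbdd ?E" by (rule sbdd_mult[OF modb_cut sbdd_of_schwartz[OF f]])
  obtain C where C: "\<And>m. norm (u (T (?E m))) \<le> C"
    using tempered_bounded[OF u T[OF E]] by blast
  have TS: "T g \<in> schwartz" if "g \<in> schwartz" for g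
    using sbdd_schwartz[OF T[OF sbdd_of_schwartz[OF that]]] .
  have cm: "(\<lambda>x. cut m x * f x) \<in> schwartz" for m
    by (intro schwartz_mult f test_functions_schwartz cut_test)
  have d: "u (T f) = u (T (\<lambda>x. cut m x * f x)) + of_real (1 / real (Suc m)) * u (T (?E m))" for m
  proof -
    have "f = (\<lambda>x. cut m x * f x + of_real (1 / real (Suc m)) * ?E m x)"
    proof
      fix x
      have "of_real (1 / real (Suc m)) * (of_nat (Suc m) :: complex) = 1"
        by (simp del: of_nat_Suc)
      then have "of_real (1 / real (Suc m)) * ?E m x = (1 - cut m x) * f x"
        by (simp only: mult.assoc[symmetric] mult_1_left)
      then show "f x = cut m x * f x + of_real (1 / real (Suc m)) * ?E m x"
        by (simp add: algebra_simps)
    qed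
    then have "u (T f) = u (T (\<lambda>x. cut m x * f x + of_real (1 / real (Suc m)) * ?E m x))" by simp
    also have "\<dots> = u (T (\<lambda>x. cut m x * f x)) + of_real (1 / real (Suc m)) * u (T (?E m))"
      using cm[of m] sbdd_schwartz[OF E, of m]
      by (simp only: lin schwartz_cmult u_add u_cmult TS)
    finally show ?thesis .
  qed
  have "(\<lambda>m. 1 / real (Suc m) * C) \<longlonglongrightarrow> 0 * C"
    by (intro tendsto_intros LIMSEQ_Suc[OF lim_1_over_n])
  then have "(\<lambda>m. of_real (1 / real (Suc m)) * u (T (?E m))) \<longlonglongrightarrow> 0"
  proof (rule Lim_null_comparison[rotated, OF tendsto_eq_rhs], goal_cases)
    case 2
    have "norm (of_real (1 / real (Suc m)) * u (T (?E m))) \<le> 1 / real (Suc m) * C" for m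
      unfolding norm_mult norm_of_real using C[of m] by (intro mult_mono) auto
    then show ?case by simp
  qed simp
  then have "(\<lambda>m. u (T f) - of_real (1 / real (Suc m)) * u (T (?E m))) \<longlonglongrightarrow> u (T f) - 0"
    by (intro tendsto_intros)
  moreover have "u (T f) - of_real (1 / real (Suc m)) * u (T (?E m)) = u (T (\<lambda>x. cut m x * f x))" for m
    using d[of m] by (simp add: algebra_simps)
  ultimately show ?thesis by simp
qed

subsection \<open>Functions are determined by their pairings with test functions\<close>

text \<open>By the Lindelof property countably many balls cover \<open>U\<close>, each with a bump
  vanishing outside \<open>U\<close>. At a given point of \<open>U\<close> some bump is bounded away
  from 0, so the product of the complements eventually stays below some \<open>\<theta> < 1\<close>,
  and the growing power drives it to 0.\<close>

lemma open_indicator_approx: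
  assumes "open U" "bounded U"
  obtains f :: "nat \<Rightarrow> real ^ 'n \<Rightarrow> real" where
    "\<And>m. (\<lambda>x. of_real (f m x)) \<in> test_functions" "\<And>m x. 0 \<le> f m x" "\<And>m x. f m x \<le> indicator U x"
    "\<And>x. (\<lambda>m. f m x) \<longlonglongrightarrow> indicator U x"
proof (cases "U = {}")
  case True
  show thesis
    by (rule that[of "\<lambda>_ _. 0"]) (auto simp: True test_functions_iff)
next
  case False
  obtain B where B: "B \<ge> 1" "\<And>x. norm (\<rho> x) \<le> B" using bump_bounded by metis
  have "\<forall>x\<in>U. \<exists>r>0. ball x (R * r) \<subseteq> U"
  proof
    fix x assume "x \<in> U"
    then obtain e where "e > 0" "ball x e \<subseteq> U" using assms(1) open_contains_ball by blast
    then show "\<exists>r>0. ball x (R * r) \<subseteq> U"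
      using R_gt_1 by (intro exI[of _ "e / R"]) auto
  qed
  then obtain r where r: "\<And>x. x \<in> U \<Longrightarrow> r x > 0" "\<And>x. x \<in> U \<Longrightarrow> ball x (R * r x) \<subseteq> U" by metis
  obtain F where F: "F \<subseteq> (\<lambda>x. ball x (r x)) ` U" "countable F" "\<Union>F = \<Union>((\<lambda>x. ball x (r x)) ` U)"
    by (rule Lindelof[of "(\<lambda>x. ball x (r x)) ` U"]) auto
  have "countable F \<and> F \<subseteq> (\<lambda>x. ball x (r x)) ` U" using F by simp
  then obtain X where X: "X \<subseteq> U" "countable X" "F = (\<lambda>x. ball x (r x)) ` X"
    unfolding countable_subset_image by blast
  have cov: "\<exists>y\<in>X. x \<in> ball y (r y)" if "x \<in> U" for x
  proof -
    have "x \<in> (\<Union>x\<in>U. ball x (r x))" using that r(1)[OF that] by (intro UN_I[of x]) auto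
    also have "\<dots> = (\<Union>x\<in>X. ball x (r x))" using F(3) X(3) by simp
    finally show ?thesis by blast
  qed
  then have ne: "X \<noteq> {}" using False by blast
  define c where "c = from_nat_into X"
  have c: "c i \<in> X" "c i \<in> U" for i using from_nat_into[OF ne] X(1) by (auto simp: c_def)
  \<comment> \<open>The squared modulus over \<open>B\<^sup>2\<close> is real, smooth and between 0
    and 1; on its ball it equals \<open>1 / B\<^sup>2\<close>, which may be less than 1. The
    exponent \<open>m\<close> in \<open>f\<close> below compensates for that.\<close>
  define b where "b i x = (norm (bump_at (c i) (r (c i)) x))\<^sup>2 / B\<^sup>2" for i x
  have b01: "0 \<le> b i x" "b i x \<le> 1" for i x
    using B(1) power_mono[OF B(2) norm_ge_zero, of _ 2] by (auto simp: b_def bump_at_def divide_le_eq)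
  have bU: "b i x = 0" if "x \<notin> U" for i x
  proof -
    have "x \<notin> ball (c i) (R * r (c i))" using that r(2)[OF c(2)] by blast
    then show ?thesis
      using r(1)[OF c(2)] by (simp add: b_def bump_at_zero dist_norm norm_minus_commute)
  qed
  have sb: "smooth (\<lambda>x. of_real (b i x))" for i
  proof -
    let ?g = "bump_at (c i) (r (c i))"
    have "smooth ?g" using bump_at_test[OF r(1)[OF c(2)]] by (simp add: test_functions_iff)
    then have "smooth (\<lambda>x. of_real (1 / B\<^sup>2) * (?g x * cnj (?g x)))"
      by (intro smooth_mult smooth_const smooth_cnj)
    moreover have "of_real (b i x) = of_real (1 / B\<^sup>2) * (?g x * cnj (?g x))" for x
      by (simp only: complex_norm_square[symmetric] of_real_mult[symmetric]) (simp add: b_def)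
    ultimately show ?thesis by simp
  qed
  define f where "f m x = 1 - (\<Prod>i\<le>m. (1 - b i x)) ^ m" for m x
  have P01: "0 \<le> (\<Prod>i\<le>m. (1 - b i x))" "(\<Prod>i\<le>m. (1 - b i x)) \<le> 1" for m x
    using b01 by (auto intro!: prod_nonneg prod_le_1)
  show thesis
  proof (rule that[of f])
    fix m x
    show "0 \<le> f m x" using P01 by (simp add: f_def power_le_one)
    show fU: "f m x \<le> indicator U x" for x
      using P01 bU by (cases "x \<in> U") (auto simp: f_def)
    have "smooth (\<lambda>x. 1 - (\<Prod>i\<le>m. (1 - complex_of_real (b i x))) ^ m)"
      by (intro smooth_diff smooth_const smooth_power smooth_prod sb finite_atMost)
    then have "smooth (\<lambda>x. complex_of_real (f m x))" by (simp add: f_def)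
    moreover have "{x. complex_of_real (f m x) \<noteq> 0} \<subseteq> U" using bU by (force simp: f_def)
    ultimately show "(\<lambda>x. complex_of_real (f m x)) \<in> test_functions"
      unfolding test_functions_iff using assms(2) bounded_subset by blast
  next
    fix x
    show "(\<lambda>m. f m x) \<longlonglongrightarrow> indicator U x"
    proof (cases "x \<in> U")
      case False then show ?thesis using bU by (simp add: f_def)
    next
      case True
      then obtain y where y: "y \<in> X" "x \<in> ball y (r y)" using cov by blast
      then obtain k where k: "c k = y" using from_nat_into_surj[OF X(2)] by (auto simp: c_def)
      have bk: "b k x = 1 / B\<^sup>2"
        using y r(1)[of y] X(1) k by (auto simp: b_def bump_at_one dist_norm norm_minus_commute)
      define \<theta> where "\<theta> = 1 - 1 / B\<^sup>2"
      have \<theta>: "0 \<le> \<theta>" "\<theta> < 1" using B(1) by (auto simp: \<theta>_def)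
      have le: "(\<Prod>i\<le>m. (1 - b i x)) ^ m \<le> \<theta> ^ m" if "k \<le> m" for m
      proof (rule power_mono)
        have "(\<Prod>i\<le>m. (1 - b i x)) = (1 - b k x) * (\<Prod>i\<in>{..m} - {k}. (1 - b i x))"
          using that by (intro prod.remove) auto
        also have "\<dots> \<le> (1 - b k x) * 1"
          using b01 by (intro mult_left_mono prod_le_1) auto
        finally show "(\<Prod>i\<le>m. (1 - b i x)) \<le> \<theta>" by (simp add: bk \<theta>_def)
      qed (use P01 in auto)
      have "(\<lambda>m. (\<Prod>i\<le>m. (1 - b i x)) ^ m) \<longlonglongrightarrow> 0"
      proof (rule Lim_null_comparison)
        show "\<forall>\<^sub>F m in sequentially. norm ((\<Prod>i\<le>m. (1 - b i x)) ^ m) \<le> \<theta> ^ m"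
          using le P01 by (intro eventually_sequentiallyI[of k]) simp
        show "(\<lambda>m. \<theta> ^ m) \<longlonglongrightarrow> 0" using \<theta> by (intro LIMSEQ_power_zero) simp
      qed
      then have "(\<lambda>m. f m x) \<longlonglongrightarrow> 1 - 0" unfolding f_def by (intro tendsto_intros)
      then show ?thesis using True by simp
    qed
  qed
qed

text \<open>Nonnegativity of integrals passes from test functions to bounded open sets by
  \<open>open_indicator_approx\<close>, and on to bounded Borel sets by outer regularity, where it
  forces nonnegativity of the density almost everywhere.\<close>

lemma AE_nonneg_if_test_nonneg:
  fixes k :: "real ^ 'n \<Rightarrow> real"
  assumes [measurable]: "k \<in> borel_measurable borel"
    and loc: "\<And>K. compact K \<Longrightarrow> set_integrable lborel K k"
    and pos: "\<And>f. (\<lambda>x. of_real (f x)) \<in> test_functions \<Longrightarrow> (\<And>x. 0 \<le> f x) \<Longrightarrow> 0 \<le> (LINT x|lborel. k x * f x)"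
  shows "AE x in lborel. 0 \<le> k x"
proof -
  have op: "0 \<le> (LINT x|lborel. k x * indicator U x)" if U: "open U" "bounded U" for U
  proof -
    obtain f :: "nat \<Rightarrow> real ^ 'n \<Rightarrow> real" where f: "\<And>m. (\<lambda>x. of_real (f m x)) \<in> test_functions"
      "\<And>m x. 0 \<le> f m x" "\<And>m x. f m x \<le> indicator U x" "\<And>x. (\<lambda>m. f m x) \<longlonglongrightarrow> indicator U x"
      using open_indicator_approx[OF U] by blast
    have [measurable]: "f m \<in> borel_measurable borel" for m
    proof -
      have "(\<lambda>x. Re (of_real (f m x))) \<in> borel_measurable borel"
        by (rule measurable_compose[OF smooth_measurable borel_measurable_Re]) (use f(1)[of m] in \<open>simp add: test_functions_iff\<close>)
      then show ?thesis by simp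
    qed
    have [measurable]: "U \<in> sets borel" using U(1) by simp
    have "(\<lambda>m. LINT x|lborel. k x * f m x) \<longlonglongrightarrow> (LINT x|lborel. k x * indicator U x)"
    proof (rule integral_dominated_convergence)
      have "set_integrable lborel (closure U) k" using U(2) by (intro loc) simp
      then show "integrable lborel (\<lambda>x. norm (indicator (closure U) x *\<^sub>R k x))"
        unfolding set_integrable_def by (rule integrable_norm)
      show "AE x in lborel. (\<lambda>m. k x * f m x) \<longlonglongrightarrow> k x * indicator U x"
        by (intro AE_I2 tendsto_intros f)
      fix m show "AE x in lborel. norm (k x * f m x) \<le> norm (indicator (closure U) x *\<^sub>R k x)"
      proof (rule AE_I2)
        fix x
        have "f m x \<le> indicator (closure U) x"
          by (rule order_trans[OF f(3)]) (auto simp: indicator_def dest: closure_subset[THEN subsetD])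
        then show "norm (k x * f m x) \<le> norm (indicator (closure U) x *\<^sub>R k x)"
          using f(2)[of m x] by (simp add: abs_mult mult.commute[of _ "\<bar>k x\<bar>"] mult_left_mono)
      qed
    qed measurable
    then show ?thesis
      by (rule LIMSEQ_le_const) (use pos[OF f(1,2)] in auto)
  qed
  have bor: "0 \<le> (LINT x|lborel. k x * indicator A x)" if A: "A \<in> sets borel" "A \<subseteq> ball 0 (real N)" for A N
  proof -
    have "\<forall>m::nat. \<exists>U. open U \<and> A \<subseteq> U \<and> emeasure lborel (U - A) < ennreal (1 / real (Suc m))"
      using outer_regular_lborel[OF A(1)] by (metis divide_pos_pos of_nat_0_less_iff zero_less_Suc zero_less_one)
    then obtain U where U: "\<And>m. open (U m)" "\<And>m. A \<subseteq> U m" "\<And>m::nat. emeasure lborel (U m - A) < ennreal (1 / real (Suc m))"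
      by metis
    \<comment> \<open>Intersecting makes the open sets decreasing, and the ball keeps them in a
      compact set on which \<open>k\<close> is integrable; their intersection exceeds
      \<open>A\<close> only by a null set.\<close>
    define V where "V m = ball 0 (real N) \<inter> (\<Inter>i\<le>m. U i)" for m
    have Vo: "open (V m)" "bounded (V m)" for m
      using U(1) by (auto simp: V_def intro!: open_INT open_Int intro: bounded_subset[OF bounded_ball])
    have [measurable]: "V m \<in> sets borel" "A \<in> sets borel" for m using Vo A by auto
    have AV: "A \<subseteq> (\<Inter>m. V m)" using U(2) A(2) by (auto simp: V_def)
    have null: "(\<Inter>m. V m) - A \<in> null_sets lborel"
    proof (rule null_setsI)
      have le: "emeasure lborel ((\<Inter>m. V m) - A) \<le> ennreal (1 / real (Suc m))" for m
      proof -
        have "emeasure lborel ((\<Inter>m. V m) - A) \<le> emeasure lborel (U m - A)"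
          using U(1) A by (intro emeasure_mono) (auto simp: V_def)
        with U(3)[of m] show ?thesis by (meson less_imp_le order_trans)
      qed
      have "(\<lambda>m. ennreal (1 / real (Suc m))) \<longlonglongrightarrow> ennreal 0"
        by (intro tendsto_ennrealI LIMSEQ_Suc[OF lim_1_over_n])
      then have "emeasure lborel ((\<Inter>m. V m) - A) \<le> ennreal 0"
        by (rule LIMSEQ_le_const) (use le in auto)
      then show "emeasure lborel ((\<Inter>m. V m) - A) = 0" by simp
    qed auto
    have lim: "(\<lambda>m. LINT x|lborel. k x * indicator (V m) x) \<longlonglongrightarrow> (LINT x|lborel. k x * indicator A x)"
    proof (rule integral_dominated_convergence)
      have "set_integrable lborel (cball 0 (real N)) k" by (intro loc) simp
      then show "integrable lborel (\<lambda>x. norm (indicator (cball 0 (real N)) x *\<^sub>R k x))"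
        unfolding set_integrable_def by (rule integrable_norm)
      show "AE x in lborel. (\<lambda>m. k x * indicator (V m) x) \<longlonglongrightarrow> k x * indicator A x"
        using AE_not_in[OF null]
      proof eventually_elim
        fix x assume x: "x \<notin> (\<Inter>m. V m) - A"
        have "(\<lambda>m. indicator (V m) x :: real) \<longlonglongrightarrow> indicator A x"
        proof (cases "x \<in> A")
          case True then show ?thesis using AV by (auto simp: indicator_def)
        next
          case False
          then obtain m where m: "x \<notin> V m" using x by auto
          have "x \<notin> V j" if "m \<le> j" for j using m that by (auto simp: V_def) 
          then have "\<forall>\<^sub>F j in sequentially. indicator (V j) x = (indicator A x :: real)"
            using False by (intro eventually_sequentiallyI[of m]) auto
          then show ?thesis by (rule tendsto_eventually)
        qed
        then show "(\<lambda>m. k x * indicator (V m) x) \<longlonglongrightarrow> k x * indicator A x" by (intro tendsto_intros)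
      qed
      fix m show "AE x in lborel. norm (k x * indicator (V m) x) \<le> norm (indicator (cball 0 (real N)) x *\<^sub>R k x)"
        by (intro AE_I2) (auto simp: indicator_def V_def)
    qed measurable
    then show ?thesis
      by (rule LIMSEQ_le_const) (use op[OF Vo] in auto)
  qed
  have "AE x in lborel. 0 \<le> indicator (ball 0 (real N)) x *\<^sub>R k x" for N
  proof (rule sigma_finite_measure.density_nonneg[OF sigma_finite_lborel])
    have "set_integrable lborel (cball 0 (real N)) k" by (intro loc) simp
    then show "integrable lborel (\<lambda>x. indicator (ball 0 (real N)) x *\<^sub>R k x)"
      using set_integrable_subset[of lborel "cball 0 (real N)" k "ball 0 (real N)"] by (simp add: set_integrable_def)
    fix A :: "(real ^ 'n) set" assume "A \<in> sets lborel"
    then have "0 \<le> (LINT x|lborel. k x * indicator (A \<inter> ball 0 (real N)) x)"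
      by (intro bor[of _ N]) auto
    then show "0 \<le> set_lebesgue_integral lborel A (\<lambda>x. indicator (ball 0 (real N)) x *\<^sub>R k x)"
      by (simp add: set_lebesgue_integral_def indicator_inter_arith mult_ac)
  qed
  then have "AE x in lborel. \<forall>N. 0 \<le> indicator (ball 0 (real N)) x *\<^sub>R k x"
    by (simp add: AE_all_countable)
  then show ?thesis
  proof eventually_elim
    fix x assume x: "\<forall>N. 0 \<le> indicator (ball 0 (real N)) x *\<^sub>R k x"
    obtain N where "norm x < real N" using reals_Archimedean2 by blast
    then show "0 \<le> k x" using x[rule_format, of N] by (simp add: indicator_def)
  qed
qed

lemma loc_integrable_mult_test:
  fixes h f :: "real ^ 'n \<Rightarrow> complex"
  assumes [measurable]: "h \<in> borel_measurable borel"
    and loc: "\<And>K. compact K \<Longrightarrow> set_integrable lborel K h" and f: "f \<in> test_functions"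
  shows "integrable lborel (\<lambda>x. h x * f x)"
proof -
  obtain C where C: "\<And>x. norm (f x) \<le> C / (1 + norm x) ^ 0"
    using sbdd_bound0[OF sbdd_of_schwartz[OF test_functions_schwartz[OF f]]] by metis
  have [measurable]: "f \<in> borel_measurable borel" using f smooth_measurable by (auto simp: test_functions_def)
  show ?thesis
  proof (rule Bochner_Integration.integrable_bound)
    have "set_integrable lborel (fun_supp f) h" using f by (intro loc) (simp add: test_functions_def)
    then show "integrable lborel (\<lambda>x. C * norm (indicator (fun_supp f) x *\<^sub>R h x))"
      unfolding set_integrable_def by (intro integrable_mult_right integrable_norm)
    show "AE x in lborel. norm (h x * f x) \<le> norm (C * norm (indicator (fun_supp f) x *\<^sub>R h x))"
    proof (rule AE_I2)
      fix x
      show "norm (h x * f x) \<le> norm (C * norm (indicator (fun_supp f) x *\<^sub>R h x))"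
      proof (cases "f x = 0")
        case False
        then have "x \<in> fun_supp f" using closure_subset by (force simp: fun_supp_def)
        moreover have "norm (f x) \<le> \<bar>C\<bar>" using C[of x] by simp
        ultimately show ?thesis by (simp add: norm_mult abs_mult mult.commute mult_right_mono)
      qed simp
    qed
  qed measurable
qed

text \<open>Nonnegative test functions bound \<open>Re (c * h x)\<close> by \<open>w x\<close> for
  each unimodular \<open>c\<close>, up to a null set depending on \<open>c\<close>. The four values
  1, -1 and plus or minus the imaginary unit bound the real and imaginary parts, which costs the
  factor 2.\<close>

lemma AE_le_if_test_le:
  fixes h :: "real ^ 'n \<Rightarrow> complex" and w :: "real ^ 'n \<Rightarrow> real"
  assumes [measurable]: "h \<in> borel_measurable borel" "w \<in> borel_measurable borel"
    and loc: "\<And>K. compact K \<Longrightarrow> set_integrable lborel K h" "\<And>K. compact K \<Longrightarrow> set_integrable lborel K w"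
    and le: "\<And>f. f \<in> test_functions \<Longrightarrow> norm (LINT x|lborel. h x * f x) \<le> (LINT x|lborel. w x * norm (f x))"
  shows "AE x in lborel. norm (h x) \<le> 2 * w x"
proof -
  have *: "AE x in lborel. 0 \<le> w x - Re (c * h x)" if c: "norm c = 1" for c
  proof (rule AE_nonneg_if_test_nonneg)
    fix K :: "(real ^ 'n) set" assume K: "compact K"
    have "integrable lborel (\<lambda>x. Re (c * (indicator K x *\<^sub>R h x)))"
      using loc(1)[OF K] unfolding set_integrable_def by (intro integrable_Re integrable_mult_right)
    then have "integrable lborel (\<lambda>x. indicator K x *\<^sub>R w x - Re (c * (indicator K x *\<^sub>R h x)))"
      using loc(2)[OF K] unfolding set_integrable_def by (intro Bochner_Integration.integrable_diff)
    then show "set_integrable lborel K (\<lambda>x. w x - Re (c * h x))"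
      unfolding set_integrable_def by (simp add: algebra_simps)
  next
    fix f :: "real ^ 'n \<Rightarrow> real"
    assume f: "(\<lambda>x. complex_of_real (f x)) \<in> test_functions" "\<And>x. 0 \<le> f x"
    have loc': "set_integrable lborel K (\<lambda>x. complex_of_real (w x))" if K: "compact K" for K
    proof -
      have "integrable lborel (\<lambda>x. complex_of_real (indicator K x *\<^sub>R w x))"
        using loc(2)[OF K] unfolding set_integrable_def by (rule integrable_of_real)
      then show ?thesis by (simp add: set_integrable_def scaleR_conv_of_real)
    qed
    have "integrable lborel (\<lambda>x. complex_of_real (w x) * complex_of_real (f x))"
      by (rule loc_integrable_mult_test[OF _ loc' f(1)]) measurable
    from integrable_Re[OF this] have iw: "integrable lborel (\<lambda>x. w x * f x)" by simp
    have ih: "integrable lborel (\<lambda>x. h x * complex_of_real (f x))"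
      by (rule loc_integrable_mult_test[OF _ loc(1) f(1)]) measurable
    then have ih': "integrable lborel (\<lambda>x. Re (c * (h x * complex_of_real (f x))))"
      by (intro integrable_Re integrable_mult_right)
    have "(LINT x|lborel. Re (c * (h x * complex_of_real (f x)))) = Re (c * (LINT x|lborel. h x * complex_of_real (f x)))"
      using ih by (subst integral_Re) simp_all
    also have "\<dots> \<le> norm (c * (LINT x|lborel. h x * complex_of_real (f x)))" by (rule complex_Re_le_cmod)
    also have "\<dots> = norm (LINT x|lborel. h x * complex_of_real (f x))" by (simp add: norm_mult c)
    also have "\<dots> \<le> (LINT x|lborel. w x * f x)" using le[OF f(1)] f(2) by simp
    finally have "0 \<le> (LINT x|lborel. w x * f x) - (LINT x|lborel. Re (c * (h x * complex_of_real (f x))))" by simp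
    also have "\<dots> = (LINT x|lborel. w x * f x - Re (c * (h x * complex_of_real (f x))))"
      by (rule Bochner_Integration.integral_diff[symmetric, OF iw ih'])
    also have "\<dots> = (LINT x|lborel. (w x - Re (c * h x)) * f x)"
      by (rule Bochner_Integration.integral_cong) (auto simp: algebra_simps)
    finally show "0 \<le> (LINT x|lborel. (w x - Re (c * h x)) * f x)" .
  qed measurable
  have "AE x in lborel. 0 \<le> w x - Re (1 * h x)" "AE x in lborel. 0 \<le> w x - Re (- 1 * h x)"
    "AE x in lborel. 0 \<le> w x - Re (- \<i> * h x)" "AE x in lborel. 0 \<le> w x - Re (\<i> * h x)"
    by (rule *; simp)+
  then show ?thesis
  proof eventually_elim
    fix x
    assume "0 \<le> w x - Re (1 * h x)" "0 \<le> w x - Re (- 1 * h x)" "0 \<le> w x - Re (- \<i> * h x)" "0 \<le> w x - Re (\<i> * h x)"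
    then have "\<bar>Re (h x)\<bar> \<le> w x" "\<bar>Im (h x)\<bar> \<le> w x" by auto
    then show "norm (h x) \<le> 2 * w x" using cmod_le[of "h x"] by linarith
  qed
qed

text \<open>Makes the choice hidden in \<open>dist_fun\<close> harmless: an explicit representing
  function may replace the chosen one almost everywhere. It is the comparison lemma with majorant
  0.\<close>

lemma represents_unique:
  fixes u :: "'n functional"
  assumes "represents h1 u" "represents h2 u"
  shows "AE x in lborel. h1 x = h2 x"
proof -
  have [measurable]: "h1 \<in> borel_measurable borel" "h2 \<in> borel_measurable borel"
    using assms by (auto simp: represents_def)
  have "AE x in lborel. norm (h1 x - h2 x) \<le> 2 * 0"
  proof (rule AE_le_if_test_le)
    show "set_integrable lborel K (\<lambda>x. h1 x - h2 x)" if "compact K" for K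
      using assms that by (intro set_integral_diff) (auto simp: represents_def)
    fix f :: "real ^ 'n \<Rightarrow> complex" assume f: "f \<in> test_functions"
    have "integrable lborel (\<lambda>x. h1 x * f x)" "integrable lborel (\<lambda>x. h2 x * f x)"
      using assms by (intro loc_integrable_mult_test f; simp add: represents_def)+
    then have "(LINT x|lborel. (h1 x - h2 x) * f x) = (LINT x|lborel. h1 x * f x) - (LINT x|lborel. h2 x * f x)"
      by (simp add: left_diff_distrib)
    also have "\<dots> = 0" using assms f by (simp add: represents_def)
    finally show "norm (LINT x|lborel. (h1 x - h2 x) * f x) \<le> (LINT x|lborel. 0 * norm (f x))" by simp
  qed (auto simp: set_integrable_def)
  then show ?thesis by eventually_elim simp
qed

end

section \<open>Band-limited distributions\<close>

lemma fourier_add: "f \<in> schwartz \<Longrightarrow> g \<in> schwartz \<Longrightarrow> fourier (\<lambda>x. f x + g x) = (\<lambda>\<xi>. fourier f \<xi> + fourier g \<xi>)"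
  unfolding fourier_def distrib_left
  by (intro ext Bochner_Integration.integral_add integrable_iexp_mult schwartz_integrable)

lemma fourier_cmult: "fourier (\<lambda>x. c * f x) = (\<lambda>\<xi>. c * fourier f \<xi>)"
  unfolding fourier_def by (simp add: mult.left_commute[of _ c])

lemma tempered_add: "u \<in> tempered \<Longrightarrow> f \<in> schwartz \<Longrightarrow> g \<in> schwartz \<Longrightarrow> u (\<lambda>x. f x + g x) = u f + u g"
  by (auto simp: tempered_def)

text \<open>All derivatives of the convolution of \<open>f\<close> with a fixed kernel fall on the kernel.\<close>

lemma pderivs_fourier_mult:
  assumes "\<Phi> \<in> schwartz"
  shows "\<exists>\<Phi>'\<in>schwartz. \<forall>g\<in>schwartz. pderivs is (fourier (\<lambda>x. \<Phi> x * g x)) = fourier (\<lambda>x. \<Phi>' x * g x)"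
proof (induct "is")
  case Nil
  then show ?case using assms by auto
next
  case (Cons i "is")
  then obtain \<Phi>' where P: "\<Phi>' \<in> schwartz"
    "\<And>g. g \<in> schwartz \<Longrightarrow> pderivs is (fourier (\<lambda>x. \<Phi> x * g x)) = fourier (\<lambda>x. \<Phi>' x * g x)" by blast
  have "(\<lambda>x. - \<i> * (of_real (x $ i) * \<Phi>' x)) \<in> schwartz"
    using sbdd_coord_mult'[of "\<lambda>_::unit. \<Phi>'"] P(1) by (simp add: schwartz_iff_sbdd)
  moreover have "pderivs (i # is) (fourier (\<lambda>x. \<Phi> x * g x)) = fourier (\<lambda>x. (- \<i> * (of_real (x $ i) * \<Phi>' x)) * g x)"
    if g: "g \<in> schwartz" for g
    unfolding pderivs_Cons P(2)[OF g] pderiv_at_fourier[OF schwartz_mult[OF P(1) g]] by (simp only: mult.assoc)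
  ultimately show ?case
    by (intro bexI[of _ "\<lambda>x. - \<i> * (of_real (x $ i) * \<Phi>' x)"] ballI)
qed

lemma weight_submult: "1 + norm x \<le> (1 + norm y) * (1 + norm (x - y :: 'a :: real_normed_vector))"
proof -
  have "norm x \<le> norm y + norm (x - y)" using norm_triangle_ineq[of y "x - y"] by simp
  moreover have "0 \<le> norm y * norm (x - y)" by simp
  ultimately show ?thesis unfolding distrib_left distrib_right by linarith
qed

lemma norm_integral_le:
  fixes f :: "real ^ 'n \<Rightarrow> complex"
  assumes g: "integrable lborel g" and f: "f \<in> borel_measurable borel" and le: "\<And>x. norm (f x) \<le> g x"
  shows "norm (LINT x|lborel. f x) \<le> (LINT x|lborel. g x)"
proof (rule Bochner_Integration.integral_norm_bound_integral[OF _ g le])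
  show "integrable lborel f"
    by (rule Bochner_Integration.integrable_bound[OF g]) (use f order_trans[OF le abs_ge_self] in auto)
qed

text \<open>The infimum \<open>D\<close> of all almost sure bounds is itself one, so
  \<open>step\<close> forces \<open>D \<le> c * D powr (1 - p)\<close>, and cancelling gives the
  claim. The finite starting bound \<open>D0\<close> makes the argument possible, yet the result
  does not depend on its size.\<close>

lemma ex_sup_bound_self:
  fixes g :: "real ^ 'n \<Rightarrow> real"
  assumes g: "\<And>x. 0 \<le> g x" and D0: "AE x in lborel. g x \<le> D0" and c: "0 \<le> c" and p: "0 < p" "p < 1"
    and step: "\<And>D. 0 \<le> D \<Longrightarrow> AE x in lborel. g x \<le> D \<Longrightarrow> AE x in lborel. g x \<le> c * D powr (1 - p)"
  shows "AE x in lborel. g x \<le> c powr (1 / p)"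
proof -
  define S where "S = {D. 0 \<le> D \<and> (AE x in lborel. g x \<le> D)}"
  have "AE x in lborel. g x \<le> max 0 D0" using D0 by eventually_elim auto
  then have ne: "S \<noteq> {}" by (auto simp: S_def intro!: exI[of _ "max 0 D0"])
  have bd: "bdd_below S" by (auto simp: S_def bdd_below_def)
  define D where "D = Inf S"
  have D: "0 \<le> D" unfolding D_def by (rule cInf_greatest[OF ne]) (auto simp: S_def)
  have "AE x in lborel. g x \<le> D + 1 / real (Suc m)" for m
  proof -
    have "Inf S < D + 1 / real (Suc m)" by (simp add: D_def)
    then obtain E where "E \<in> S" "E < D + 1 / real (Suc m)" using cInf_less_iff[OF ne bd] by blast
    then show ?thesis unfolding S_def by (auto elim!: eventually_mono)
  qed
  then have "AE x in lborel. \<forall>m. g x \<le> D + 1 / real (Suc m)" by (simp add: AE_all_countable)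
  then have AD: "AE x in lborel. g x \<le> D"
  proof eventually_elim
    fix x assume x: "\<forall>m. g x \<le> D + 1 / real (Suc m)"
    have "(\<lambda>m. D + 1 / real (Suc m)) \<longlonglongrightarrow> D + 0"
      by (intro tendsto_intros LIMSEQ_Suc[OF lim_1_over_n])
    then have "g x \<le> D + 0" by (rule LIMSEQ_le_const) (use x in auto)
    then show "g x \<le> D" by simp
  qed
  have "c * D powr (1 - p) \<in> S"
    using step[OF D AD] c by (simp add: S_def)
  then have le: "D \<le> c * D powr (1 - p)" unfolding D_def by (rule cInf_lower[OF _ bd])
  have Dc: "D \<le> c powr (1 / p)"
  proof (cases "D = 0")
    case False
    then have pos: "D > 0" using D by simp
    have "D powr p * D powr (1 - p) = D" using pos by (simp add: powr_add[symmetric])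
    then have "D powr p * D powr (1 - p) \<le> c * D powr (1 - p)" using le by simp
    then have "D powr p \<le> c" using pos by simp
    then have "(D powr p) powr (1 / p) \<le> c powr (1 / p)" using p by (intro powr_mono2) auto
    then show ?thesis using pos p by (simp add: powr_powr)
  qed simp
  from AD show ?thesis by eventually_elim (use Dc in simp)
qed

lemma le_powr_split:
  fixes t D p :: real
  assumes "0 \<le> t" "t \<le> D" "0 < p" "p < 1"
  shows "t \<le> D powr (1 - p) * t powr p"
proof (cases "t = 0")
  case False
  then have "t = t powr (1 - p) * t powr p" using assms by (simp add: powr_add[symmetric])
  also have "\<dots> \<le> D powr (1 - p) * t powr p" using assms by (intro mult_right_mono powr_mono2) auto
  finally show ?thesis .
qed simp

section \<open>Spectrum and the reproducing formula\<close>

context bump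
begin

text \<open>A smooth partition of unity is avoided by successively splitting \<open>f = f b + f (1 - b)\<close>, where the
  bump \<open>b\<close> equals \<open>1\<close> on one member of a finite cover of the support of \<open>f\<close>.\<close>

lemma vanish_off_dist_supp:
  fixes W :: "'n functional"
  assumes add: "\<And>f g. f \<in> test_functions \<Longrightarrow> g \<in> test_functions \<Longrightarrow> W (\<lambda>x. f x + g x) = W f + W g"
    and f: "f \<in> test_functions" "fun_supp f \<inter> dist_supp W = {}"
  shows "W f = 0"
proof -
  \<comment> \<open>The radius is enlarged by \<open>R\<close> because a bump equal to 1 on the ball
    of radius \<open>r\<close> is only known to vanish from distance \<open>R * r\<close>
    on.\<close>
  define P where "P x r \<longleftrightarrow> 0 < r \<and> (\<forall>g\<in>test_functions. fun_supp g \<subseteq> cball x (R * r) \<longrightarrow> W g = 0)" for x r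
  have "\<forall>x\<in>fun_supp f. \<exists>r. P x r"
  proof
    fix x assume "x \<in> fun_supp f"
    then have "x \<notin> dist_supp W" using f(2) by blast
    then obtain U where U: "open U" "x \<in> U" "\<And>g. g \<in> test_functions \<Longrightarrow> fun_supp g \<subseteq> U \<Longrightarrow> W g = 0"
      by (auto simp: dist_supp_def)
    obtain e where e: "e > 0" "cball x e \<subseteq> U" using U(1,2) open_contains_cball by blast
    have "P x (e / R)"
      using e R_gt_1 U(3) by (auto simp: P_def)
    then show "\<exists>r. P x r" ..
  qed
  then obtain r where r: "\<And>x. x \<in> fun_supp f \<Longrightarrow> P x (r x)" by metis
  have fin: "W g = 0" if "finite X" "\<And>x. x \<in> X \<Longrightarrow> P x (r x)" "g \<in> test_functions" "fun_supp g \<subseteq> (\<Union>x\<in>X. ball x (r x))" for X g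
    using that
  proof (induct X arbitrary: g rule: finite_induct)
    case empty
    then have "g = (\<lambda>x. 0)" using closure_subset[of "{x. g x \<noteq> 0}"] by (auto simp: fun_supp_def)
    then show ?case using add[OF empty(2) empty(2)] by simp
  next
    case (insert y X)
    have y: "P y (r y)" and ry: "r y > 0" using insert(4)[of y] by (auto simp: P_def)
    let ?b = "bump_at y (r y)"
    have sb: "smooth ?b" and sg: "smooth g"
      using bump_at_test[OF ry] insert(5) by (auto simp: test_functions_iff)
    have t1: "(\<lambda>x. ?b x * g x) \<in> test_functions" and t2: "(\<lambda>x. (1 - ?b x) * g x) \<in> test_functions"
      by (intro test_functions_mult smooth_diff smooth_const sb insert)+
    have "fun_supp (\<lambda>x. ?b x * g x) \<subseteq> cball y (R * r y)"
      unfolding fun_supp_def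
    proof (rule closure_minimal)
      show "{x. ?b x * g x \<noteq> 0} \<subseteq> cball y (R * r y)"
        using bump_at_zero[OF ry, of _ y] by (force simp: dist_norm norm_minus_commute)
    qed simp
    then have 1: "W (\<lambda>x. ?b x * g x) = 0" using y t1 by (simp add: P_def)
    have "fun_supp (\<lambda>x. (1 - ?b x) * g x) \<subseteq> fun_supp g - ball y (r y)"
      unfolding fun_supp_def
    proof (rule closure_minimal)
      show "{x. (1 - ?b x) * g x \<noteq> 0} \<subseteq> closure {x. g x \<noteq> 0} - ball y (r y)"
        using closure_subset[of "{x. g x \<noteq> 0}"] bump_at_one[OF ry, of _ y] by (force simp: dist_norm norm_minus_commute)
    qed (intro closed_Diff, auto)
    then have "fun_supp (\<lambda>x. (1 - ?b x) * g x) \<subseteq> (\<Union>x\<in>X. ball x (r x))" using insert(6) by auto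
    then have 2: "W (\<lambda>x. (1 - ?b x) * g x) = 0" using insert(4) by (intro insert(3) t2) auto
    have "g = (\<lambda>x. ?b x * g x + (1 - ?b x) * g x)" by (auto simp: algebra_simps)
    then have "W g = W (\<lambda>x. ?b x * g x + (1 - ?b x) * g x)" by simp
    also have "\<dots> = 0" unfolding add[OF t1 t2] 1 2 by simp
    finally show ?case .
  qed
  have "compact (fun_supp f)" using f(1) by (simp add: test_functions_def)
  moreover have "fun_supp f \<subseteq> (\<Union>x\<in>fun_supp f. ball x (r x))" using r by (force simp: P_def)
  ultimately obtain X where X: "X \<subseteq> fun_supp f" "finite X" "fun_supp f \<subseteq> (\<Union>x\<in>X. ball x (r x))"
    by (elim compactE_image) auto
  show ?thesis by (rule fin[OF X(2) _ f(1) X(3)]) (use X(1) r in blast)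
qed

text \<open>The inverse transform times \<open>1 - \<Phi>\<close> vanishes on \<open>O'\<close>; as
  \<open>O'\<close> is open, even the closed support misses the spectrum. Being only a Schwartz
  function, the product is first cut off to a test function, and \<open>tempered_cut_limit\<close>
  with the Fourier transform as \<open>T\<close> removes the cutoff.\<close>

lemma band_limited_reproducing:
  fixes v :: "'n functional"
  assumes v: "v \<in> tempered" and \<Phi>: "\<Phi> \<in> test_functions" and O: "open O'" "dist_supp (dist_fourier v) \<subseteq> O'"
    and one: "\<And>x. x \<in> O' \<Longrightarrow> \<Phi> x = 1" and f: "f \<in> schwartz"
  shows "v f = v (fourier (\<lambda>\<xi>. \<Phi> \<xi> * inv_fourier f \<xi>))"
proof -
  let ?g = "inv_fourier f"
  have g: "?g \<in> schwartz" using f by (rule schwartz_inv_fourier)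
  have \<Phi>S: "\<Phi> \<in> schwartz" using \<Phi> by (rule test_functions_schwartz)
  have s1: "(\<lambda>\<xi>. \<Phi> \<xi> * ?g \<xi>) \<in> schwartz" by (rule schwartz_mult[OF \<Phi>S g])
  have s2: "(\<lambda>\<xi>. (1 - \<Phi> \<xi>) * ?g \<xi>) \<in> schwartz"
    using schwartz_diff[OF g s1] by (simp add: algebra_simps)
  have "(\<lambda>m. v (fourier (\<lambda>x. cut m x * ((1 - \<Phi> x) * ?g x)))) \<longlonglongrightarrow> v (fourier (\<lambda>\<xi>. (1 - \<Phi> \<xi>) * ?g \<xi>))"
    by (rule tempered_cut_limit[OF v sbdd_fourier fourier_add fourier_cmult s2])
  moreover have "v (fourier (\<lambda>x. cut m x * ((1 - \<Phi> x) * ?g x))) = 0" for m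
  proof -
    let ?f = "\<lambda>x. cut m x * ((1 - \<Phi> x) * ?g x)"
    have t: "?f \<in> test_functions"
      using test_functions_mult[OF schwartz_smooth[OF s2] cut_test[of m]] by (simp add: mult_ac)
    have "fun_supp ?f \<subseteq> - O'"
      unfolding fun_supp_def by (rule closure_minimal) (use one O(1) in auto)
    then have "fun_supp ?f \<inter> dist_supp (dist_fourier v) = {}" using O(2) by blast
    with _ t have "dist_fourier v ?f = 0"
    proof (rule vanish_off_dist_supp)
      fix f g :: "real ^ 'n \<Rightarrow> complex" assume "f \<in> test_functions" "g \<in> test_functions"
      then have "f \<in> schwartz" "g \<in> schwartz" by (simp_all add: test_functions_schwartz)
      then show "dist_fourier v (\<lambda>x. f x + g x) = dist_fourier v f + dist_fourier v g"
        by (simp add: dist_fourier_def schwartz_add fourier_add tempered_add[OF v] schwartz_fourier)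
    qed
    then show ?thesis using test_functions_schwartz[OF t] by (simp add: dist_fourier_def)
  qed
  ultimately have "(\<lambda>m. 0) \<longlonglongrightarrow> v (fourier (\<lambda>\<xi>. (1 - \<Phi> \<xi>) * ?g \<xi>))" by simp
  then have 0: "v (fourier (\<lambda>\<xi>. (1 - \<Phi> \<xi>) * ?g \<xi>)) = 0"
    by (simp add: tendsto_const_iff)
  have "v f = v (fourier (\<lambda>\<xi>. \<Phi> \<xi> * ?g \<xi> + (1 - \<Phi> \<xi>) * ?g \<xi>))"
    by (simp add: algebra_simps fourier_inv_fourier[OF f])
  also have "\<dots> = v (fourier (\<lambda>\<xi>. \<Phi> \<xi> * ?g \<xi>))"
    by (simp add: fourier_add[OF s1 s2] tempered_add[OF v schwartz_fourier[OF s1] schwartz_fourier[OF s2]] 0)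
  finally show ?thesis .
qed

end

locale band_limited = bump \<rho> R for \<rho> :: "real ^ 'n \<Rightarrow> complex" and R +
  fixes v :: "'n functional" and h \<Phi> :: "real ^ 'n \<Rightarrow> complex" and O' :: "(real ^ 'n) set"
  assumes v: "v \<in> tempered" and hv: "represents h v" and \<Phi>: "\<Phi> \<in> test_functions"
    and O': "open O'" "dist_supp (dist_fourier v) \<subseteq> O'" and one: "\<And>x. x \<in> O' \<Longrightarrow> \<Phi> x = 1"
begin

lemma h_measurable [measurable]: "h \<in> borel_measurable borel"
  using hv by (simp add: represents_def)

lemma h_loc: "compact K \<Longrightarrow> set_integrable lborel K h"
  using hv by (simp add: represents_def)

lemma \<Phi>_schwartz: "\<Phi> \<in> schwartz" using \<Phi> by (rule test_functions_schwartz)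

text \<open>The inverse transform of \<open>\<Phi>\<close>, reflected. Integrating
  \<open>h x * ker (x - y)\<close> over \<open>x\<close> formally gives back \<open>h y\<close>,
  which is how the reproducing formula leads to pointwise estimates.\<close>

definition ker :: "real ^ 'n \<Rightarrow> complex"
  where "ker z = of_real (1 / (2 * pi) ^ CARD('n)) * fourier \<Phi> z"

lemma ker_schwartz: "ker \<in> schwartz"
  unfolding ker_def[abs_def] by (intro schwartz_cmult schwartz_fourier \<Phi>_schwartz)

lemma ker_measurable [measurable]: "ker \<in> borel_measurable borel"
  by (rule schwartz_measurable[OF ker_schwartz])

lemma locally_integrable_continuous: "continuous_on UNIV w \<Longrightarrow> compact K \<Longrightarrow> set_integrable lborel K (w :: real ^ 'n \<Rightarrow> real)"
  unfolding set_integrable_def by (rule borel_integrable_compact) (auto elim: continuous_on_subset)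

text \<open>The growth estimate of the Paley--Wiener--Schwartz theorem. In the reproducing formula
  all derivatives fall on the kernel, so a seminorm of the convolved test function is bounded by a
  weighted L1 norm of \<open>f\<close>. Pairings with \<open>h\<close> thus see only the size of
  \<open>f\<close>, and \<open>AE_le_if_test_le\<close> makes the bound pointwise.\<close>

lemma poly_bound: "\<exists>C N. 0 \<le> C \<and> (AE x in lborel. norm (h x) \<le> C * (1 + norm x) ^ N)"
proof -
  obtain C N where CN: "\<forall>f\<in>schwartz. norm (v f) \<le> C * schwartz_seminorm N f"
    using v unfolding tempered_def by blast
  have ex: "\<exists>A. \<forall>f\<in>test_functions. \<forall>x. (1 + norm x) ^ N * norm (pderivs is (fourier (\<lambda>\<xi>. \<Phi> \<xi> * inv_fourier f \<xi>)) x)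
    \<le> A * (LINT y|lborel. (1 + norm y) ^ N * norm (f y))" for "is"
  proof -
    obtain \<Phi>' where P: "\<Phi>' \<in> schwartz"
      "\<And>g. g \<in> schwartz \<Longrightarrow> pderivs is (fourier (\<lambda>x. \<Phi> x * g x)) = fourier (\<lambda>x. \<Phi>' x * g x)"
      using pderivs_fourier_mult[OF \<Phi>_schwartz] by blast
    let ?k = "\<lambda>z. of_real (1 / (2 * pi) ^ CARD('n)) * fourier \<Phi>' z"
    have kS: "?k \<in> schwartz" by (intro schwartz_cmult schwartz_fourier P)
    obtain A where A: "A > 0" "\<And>z. norm (?k z) \<le> A / (1 + norm z) ^ N"
      using sbdd_bound0[OF sbdd_of_schwartz[OF kS]] by metis
    note [measurable] = schwartz_measurable[OF kS]
    have "(1 + norm x) ^ N * norm (pderivs is (fourier (\<lambda>\<xi>. \<Phi> \<xi> * inv_fourier f \<xi>)) x)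
      \<le> A * (LINT y|lborel. (1 + norm y) ^ N * norm (f y))" if f: "f \<in> test_functions" for f x
    proof -
      have fS: "f \<in> schwartz" using f by (rule test_functions_schwartz)
      note [measurable] = schwartz_measurable[OF fS]
      have int: "integrable lborel (\<lambda>y. (1 + norm y) ^ N * norm (f y))"
      proof -
        obtain B where B: "\<And>x. norm (f x) \<le> B / (1 + norm x) ^ (N + 2 * CARD('n))"
          using sbdd_bound0[OF sbdd_of_schwartz[OF fS]] by metis
        show ?thesis
        proof (rule integrable_decay)
          fix y :: "real ^ 'n"
          have "1 + norm y \<noteq> 0" using norm_ge_zero[of y] by linarith
          have "(1 + norm y) ^ N * norm (f y) \<le> (1 + norm y) ^ N * (B / (1 + norm y) ^ (N + 2 * CARD('n)))"
            by (intro mult_left_mono B) simp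
          also have "\<dots> = B / (1 + norm y) ^ (2 * CARD('n))"
            using \<open>1 + norm y \<noteq> 0\<close> by (simp add: power_add)
          finally show "norm ((1 + norm y) ^ N * norm (f y)) \<le> B / (1 + norm y) ^ (2 * CARD('n))" by simp
        qed measurable
      qed
      have "pderivs is (fourier (\<lambda>\<xi>. \<Phi> \<xi> * inv_fourier f \<xi>)) x = (LINT y|lborel. f y * ?k (x - y))"
        unfolding P(2)[OF schwartz_inv_fourier[OF fS]] by (rule fourier_mult_inv_fourier[OF fS P(1)])
      then have "(1 + norm x) ^ N * norm (pderivs is (fourier (\<lambda>\<xi>. \<Phi> \<xi> * inv_fourier f \<xi>)) x)
        = norm (LINT y|lborel. of_real ((1 + norm x) ^ N) * (f y * ?k (x - y)))"
        unfolding integral_mult_right_zero norm_mult norm_of_real by simp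
      also have "\<dots> \<le> (LINT y|lborel. A * ((1 + norm y) ^ N * norm (f y)))"
      proof (rule norm_integral_le)
        show "integrable lborel (\<lambda>y. A * ((1 + norm y) ^ N * norm (f y)))"
          by (intro integrable_mult_right int)
        fix y
        \<comment> \<open>The weight at \<open>x\<close> is split between \<open>y\<close> and
          \<open>x - y\<close>; kernel decay of the same order \<open>N\<close> absorbs the second
          part.\<close>
        have "(1 + norm x) ^ N \<le> (1 + norm y) ^ N * (1 + norm (x - y)) ^ N"
          unfolding power_mult_distrib[symmetric] by (intro power_mono weight_submult) auto
        then have "(1 + norm x) ^ N * norm (?k (x - y)) \<le> ((1 + norm y) ^ N * (1 + norm (x - y)) ^ N) * (A / (1 + norm (x - y)) ^ N)"
          by (intro mult_mono A(2)) auto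
        also have "\<dots> = A * (1 + norm y) ^ N"
        proof -
          have "1 + norm (x - y) \<noteq> 0" using norm_ge_zero[of "x - y"] by linarith
          then show ?thesis by simp
        qed
        finally have "norm (f y) * ((1 + norm x) ^ N * norm (?k (x - y))) \<le> norm (f y) * (A * (1 + norm y) ^ N)"
          by (intro mult_left_mono) auto
        then show "norm (of_real ((1 + norm x) ^ N) * (f y * ?k (x - y))) \<le> A * ((1 + norm y) ^ N * norm (f y))"
          unfolding norm_mult norm_of_real by (simp add: mult_ac)
      qed measurable
      finally show ?thesis by simp
    qed
    then show ?thesis by blast
  qed
  from choice[OF allI[OF ex]] obtain A where A: "\<forall>is. \<forall>f\<in>test_functions. \<forall>x. (1 + norm x) ^ N * norm (pderivs is (fourier (\<lambda>\<xi>. \<Phi> \<xi> * inv_fourier f \<xi>)) x)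
    \<le> A is * (LINT y|lborel. (1 + norm y) ^ N * norm (f y))" ..
  have fin: "finite {is :: 'n list. length is \<le> N}"
    using finite_lists_length_le[of "UNIV :: 'n set"] by simp
  define A' where "A' = (\<Sum>is | length is \<le> N. \<bar>A is\<bar>)"
  have AA: "A is \<le> A'" if "length is \<le> N" for "is"
    unfolding A'_def using member_le_sum[of "is" "{is. length is \<le> N}" "\<lambda>is. \<bar>A is\<bar>"] fin that by force
  define c where "c = real (card {is :: 'n list. length is \<le> N})"
  define C' where "C' = \<bar>C\<bar> * c * A'"
  have C'0: "0 \<le> C'" by (auto simp: C'_def c_def A'_def sum_nonneg)
  have "AE x in lborel. norm (h x) \<le> 2 * (C' * (1 + norm x) ^ N)"
  proof (rule AE_le_if_test_le[OF h_measurable _ h_loc])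
    show "set_integrable lborel K (\<lambda>x. C' * (1 + norm x) ^ N)" if "compact K" for K :: "(real ^ 'n) set"
      by (intro locally_integrable_continuous that continuous_intros)
    fix f :: "real ^ 'n \<Rightarrow> complex" assume f: "f \<in> test_functions"
    let ?F = "fourier (\<lambda>\<xi>. \<Phi> \<xi> * inv_fourier f \<xi>)"
    let ?I = "LINT y|lborel. (1 + norm y) ^ N * norm (f y)"
    have fS: "f \<in> schwartz" using f by (rule test_functions_schwartz)
    have FS: "?F \<in> schwartz" by (intro schwartz_fourier schwartz_mult \<Phi>_schwartz schwartz_inv_fourier fS)
    have I0: "0 \<le> ?I" by (rule Bochner_Integration.integral_nonneg) simp
    have sn: "schwartz_seminorm N ?F \<le> c * (A' * ?I)"
      unfolding c_def
    proof (rule seminorm_le)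
      fix "is" :: "'n list" and x :: "real ^ 'n" assume l: "length is \<le> N"
      show "(1 + norm x) ^ N * norm (pderivs is ?F x) \<le> A' * ?I"
        by (rule order_trans[OF A[rule_format, OF f] mult_right_mono[OF AA[OF l] I0]])
    qed
    have sn0: "0 \<le> schwartz_seminorm N ?F" by (rule seminorm_nonneg[OF FS])
    have "norm (LINT x|lborel. h x * f x) = norm (v f)" using hv f by (simp add: represents_def)
    also have "v f = v ?F" by (rule band_limited_reproducing[OF v \<Phi> O' one fS])
    also have "norm (v ?F) \<le> C * schwartz_seminorm N ?F" using CN FS by blast
    also have "\<dots> \<le> \<bar>C\<bar> * (c * (A' * ?I))" using sn sn0 by (intro mult_mono) auto
    also have "\<dots> = C' * ?I" by (simp add: C'_def mult_ac)
    also have "\<dots> = (LINT x|lborel. C' * (1 + norm x) ^ N * norm (f x))"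
      unfolding integral_mult_right_zero[symmetric] by (simp add: mult.assoc)
    finally show "norm (LINT x|lborel. h x * f x) \<le> (LINT x|lborel. C' * (1 + norm x) ^ N * norm (f x))" .
  qed measurable
  then have "AE x in lborel. norm (h x) \<le> (2 * C') * (1 + norm x) ^ N" by (simp only: mult.assoc)
  with C'0 show ?thesis by (intro exI[of _ "2 * C'"] exI[of _ N]) auto
qed

end

section \<open>Self-bounds of band-limited functions and the Nikolskii inequality\<close>

context band_limited
begin

text \<open>\<open>represents\<close> speaks of test functions, but the reproducing formula turns
  these into Schwartz functions. The growth bound makes \<open>h\<close> integrable against them,
  and both sides of the identity survive the limit of cutoffs.\<close>

lemma pairing_schwartz:
  assumes f: "f \<in> schwartz"
  shows "integrable lborel (\<lambda>x. h x * f x)" "v f = (LINT x|lborel. h x * f x)"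
proof -
  obtain C N where C: "0 \<le> C" "AE x in lborel. norm (h x) \<le> C * (1 + norm x) ^ N"
    using poly_bound by blast
  obtain B where B: "B > 0" "\<And>x. norm (f x) \<le> B / (1 + norm x) ^ (N + 2 * CARD('n))"
    using sbdd_bound0[OF sbdd_of_schwartz[OF f]] by metis
  note [measurable] = schwartz_measurable[OF f]
  have iw: "integrable lborel (\<lambda>x::real ^ 'n. (C * B) * (1 / (1 + norm x) ^ (2 * CARD('n))))"
    by (intro integrable_mult_right integrable_weight)
  have le: "AE x in lborel. norm (h x * f x) \<le> (C * B) * (1 / (1 + norm x) ^ (2 * CARD('n)))"
    using C(2)
  proof eventually_elim
    fix x assume x: "norm (h x) \<le> C * (1 + norm x) ^ N"
    have nz: "1 + norm x \<noteq> 0" using norm_ge_zero[of x] by linarith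
    have "norm (h x * f x) \<le> (C * (1 + norm x) ^ N) * (B / (1 + norm x) ^ (N + 2 * CARD('n)))"
      unfolding norm_mult using x C(1) by (intro mult_mono B(2)) auto
    also have "\<dots> = (C * B) * (1 / (1 + norm x) ^ (2 * CARD('n)))"
      using nz by (simp add: power_add)
    finally show "norm (h x * f x) \<le> (C * B) * (1 / (1 + norm x) ^ (2 * CARD('n)))" .
  qed
  show i: "integrable lborel (\<lambda>x. h x * f x)"
  proof (rule Bochner_Integration.integrable_bound[OF iw])
    show "AE x in lborel. norm (h x * f x) \<le> norm (C * B * (1 / (1 + norm x) ^ (2 * CARD('n))))"
      using le unfolding real_norm_def by eventually_elim (rule order_trans[OF _ abs_ge_self])
  qed measurable
  have "(\<lambda>m. v (\<lambda>x. cut m x * f x)) \<longlonglongrightarrow> v f"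
    by (rule tempered_cut_limit[OF v _ _ _ f, where T = "\<lambda>x. x"]) auto
  moreover have "v (\<lambda>x. cut m x * f x) = (LINT x|lborel. h x * (cut m x * f x))" for m
  proof -
    have "(\<lambda>x. cut m x * f x) \<in> test_functions"
      using test_functions_mult[OF schwartz_smooth[OF f] cut_test[of m]] by (simp add: mult.commute)
    then show ?thesis using hv by (simp add: represents_def)
  qed
  moreover have "(\<lambda>m. LINT x|lborel. h x * (cut m x * f x)) \<longlonglongrightarrow> (LINT x|lborel. h x * (1 * f x))"
  proof -
    obtain D where D: "D \<ge> 1" "\<And>m x. norm (cut m x) \<le> D" using cut_bounded by metis
    have [measurable]: "cut m \<in> borel_measurable borel" for m
      using cut_test[of m] smooth_measurable by (auto simp: test_functions_iff)
    show ?thesis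
    proof (rule integral_dominated_convergence)
      show "integrable lborel (\<lambda>x. D * norm (h x * f x))"
        by (intro integrable_mult_right integrable_norm i)
      show "AE x in lborel. (\<lambda>m. h x * (cut m x * f x)) \<longlonglongrightarrow> h x * (1 * f x)"
        by (intro AE_I2 tendsto_intros cut_tendsto)
      fix m show "AE x in lborel. norm (h x * (cut m x * f x)) \<le> D * norm (h x * f x)"
      proof (rule AE_I2)
        fix x
        have "norm (cut m x) * norm (h x * f x) \<le> D * norm (h x * f x)"
          by (intro mult_right_mono D(2)) simp
        then show "norm (h x * (cut m x * f x)) \<le> D * norm (h x * f x)"
          by (simp add: norm_mult mult_ac)
      qed
    qed measurable
  qed
  ultimately show "v f = (LINT x|lborel. h x * f x)" using LIMSEQ_unique by force
qed

text \<open>The moduli stand inside the integral, so that Fubini applies and bounds on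
  \<open>norm (h x)\<close> can be inserted; up to a factor it is the majorant of \<open>h\<close>
  in \<open>self_bound\<close>.\<close>

definition w :: "real ^ 'n \<Rightarrow> real"
  where "w y = (LINT x|lborel. norm (h x) * norm (ker (x - y)))"

lemma w_measurable [measurable]: "w \<in> borel_measurable borel"
proof -
  have "(\<lambda>y. LINT x|lborel. norm (h x) * norm (ker (x - y))) \<in> borel_measurable lborel"
    by (rule lborel.borel_measurable_lebesgue_integral) measurable
  then show ?thesis by (simp add: w_def[abs_def])
qed

lemma w_bound:
  obtains C N where "0 \<le> C" "\<And>y. integrable lborel (\<lambda>x. norm (h x) * norm (ker (x - y)))"
    "\<And>y. w y \<le> C * (1 + norm y) ^ N"
proof -
  obtain C N where C: "0 \<le> C" "AE x in lborel. norm (h x) \<le> C * (1 + norm x) ^ N"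
    using poly_bound by blast
  let ?W = "2 * CARD('n)"
  \<comment> \<open>Decay of order \<open>N\<close> beats the growth of \<open>h\<close>, and
    \<open>2 * CARD('n)\<close> further powers leave an integrable weight.\<close>
  obtain A where A: "A > 0" "\<And>x. norm (ker x) \<le> A / (1 + norm x) ^ (N + ?W)"
    using sbdd_bound0[OF sbdd_of_schwartz[OF ker_schwartz]] by metis
  let ?b = "\<lambda>y x. (C * A * (1 + norm y) ^ (N + ?W)) * (1 / (1 + norm x) ^ ?W)"
  have ib: "integrable lborel (\<lambda>x::real ^ 'n. ?b y x)" for y :: "real ^ 'n"
    by (intro integrable_mult_right integrable_weight)
  have le: "AE x in lborel. norm (h x) * norm (ker (x - y)) \<le> ?b y x" for y
    using C(2)
  proof eventually_elim
    fix x assume x: "norm (h x) \<le> C * (1 + norm x) ^ N"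
    have nz: "1 + norm x > 0" "1 + norm (x - y) > 0" "1 + norm y > 0"
      using norm_ge_zero[of x] norm_ge_zero[of "x - y"] norm_ge_zero[of y] by linarith+
    have "(1 + norm x) ^ (N + ?W) \<le> (1 + norm y) ^ (N + ?W) * (1 + norm (x - y)) ^ (N + ?W)"
      unfolding power_mult_distrib[symmetric] using nz by (intro power_mono weight_submult) auto
    then have "A / (1 + norm (x - y)) ^ (N + ?W) \<le> A * (1 + norm y) ^ (N + ?W) / (1 + norm x) ^ (N + ?W)"
      using nz A(1) by (simp add: divide_le_eq pos_le_divide_eq mult_ac) 
    then have "norm (ker (x - y)) \<le> A * (1 + norm y) ^ (N + ?W) / (1 + norm x) ^ (N + ?W)"
      using A(2)[of "x - y"] by linarith
    then have "norm (h x) * norm (ker (x - y)) \<le> (C * (1 + norm x) ^ N) * (A * (1 + norm y) ^ (N + ?W) / (1 + norm x) ^ (N + ?W))"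
      using x C(1) nz by (intro mult_mono) auto
    also have "\<dots> = ?b y x" using nz by (simp add: power_add)
    finally show "norm (h x) * norm (ker (x - y)) \<le> ?b y x" .
  qed
  have i: "integrable lborel (\<lambda>x. norm (h x) * norm (ker (x - y)))" for y
  proof (rule Bochner_Integration.integrable_bound[OF ib[of y]])
    show "AE x in lborel. norm (norm (h x) * norm (ker (x - y))) \<le> norm (?b y x)"
      using le[of y] unfolding real_norm_def by eventually_elim (rule order_trans[OF _ abs_ge_self], simp)
  qed measurable
  let ?I = "LINT x|(lborel :: (real ^ 'n) measure). 1 / (1 + norm x) ^ ?W"
  have "w y \<le> (C * A * ?I) * (1 + norm y) ^ (N + ?W)" for y
  proof -
    have "w y \<le> (LINT x|(lborel :: (real ^ 'n) measure). ?b y x)"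
      unfolding w_def by (rule integral_mono_AE[OF i[of y] ib[of y] le[of y]])
    also have "\<dots> = (C * A * (1 + norm y) ^ (N + ?W)) * ?I" by (rule integral_mult_right_zero)
    finally show ?thesis by (simp add: mult_ac)
  qed
  moreover have "0 \<le> C * A * ?I"
    using C(1) A(1) by (intro mult_nonneg_nonneg Bochner_Integration.integral_nonneg) auto
  ultimately show thesis using that i by blast
qed

lemma w_nonneg: "0 \<le> w y"
  unfolding w_def by (rule Bochner_Integration.integral_nonneg) simp

text \<open>Pairing \<open>h\<close> with a test function equals pairing it with the convolved one.
  Fubini moves the kernel from \<open>f\<close> to \<open>h\<close>, and the estimate of pairings
  becomes pointwise with the factor 2 of \<open>AE_le_if_test_le\<close>.\<close>

lemma self_bound: "AE y in lborel. norm (h y) \<le> 2 * w y"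
proof -
  obtain C N where C: "0 \<le> C" and iw: "\<And>y. integrable lborel (\<lambda>x. norm (h x) * norm (ker (x - y)))"
    and wb: "\<And>y. w y \<le> C * (1 + norm y) ^ N" using w_bound by metis
  show ?thesis
  proof (rule AE_le_if_test_le[OF h_measurable w_measurable h_loc])
    fix K :: "(real ^ 'n) set" assume K: "compact K"
    have [measurable]: "K \<in> sets borel" using K by (simp add: borel_compact)
    have c: "set_integrable lborel K (\<lambda>y. C * (1 + norm y) ^ N)"
      by (intro locally_integrable_continuous K continuous_intros)
    show "set_integrable lborel K w"
      unfolding set_integrable_def
    proof (rule Bochner_Integration.integrable_bound[OF c[unfolded set_integrable_def]])
      show "AE x in lborel. norm (indicator K x *\<^sub>R w x) \<le> norm (indicator K x *\<^sub>R (C * (1 + norm x) ^ N))"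
        using wb w_nonneg order_trans[OF wb abs_ge_self] by (intro AE_I2) (auto simp: indicator_def)
    qed measurable
  next
    fix f :: "real ^ 'n \<Rightarrow> complex" assume f: "f \<in> test_functions"
    have fS: "f \<in> schwartz" using f by (rule test_functions_schwartz)
    note [measurable] = schwartz_measurable[OF fS]
    let ?F = "fourier (\<lambda>\<xi>. \<Phi> \<xi> * inv_fourier f \<xi>)"
    have FS: "?F \<in> schwartz" by (intro schwartz_fourier schwartz_mult \<Phi>_schwartz schwartz_inv_fourier fS)
    have Fx: "?F x = (LINT y|lborel. f y * ker (x - y))" for x
      unfolding ker_def by (rule fourier_mult_inv_fourier[OF fS \<Phi>_schwartz])
    let ?G = "\<lambda>y x. norm (f y) * (norm (h x) * norm (ker (x - y)))"
    have iwf: "integrable lborel (\<lambda>y. norm (f y) * w y)"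
    proof -
      obtain B where B: "B > 0" "\<And>x. norm (f x) \<le> B / (1 + norm x) ^ (N + 2 * CARD('n))"
        using sbdd_bound0[OF sbdd_of_schwartz[OF fS]] by metis
      show ?thesis
      proof (rule integrable_decay)
        fix y :: "real ^ 'n"
        have nz: "1 + norm y \<noteq> 0" using norm_ge_zero[of y] by linarith
        have "norm (f y) * w y \<le> (B / (1 + norm y) ^ (N + 2 * CARD('n))) * (C * (1 + norm y) ^ N)"
          using B(1) w_nonneg by (intro mult_mono B(2) wb) auto
        also have "\<dots> = (B * C) / (1 + norm y) ^ (2 * CARD('n))" using nz by (simp add: power_add)
        finally show "norm (norm (f y) * w y) \<le> (B * C) / (1 + norm y) ^ (2 * CARD('n))"
          using w_nonneg[of y] by simp
      qed measurable
    qed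
    have iG: "integrable (lborel \<Otimes>\<^sub>M lborel) (case_prod ?G)"
    proof (rule lborel_pair.Fubini_integrable)
      show "case_prod ?G \<in> borel_measurable (lborel \<Otimes>\<^sub>M lborel)" by measurable
      have *: "(LINT x|lborel. norm (case_prod ?G (y, x))) = norm (f y) * w y" for y
        unfolding w_def integral_mult_right_zero[symmetric] by simp
      show "integrable lborel (\<lambda>y. LINT x|lborel. norm (case_prod ?G (y, x)))" unfolding * by (rule iwf)
      show "AE y in lborel. integrable lborel (\<lambda>x. case_prod ?G (y, x))"
        unfolding split_conv by (intro AE_I2 integrable_mult_right iw)
    qed
    have "norm (LINT x|lborel. h x * f x) = norm (v f)" using hv f by (simp add: represents_def)
    also have "v f = v ?F" by (rule band_limited_reproducing[OF v \<Phi> O' one fS])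
    also have "v ?F = (LINT x|lborel. h x * ?F x)" by (rule pairing_schwartz(2)[OF FS])
    also have "norm \<dots> \<le> (LINT x|lborel. (LINT y|lborel. ?G y x))"
    proof (rule norm_integral_le)
      show "integrable lborel (\<lambda>x. LINT y|lborel. ?G y x)"
        by (rule lborel_pair.integrable_snd[OF iG])
      show "(\<lambda>x. h x * ?F x) \<in> borel_measurable borel" using schwartz_measurable[OF FS] by measurable
      fix x
      have "norm (?F x) \<le> (LINT y|lborel. norm (f y * ker (x - y)))"
        unfolding Fx by (rule integral_norm_bound)
      then have "norm (h x * ?F x) \<le> norm (h x) * (LINT y|lborel. norm (f y * ker (x - y)))"
        unfolding norm_mult[of "h x"] by (rule mult_left_mono) simp
      also have "\<dots> = (LINT y|lborel. ?G y x)"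
        unfolding integral_mult_right_zero[symmetric] by (simp add: norm_mult mult_ac)
      finally show "norm (h x * ?F x) \<le> (LINT y|lborel. ?G y x)" .
    qed
    also have "(LINT x|lborel. (LINT y|lborel. ?G y x)) = (LINT y|lborel. (LINT x|lborel. ?G y x))"
      by (rule lborel_pair.Fubini_integral[OF iG])
    also have "\<dots> = (LINT y|lborel. w y * norm (f y))"
      unfolding integral_mult_right_zero w_def by (simp add: mult.commute)
    finally show "norm (LINT x|lborel. h x * f x) \<le> (LINT y|lborel. w y * norm (f y))" .
  qed
qed

text \<open>Only polynomial growth is known so far, so the self-improvement is applied to
  \<open>h\<close> divided by \<open>u m x ^ N\<close>, which is bounded for each \<open>m\<close>.
  The resulting bound does not involve \<open>m\<close>, and letting \<open>m\<close> grow removes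
  the damping.\<close>

lemma essentially_bounded:
  assumes p: "0 < p" "p < 1" and J: "integrable lborel (\<lambda>x. norm (h x) powr p)"
  shows "\<exists>D. AE x in lborel. norm (h x) \<le> D"
proof -
  obtain C N where C: "0 \<le> C" "AE x in lborel. norm (h x) \<le> C * (1 + norm x) ^ N"
    using poly_bound by blast
  obtain C' N' where iw: "\<And>y. integrable lborel (\<lambda>x. norm (h x) * norm (ker (x - y)))"
    using w_bound by metis
  obtain A where A: "A > 0" "\<And>x. norm (ker x) \<le> A / (1 + norm x) ^ N"
    using sbdd_bound0[OF sbdd_of_schwartz[OF ker_schwartz]] by metis
  define I where "I = (LINT x|lborel. norm (h x) powr p)"
  have I0: "0 \<le> I" unfolding I_def by (rule Bochner_Integration.integral_nonneg) simp
  define c where "c = 2 * A * I"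
  have c0: "0 \<le> c" using A(1) I0 by (simp add: c_def)
  \<comment> \<open>This weight dominates \<open>1 + norm x\<close> up to the factor
    \<open>m + 1\<close>, varies slowly with constants independent of \<open>m\<close>, and tends to
    1 pointwise.\<close>
  define u where "u m x = 1 + norm x / real (Suc m)" for m and x :: "real ^ 'n"
  have u1: "1 \<le> u m x" for m x by (simp add: u_def)
  have up: "0 < u m x ^ N" for m x using u1[of m x] by (intro zero_less_power) linarith
  define g where "g m x = norm (h x) / u m x ^ N" for m x
  have g0: "0 \<le> g m x" for m x using up[of m x] by (simp add: g_def)
  have gh: "g m x \<le> norm (h x)" for m x
    using mult_left_mono[OF one_le_power[OF u1], of "norm (h x)" m x N] up[of m x]
    by (simp add: g_def divide_le_eq)
  have gB: "AE x in lborel. g m x \<le> c powr (1 / p)" for m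
  proof (rule ex_sup_bound_self[OF g0 _ c0 p])
    show "AE x in lborel. g m x \<le> C * real (Suc m) ^ N"
      using C(2)
    proof eventually_elim
      fix x assume x: "norm (h x) \<le> C * (1 + norm x) ^ N"
      have "1 + norm x \<le> real (Suc m) * u m x"
        by (simp add: u_def distrib_left del: of_nat_Suc)
      then have "(1 + norm x) ^ N \<le> (real (Suc m) * u m x) ^ N" by (intro power_mono) auto
      then have "C * (1 + norm x) ^ N \<le> C * (real (Suc m) ^ N * u m x ^ N)"
        using C(1) by (intro mult_left_mono) (auto simp: power_mult_distrib)
      then show "g m x \<le> C * real (Suc m) ^ N"
        using x up[of m x] unfolding g_def pos_divide_le_eq[OF up] by (simp add: mult.assoc)
    qed
    fix D assume D: "0 \<le> D" "AE x in lborel. g m x \<le> D"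
    show "AE x in lborel. g m x \<le> c * D powr (1 - p)"
      using self_bound
    proof eventually_elim
      fix y assume y: "norm (h y) \<le> 2 * w y"
      \<comment> \<open>Kernel decay of order \<open>N\<close> pays for comparing the weights at
        \<open>x\<close> and \<open>y\<close>:
        \<open>u m x \<le> u m y * (1 + norm (x - y))\<close>, with no constant depending on
        \<open>m\<close>.\<close>
      have k: "norm (ker (x - y)) \<le> A * u m y ^ N / u m x ^ N" for x
      proof -
        have n0: "0 < 1 + norm (x - y)" using norm_ge_zero[of "x - y"] by linarith
        have "u m x \<le> u m y * (1 + norm (x - y))"
        proof -
          have "norm x \<le> norm y + norm (x - y)" using norm_triangle_ineq[of y "x - y"] by simp
          then have "norm x / real (Suc m) \<le> (norm y + norm (x - y)) / real (Suc m)"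
            by (intro divide_right_mono) auto
          also have "\<dots> \<le> norm y / real (Suc m) + norm (x - y)"
            by (simp add: add_divide_distrib divide_le_eq distrib_left)
          also have "\<dots> \<le> norm y / real (Suc m) + norm (x - y) * u m y"
            using mult_left_mono[OF u1[of m y], of "norm (x - y)"] by simp
          finally show ?thesis by (simp add: u_def algebra_simps add_divide_distrib)
        qed
        then have "u m x ^ N \<le> u m y ^ N * (1 + norm (x - y)) ^ N"
          unfolding power_mult_distrib[symmetric] using u1[of m x] by (intro power_mono) auto
        then have "A / (1 + norm (x - y)) ^ N \<le> A * u m y ^ N / u m x ^ N"
          using A(1) n0 up[of m x] by (simp add: divide_le_eq pos_le_divide_eq mult_ac)
        then show ?thesis using A(2)[of "x - y"] by linarith
      qed
      have "w y \<le> (LINT x|lborel. (A * u m y ^ N * D powr (1 - p)) * norm (h x) powr p)"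
        unfolding w_def
      proof (rule integral_mono_AE[OF iw])
        show "integrable lborel (\<lambda>x. (A * u m y ^ N * D powr (1 - p)) * norm (h x) powr p)"
          by (intro integrable_mult_right J)
        show "AE x in lborel. norm (h x) * norm (ker (x - y)) \<le> (A * u m y ^ N * D powr (1 - p)) * norm (h x) powr p"
          using D(2)
        proof eventually_elim
          fix x assume x: "g m x \<le> D"
          have "norm (h x) * norm (ker (x - y)) \<le> norm (h x) * (A * u m y ^ N / u m x ^ N)"
            by (intro mult_left_mono k) simp
          also have "\<dots> = (A * u m y ^ N) * g m x" by (simp add: g_def)
          also have "g m x \<le> D powr (1 - p) * g m x powr p"
            by (rule le_powr_split[OF g0 x p])
          \<comment> \<open>The weight is at least 1, so it may be dropped in the power
            \<open>p\<close>; what remains is the integral \<open>I\<close>, free of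
            \<open>m\<close>.\<close>
          also have "\<dots> \<le> D powr (1 - p) * norm (h x) powr p"
            using gh[of m x] g0[of m x] p by (intro mult_left_mono powr_mono2) auto
          finally show "norm (h x) * norm (ker (x - y)) \<le> (A * u m y ^ N * D powr (1 - p)) * norm (h x) powr p"
            using A(1) up[of m y] by (simp add: mult.assoc)
        qed
      qed
      also have "\<dots> = (A * u m y ^ N * D powr (1 - p)) * I" unfolding I_def by (rule integral_mult_right_zero)
      finally have "norm (h y) \<le> 2 * ((A * u m y ^ N * D powr (1 - p)) * I)" using y by linarith
      then show "g m y \<le> c * D powr (1 - p)"
        unfolding g_def pos_divide_le_eq[OF up] by (simp add: c_def mult_ac)
    qed
  qed
  then have "AE x in lborel. \<forall>m. g m x \<le> c powr (1 / p)" by (simp add: AE_all_countable)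
  then have "AE x in lborel. norm (h x) \<le> c powr (1 / p)"
  proof eventually_elim
    fix x assume x: "\<forall>m. g m x \<le> c powr (1 / p)"
    have "(\<lambda>m. norm (h x) / (1 + norm x * (1 / real (Suc m))) ^ N) \<longlonglongrightarrow> norm (h x) / (1 + norm x * 0) ^ N"
      by (intro tendsto_intros LIMSEQ_Suc[OF lim_1_over_n]) auto
    then have "norm (h x) / (1 + norm x * 0) ^ N \<le> c powr (1 / p)"
      by (rule LIMSEQ_le_const2) (use x in \<open>auto simp: g_def u_def\<close>)
    then show "norm (h x) \<le> c powr (1 / p)" by simp
  qed
  then show ?thesis by blast
qed

text \<open>With boundedness at hand, the L1 norm is at most \<open>D powr (1 - p) * I\<close>, and
  the supremum at most \<open>2 * k\<close> times the L1 norm; \<open>ex_sup_bound_self\<close>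
  yields the supremum bound \<open>(2 * k * I) powr (1 / p)\<close>, which is inserted once more. Of
  the kernel only the sup norm \<open>k\<close> enters, and this makes the dependence on the
  frequency scale explicit.\<close>

lemma nikolskii:
  assumes p: "0 < p" "p < 1" and J: "integrable lborel (\<lambda>x. norm (h x) powr p)"
    and k: "\<And>z. norm (ker z) \<le> k"
  shows "integrable lborel h"
    and "(LINT x|lborel. norm (h x)) \<le> (2 * k) powr ((1 - p) / p) * (LINT x|lborel. norm (h x) powr p) powr (1 / p)"
proof -
  have k0: "0 \<le> k" using k[of 0] norm_ge_zero order_trans by blast
  define I where "I = (LINT x|lborel. norm (h x) powr p)"
  have I0: "0 \<le> I" unfolding I_def by (rule Bochner_Integration.integral_nonneg) simp
  obtain D0 where D0: "AE x in lborel. norm (h x) \<le> D0" using essentially_bounded[OF p J] by blast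
  obtain C' N' where iw: "\<And>y. integrable lborel (\<lambda>x. norm (h x) * norm (ker (x - y)))"
    using w_bound by metis
  have split: "AE x in lborel. norm (h x) \<le> D powr (1 - p) * norm (h x) powr p"
    if "AE x in lborel. norm (h x) \<le> D" for D
    using that by eventually_elim (rule le_powr_split[OF norm_ge_zero _ p])
  have L1: "integrable lborel h \<and> (LINT x|lborel. norm (h x)) \<le> D powr (1 - p) * I" if D: "AE x in lborel. norm (h x) \<le> D" for D
  proof
    have iD: "integrable lborel (\<lambda>x. D powr (1 - p) * norm (h x) powr p)" by (intro integrable_mult_right J)
    show i: "integrable lborel h"
    proof (rule Bochner_Integration.integrable_bound[OF iD])
      show "AE x in lborel. norm (h x) \<le> norm (D powr (1 - p) * norm (h x) powr p)"
        using split[OF D] by eventually_elim simp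
    qed measurable
    have "(LINT x|lborel. norm (h x)) \<le> (LINT x|lborel. D powr (1 - p) * norm (h x) powr p)"
      by (rule integral_mono_AE[OF integrable_norm[OF i] iD split[OF D]])
    then show "(LINT x|lborel. norm (h x)) \<le> D powr (1 - p) * I" by (simp add: I_def)
  qed
  have "AE x in lborel. norm (h x) \<le> (2 * k * I) powr (1 / p)"
  proof (rule ex_sup_bound_self[OF norm_ge_zero D0 _ p])
    show "0 \<le> 2 * k * I" using k0 I0 by simp
    fix D assume D: "0 \<le> D" "AE x in lborel. norm (h x) \<le> D"
    show "AE x in lborel. norm (h x) \<le> 2 * k * I * D powr (1 - p)"
      using self_bound
    proof eventually_elim
      fix y assume y: "norm (h y) \<le> 2 * w y"
      have "w y \<le> (LINT x|lborel. norm (h x) * k)"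
        unfolding w_def using L1[OF D(2)]
        by (intro integral_mono[OF iw] integrable_mult_left mult_left_mono k) auto
      also have "\<dots> = (LINT x|lborel. norm (h x)) * k" by simp
      also have "\<dots> \<le> (D powr (1 - p) * I) * k" using L1[OF D(2)] k0 by (intro mult_right_mono) auto
      finally show "norm (h y) \<le> 2 * k * I * D powr (1 - p)" using y by (simp add: mult_ac)
    qed
  qed
  from L1[OF this]
  have L: "integrable lborel h" "(LINT x|lborel. norm (h x)) \<le> ((2 * k * I) powr (1 / p)) powr (1 - p) * I" by auto
  show "integrable lborel h" by (rule L(1))
  have "((2 * k * I) powr (1 / p)) powr (1 - p) * I = (2 * k) powr ((1 - p) / p) * (I powr ((1 - p) / p) * I)"
    using k0 I0 by (simp add: powr_powr powr_mult mult_ac)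
  also have "I powr ((1 - p) / p) * I = I powr (1 / p)"
  proof (cases "I = 0")
    case False
    then have "I powr ((1 - p) / p) * I powr 1 = I powr ((1 - p) / p + 1)" using I0 by (simp add: powr_add)
    also have "(1 - p) / p + 1 = 1 / p" using p by (simp add: field_simps)
    finally show ?thesis using False I0 by simp
  qed simp
  finally show "(LINT x|lborel. norm (h x)) \<le> (2 * k) powr ((1 - p) / p) * (LINT x|lborel. norm (h x) powr p) powr (1 / p)"
    using L(2) by (simp add: I_def)
qed

end

section \<open>Quasi-norms of functions\<close>

lemma epowr_ennreal [simp]: "0 \<le> t \<Longrightarrow> epowr (ennreal t) r = ennreal (t powr r)"
  by (simp add: epowr_def)

lemma epowr_eq_top_iff: "0 < r \<Longrightarrow> epowr x r = \<infinity> \<longleftrightarrow> x = \<infinity>"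
  by (simp add: epowr_def)

lemma Lp_qnorm_finite:
  fixes h :: "real ^ 'n \<Rightarrow> complex"
  assumes p: "0 < p" and [measurable]: "h \<in> borel_measurable borel"
    and fin: "Lp_qnorm (ennreal p) (\<lambda>x. ennreal (norm (h x))) < \<infinity>"
  shows "integrable lborel (\<lambda>x. norm (h x) powr p)"
    and "Lp_qnorm (ennreal p) (\<lambda>x. ennreal (norm (h x))) = ennreal ((LINT x|lborel. norm (h x) powr p) powr (1 / p))"
proof -
  have Lp: "Lp_qnorm (ennreal p) (\<lambda>x. ennreal (norm (h x))) = epowr (\<integral>\<^sup>+x. ennreal (norm (h x) powr p) \<partial>lborel) (1 / p)"
    using p by (simp add: Lp_qnorm_def)
  have "(\<integral>\<^sup>+x. ennreal (norm (h x) powr p) \<partial>lborel) \<noteq> \<infinity>"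
  proof
    assume "(\<integral>\<^sup>+x. ennreal (norm (h x) powr p) \<partial>lborel) = \<infinity>"
    then show False using fin unfolding Lp by (simp add: epowr_def)
  qed
  then have "(\<integral>\<^sup>+x. ennreal (norm (h x) powr p) \<partial>lborel) < \<infinity>"
    by (simp add: less_top)
  then show i: "integrable lborel (\<lambda>x. norm (h x) powr p)"
    by (intro integrableI_nonneg) auto
  show "Lp_qnorm (ennreal p) (\<lambda>x. ennreal (norm (h x))) = ennreal ((LINT x|lborel. norm (h x) powr p) powr (1 / p))"
    unfolding Lp by (subst nn_integral_eq_integral[OF i]) (auto intro: Bochner_Integration.integral_nonneg)
qed

text \<open>The terms are eventually less than 1, where raising to a power \<open>q \<le> 1\<close>
  does not decrease them.\<close>

lemma summable_of_powr:
  fixes t :: "nat \<Rightarrow> real"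
  assumes t: "\<And>j. 0 \<le> t j" and q: "0 < q" "q \<le> 1" and s: "summable (\<lambda>j. t j powr q)"
  shows "summable t"
proof -
  have "(\<lambda>j. t j powr q) \<longlonglongrightarrow> 0" using s by (rule summable_LIMSEQ_zero)
  then have "\<forall>\<^sub>F j in sequentially. t j powr q < 1" by (rule order_tendstoD) simp
  then have "\<forall>\<^sub>F j in sequentially. norm (t j) \<le> t j powr q"
  proof eventually_elim
    fix j assume "t j powr q < 1"
    then have "t j \<le> 1" using q ge_one_powr_ge_zero[of "t j" q] by force
    then have "t j powr 1 \<le> t j powr q" using t q by (intro powr_mono') auto
    then show "norm (t j) \<le> t j powr q" using t[of j] by simp
  qed
  then show ?thesis using s by (rule summable_comparison_test_ev)
qed

lemma lq_qnorm_finite_summable: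
  assumes t: "\<And>j. 0 \<le> t j" and q: "0 < q" "q \<le> 1" and fin: "lq_qnorm (ennreal q) (\<lambda>j. ennreal (t j)) < \<infinity>"
  shows "summable t"
proof -
  have "epowr (\<Sum>j. ennreal (t j powr q)) (1 / q) < \<infinity>"
    using fin q t by (simp add: lq_qnorm_def)
  then have "(\<Sum>j. ennreal (t j powr q)) \<noteq> \<top>"
    by (auto simp: epowr_def)
  then have "summable (\<lambda>j. t j powr q)" by (intro summable_suminf_not_top) auto
  then show ?thesis by (rule summable_of_powr[OF t q])
qed

section \<open>The Dirac distribution\<close>

definition dirac :: "'n::finite functional"
  where "dirac = (\<lambda>f\<in>schwartz. f 0)"

lemma seminorm_bound_sup:
  fixes f :: "real ^ 'n \<Rightarrow> complex"
  assumes "f \<in> schwartz"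
  shows "norm (f x) \<le> schwartz_seminorm 0 f"
proof -
  have "{is :: 'n list. length is \<le> 0} = {[]}" by auto
  then have "schwartz_seminorm 0 f = (SUP x. norm (f x))" by (simp add: schwartz_seminorm_def)
  moreover have "\<forall>k is. bdd_above (range (\<lambda>x. (1 + norm x) ^ k * norm (pderivs is f x)))"
    using assms by (simp add: schwartz_def)
  from this[rule_format, of 0 "[]"] have "bdd_above (range (\<lambda>x. norm (f x)))" by simp
  ultimately show ?thesis by (metis cSUP_upper UNIV_I)
qed

lemma dirac_tempered: "(dirac :: 'n::finite functional) \<in> tempered"
proof -
  have "\<exists>C N. \<forall>f\<in>schwartz. norm (f 0) \<le> C * schwartz_seminorm N (f :: real ^ 'n \<Rightarrow> complex)"
    by (rule exI[of _ 1], rule exI[of _ 0]) (simp add: seminorm_bound_sup)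
  then show ?thesis
    unfolding tempered_def by (simp add: dirac_def schwartz_add schwartz_cmult)
qed

section \<open>The Dirac distribution lies outside the space A\<close>

locale aniso_cutoff =
  fixes a :: "real ^ 'n" and \<psi> :: "real ^ 'n \<Rightarrow> complex"
  assumes an: "anisotropy a" and cutoff: "cutoff a \<psi>"
begin

lemma \<psi>_test: "\<psi> \<in> test_functions" using cutoff by (simp add: cutoff_def)

lemma \<psi>_one: "aniso_norm a x \<le> 1 \<Longrightarrow> \<psi> x = 1" using cutoff by (simp add: cutoff_def)

lemma \<psi>_zero: "2 \<le> aniso_norm a x \<Longrightarrow> \<psi> x = 0" using cutoff by (simp add: cutoff_def)

lemma ex_bump: "\<exists>R. bump \<psi> R"
proof -
  have "bounded {x. \<psi> x \<noteq> 0}" using \<psi>_test by (simp add: test_functions_iff)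
  then obtain B where B: "\<And>x. \<psi> x \<noteq> 0 \<Longrightarrow> norm x \<le> B" by (auto simp: bounded_iff)
  \<comment> \<open>\<open>B + 1\<close> lies strictly beyond the support of \<open>\<psi>\<close>,
    and 2 ensures a radius greater than 1.\<close>
  have "bump \<psi> (max 2 (B + 1))"
    using B \<psi>_test by unfold_locales (force intro: \<psi>_one aniso_norm_le_1[OF an])+
  then show ?thesis ..
qed

text \<open>The index is real because \<open>real j - 1\<close> occurs, which is negative for
  \<open>j = 0\<close>.\<close>

definition dil :: "real \<Rightarrow> real ^ 'n \<Rightarrow> complex"
  where "dil r x = \<psi> (aniso_dil a (2 powr (- r)) x)"

lemma dil_test: "dil r \<in> test_functions"
  using test_functions_affine[OF \<psi>_test, of "\<chi> i. (2 powr (- r)) powr (a $ i)" 0]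
  by (simp add: dil_def[abs_def] aniso_dil_eq_diag)

lemma dil_one: "aniso_norm a x \<le> 2 powr r \<Longrightarrow> dil r x = 1"
  unfolding dil_def by (rule \<psi>_one) (simp add: aniso_norm_dil_le_iff[OF an] powr_minus field_simps)

lemma dil_zero: "2 powr (r + 1) \<le> aniso_norm a x \<Longrightarrow> dil r x = 0"
  unfolding dil_def by (rule \<psi>_zero) (simp add: aniso_norm_dil_ge_iff[OF an] powr_minus powr_add field_simps)

lemma prod_dil: "(\<Prod>i\<in>UNIV. \<bar>(2 powr r) powr (a $ i)\<bar>) = 2 powr (r * aniso_size a)"
  by (simp add: powr_powr powr_sum[symmetric] aniso_size_def sum_distrib_left)

lemma integral_norm_dil: "(LINT x|lborel. norm (dil r x)) = 2 powr (r * aniso_size a) * (LINT x|lborel. norm (\<psi> x))"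
proof -
  let ?d = "\<chi> i. (2 powr (- r)) powr (a $ i)"
  have [measurable]: "\<psi> \<in> borel_measurable borel"
    using \<psi>_test by (intro schwartz_measurable test_functions_schwartz)
  have "of_real (\<Prod>i\<in>UNIV. \<bar>?d $ i\<bar>) * (LINT x|lborel. complex_of_real (norm (\<psi> (0 + diag ?d x)))) = (LINT x|lborel. complex_of_real (norm (\<psi> x)))"
    by (rule lborel_integral_diag) auto
  then have "complex_of_real (2 powr (- r * aniso_size a) * (LINT x|lborel. norm (dil r x))) = complex_of_real (LINT x|lborel. norm (\<psi> x))"
    by (simp add: dil_def aniso_dil_eq_diag powr_powr powr_sum[symmetric] aniso_size_def sum_distrib_left sum_negf)
  then have "2 powr (- r * aniso_size a) * (LINT x|lborel. norm (dil r x)) = (LINT x|lborel. norm (\<psi> x))"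
    using of_real_eq_iff by blast
  then show ?thesis by (simp add: powr_minus field_simps)
qed

text \<open>The kernel of a cutoff at frequency \<open>2 ^ (j + 1)\<close> is bounded by a constant
  times \<open>2 powr (real j * aniso_size a)\<close>; the Nikolskii exponent
  \<open>(1 - p) / p\<close> turns this into exactly the weight of the critical smoothness.\<close>

lemma A_representation_L1:
  assumes p: "0 < p" "p < 1" and rep: "A_representation a (ennreal p) u V H"
  shows "\<exists>C\<ge>0. \<forall>j. integrable lborel (H j) \<and> (LINT x|lborel. norm (H j x)) \<le>
     C * (2 powr (real j * (aniso_size a * (1 / p - 1))) * (LINT x|lborel. norm (H j x) powr p) powr (1 / p))"
proof -
  obtain R where R: "bump \<psi> R" using ex_bump by blast
  define K where "K = 1 / (2 * pi) ^ CARD('n) * (LINT x|lborel. norm (\<psi> x))"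
  have K0: "0 \<le> K" unfolding K_def by (intro mult_nonneg_nonneg Bochner_Integration.integral_nonneg) auto
  define C where "C = (2 * (2 powr (aniso_size a) * K)) powr ((1 - p) / p)"
  have "integrable lborel (H j) \<and> (LINT x|lborel. norm (H j x)) \<le>
     C * (2 powr (real j * (aniso_size a * (1 / p - 1))) * (LINT x|lborel. norm (H j x) powr p) powr (1 / p))" for j
  proof -
    have V: "V j \<in> tempered" "represents (H j) (V j)" "Lp_qnorm (ennreal p) (\<lambda>x. ennreal (norm (H j x))) < \<infinity>"
      "dist_supp (dist_fourier (V j)) \<subseteq> {\<xi>. aniso_norm a \<xi> \<le> 2 ^ j}"
      using rep by (auto simp: A_representation_def)
    have Hm: "H j \<in> borel_measurable borel" using V(2) by (simp add: represents_def)
    \<comment> \<open>Index \<open>j + 1\<close> rather than \<open>j\<close>: the cutoff must be 1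
      on an open set containing the closed set \<open>aniso_norm a \<xi> \<le> 2 ^ j\<close>. The
      extra factor \<open>2 powr (aniso_size a)\<close> goes into \<open>C\<close>.\<close>
    let ?\<Phi> = "dil (real j + 1)"
    let ?O = "{x. norm (aniso_dil a (1 / 2 ^ (j + 1)) x) < 1}"
    interpret band_limited \<psi> R "V j" "H j" ?\<Phi> ?O
    proof (intro band_limited.intro band_limited_axioms.intro R V dil_test)
      show "open ?O" unfolding aniso_dil_eq_diag by (intro open_Collect_less continuous_intros)
      have "x \<in> ?O" if "aniso_norm a x \<le> 2 ^ j" for x
      proof -
        have "\<not> 2 ^ (j + 1) \<le> aniso_norm a x"
        proof
          assume "2 ^ (j + 1) \<le> aniso_norm a x"
          then have "(2::real) ^ (j + 1) \<le> 2 ^ j" using that by linarith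
          then show False by simp
        qed
        then show ?thesis using aniso_norm_compare(2)[OF an, of "2 ^ (j + 1)" x] by simp
      qed
      then show "dist_supp (dist_fourier (V j)) \<subseteq> ?O" using V(4) by blast
      fix x assume "x \<in> ?O"
      then have "aniso_norm a x \<le> 2 ^ (j + 1)"
        using aniso_norm_compare(1)[OF an, of "2 ^ (j + 1)" x] by simp
      then show "?\<Phi> x = 1" by (intro dil_one) (simp add: powr_add powr_realpow)
    qed
    define k where "k = 2 powr ((real j + 1) * aniso_size a) * K"
    have kb: "norm (ker z) \<le> k" for z
    proof -
      have "norm (fourier ?\<Phi> z) \<le> 2 powr ((real j + 1) * aniso_size a) * (LINT x|lborel. norm (\<psi> x))"
        unfolding integral_norm_dil[symmetric] by (intro fourier_bound schwartz_integrable \<Phi>_schwartz)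
      then have "1 / (2 * pi) ^ CARD('n) * norm (fourier ?\<Phi> z)
        \<le> 1 / (2 * pi) ^ CARD('n) * (2 powr ((real j + 1) * aniso_size a) * (LINT x|lborel. norm (\<psi> x)))"
        by (intro mult_left_mono) auto
      then show ?thesis unfolding ker_def norm_mult norm_of_real by (simp add: k_def K_def mult_ac)
    qed
    have J: "integrable lborel (\<lambda>x. norm (H j x) powr p)" by (rule Lp_qnorm_finite(1)[OF p(1) Hm V(3)])
    have "(2 * k) powr ((1 - p) / p) = C * 2 powr (real j * (aniso_size a * (1 / p - 1)))"
    proof -
      have e: "2 * k = (2 * (2 powr (aniso_size a) * K)) * 2 powr (real j * aniso_size a)"
      proof -
        have "(real j + 1) * aniso_size a = aniso_size a + real j * aniso_size a" by (simp add: algebra_simps)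
        then show ?thesis unfolding k_def by (simp only: powr_add) simp
      qed
      have "(2 powr (real j * aniso_size a)) powr ((1 - p) / p) = 2 powr (real j * (aniso_size a * (1 / p - 1)))"
        using p by (simp add: powr_powr diff_divide_distrib mult.assoc)
      then show ?thesis using K0 unfolding e C_def by (simp add: powr_mult)
    qed
    then show ?thesis using nikolskii[OF p J kb] by (simp add: mult.assoc)
  qed
  moreover have "0 \<le> C" by (simp add: C_def)
  ultimately show ?thesis by blast
qed

text \<open>Bumps that equal 1 at the origin and shrink to that point have pairings with each
  integrable \<open>H j\<close> tending to 0. The L1 bounds are summable in \<open>j\<close>, so
  Tannery's theorem takes the limit through the series, whereas the Dirac distribution always
  returns 1.\<close>

lemma dirac_notin_A_space:
  assumes p: "0 < p" "p < 1" and q: "0 < q" "q \<le> 1"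
  shows "dirac \<notin> A_space a (aniso_size a * (1 / p - 1)) (ennreal p) (ennreal q)"
proof
  let ?s = "aniso_size a * (1 / p - 1)"
  assume "dirac \<in> A_space a ?s (ennreal p) (ennreal q)"
  then obtain V H where rep: "A_representation a (ennreal p) dirac V H" and cost: "A_cost ?s (ennreal p) (ennreal q) H < \<infinity>"
    by (auto simp: A_space_def)
  have V: "V j \<in> tempered" "represents (H j) (V j)" "Lp_qnorm (ennreal p) (\<lambda>x. ennreal (norm (H j x))) < \<infinity>" for j
    using rep by (auto simp: A_representation_def)
  have Hm [measurable]: "H j \<in> borel_measurable borel" for j using V(2)[of j] by (simp add: represents_def)
  let ?t = "\<lambda>j. 2 powr (real j * ?s) * (LINT x|lborel. norm (H j x) powr p) powr (1 / p)"
  have "(\<lambda>j. ennreal (2 powr (real j * ?s)) * Lp_qnorm (ennreal p) (\<lambda>x. ennreal (norm (H j x)))) = (\<lambda>j. ennreal (?t j))"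
    by (simp add: Lp_qnorm_finite(2)[OF p(1) Hm V(3)] ennreal_mult)
  then have "lq_qnorm (ennreal q) (\<lambda>j. ennreal (?t j)) < \<infinity>"
    using cost by (simp add: A_cost_def)
  then have st: "summable ?t" by (intro lq_qnorm_finite_summable[OF _ q]) auto
  obtain C where C: "C \<ge> 0" "\<And>j. integrable lborel (H j)" "\<And>j. (LINT x|lborel. norm (H j x)) \<le> C * ?t j"
    using A_representation_L1[OF p rep] by blast
  obtain R where "bump \<psi> R" using ex_bump by blast
  then interpret bump \<psi> R .
  obtain B where B: "B \<ge> 1" "\<And>x. norm (\<psi> x) \<le> B" using bump_bounded by metis
  define f where "f m = bump_at 0 (1 / real (Suc m))" for m
  have ft: "f m \<in> test_functions" for m unfolding f_def by (rule bump_at_test) simp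
  have [measurable]: "f m \<in> borel_measurable borel" for m
    using schwartz_measurable[OF test_functions_schwartz[OF ft]] .
  have f0: "f m 0 = 1" for m by (simp add: f_def bump_at_one)
  have fB: "norm (f m x) \<le> B" for m x by (simp add: f_def bump_at_def B)
  have fl: "(\<lambda>m. f m x) \<longlonglongrightarrow> 0" if "x \<noteq> 0" for x
  proof (rule tendsto_eventually)
    have "norm x > 0" using that by simp
    then obtain N where N: "R / norm x < real N" using reals_Archimedean2 by blast
    show "\<forall>\<^sub>F m in sequentially. f m x = 0"
    proof (rule eventually_sequentiallyI[of N])
      fix m assume "N \<le> m"
      then have "R / norm x \<le> real (Suc m)" using N by linarith
      then have "R * (1 / real (Suc m)) \<le> norm (x - 0)"
        using \<open>norm x > 0\<close> by (simp add: divide_le_eq mult.commute)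
      then show "f m x = 0" unfolding f_def by (intro bump_at_zero) auto
    qed
  qed
  have Vf: "V j (f m) = (LINT x|lborel. H j x * f m x)" for j m
    using V(2)[of j] ft[of m] by (simp add: represents_def)
  have bnd: "norm (H j x * f m x) \<le> B * norm (H j x)" for j m x
    using mult_left_mono[OF fB[of m x], of "norm (H j x)"] by (simp add: norm_mult mult.commute)
  have lim: "(\<lambda>m. V j (f m)) \<longlonglongrightarrow> 0" for j
  proof -
    have "(\<lambda>m. LINT x|lborel. H j x * f m x) \<longlonglongrightarrow> (LINT x|(lborel :: (real ^ 'n) measure). (0::complex))"
    proof (rule integral_dominated_convergence)
      show "integrable lborel (\<lambda>x. B * norm (H j x))" by (intro integrable_mult_right integrable_norm C)
      show "AE x in lborel. (\<lambda>m. H j x * f m x) \<longlonglongrightarrow> 0"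
        using AE_lborel_singleton[of "0::real ^ 'n"]
      proof eventually_elim
        fix x :: "real ^ 'n" assume "x \<noteq> 0"
        from tendsto_mult_left[OF fl[OF this], of "H j x"] show "(\<lambda>m. H j x * f m x) \<longlonglongrightarrow> 0" by simp
      qed
      fix m show "AE x in lborel. norm (H j x * f m x) \<le> B * norm (H j x)" using bnd by (intro AE_I2)
    qed measurable
    then show ?thesis by (simp add: Vf)
  qed
  have bound: "norm (V j (f m)) \<le> B * (C * ?t j)" for j m
  proof -
    have "norm (V j (f m)) \<le> (LINT x|lborel. B * norm (H j x))"
      unfolding Vf by (rule norm_integral_le) (auto intro: bnd C)
    also have "\<dots> \<le> B * (C * ?t j)" using C(3)[of j] B(1) by simp
    finally show ?thesis .
  qed
  have "(\<lambda>m. \<Sum>j. V j (f m)) \<longlonglongrightarrow> (\<Sum>j. 0)"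
  proof -
    have "\<forall>\<^sub>F (j, m) in sequentially \<times>\<^sub>F sequentially. norm (V j (f m)) \<le> B * (C * ?t j)"
      using bound by (intro always_eventually) auto
    from tannerys_theorem[OF lim this] st show ?thesis
      by (simp add: summable_mult)
  qed
  moreover have "(\<Sum>j. V j (f m)) = 1" for m
  proof -
    have fs: "f m \<in> schwartz" by (rule test_functions_schwartz[OF ft])
    then have "(\<lambda>j. V j (f m)) sums dirac (f m)" using rep by (simp add: A_representation_def dist_sums_def)
    then show ?thesis using fs by (simp add: sums_iff dirac_def f0)
  qed
  ultimately have "(\<lambda>m. 1::complex) \<longlonglongrightarrow> 0" by simp
  then show False using LIMSEQ_unique[OF tendsto_const] by fastforce
qed

end

section \<open>Littlewood--Paley blocks\<close>

text \<open>Parseval's identity finds the function behind a functional that is given on the Fourier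
  side. The scalar \<open>c\<close> accommodates the coefficients of layers and of their
  superpositions.\<close>

lemma represents_inv_fourier:
  fixes \<Phi> :: "real ^ 'n \<Rightarrow> complex"
  assumes \<Phi>: "\<Phi> \<in> schwartz" and T: "\<And>f. f \<in> schwartz \<Longrightarrow> T f = c * (LINT \<xi>|lborel. \<Phi> \<xi> * inv_fourier f \<xi>)"
  shows "represents (\<lambda>x. c * inv_fourier \<Phi> x) T"
  unfolding represents_def
proof (intro conjI allI impI ballI)
  have S: "inv_fourier \<Phi> \<in> schwartz" by (rule schwartz_inv_fourier[OF \<Phi>])
  note [measurable] = schwartz_measurable[OF S]
  show "(\<lambda>x. c * inv_fourier \<Phi> x) \<in> borel_measurable borel" by measurable
  show "set_integrable lborel K (\<lambda>x. c * inv_fourier \<Phi> x)" if "compact K" for K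
    unfolding set_integrable_def using that
    by (intro integrable_mult_indicator integrable_mult_right schwartz_integrable S) (simp add: borel_compact)
  fix f :: "real ^ 'n \<Rightarrow> complex" assume "f \<in> test_functions"
  then have f: "f \<in> schwartz" by (rule test_functions_schwartz)
  have "(LINT x|lborel. inv_fourier \<Phi> x * f x) = (LINT \<xi>|lborel. \<Phi> \<xi> * inv_fourier f \<xi>)"
    by (intro inv_fourier_integral_exchange schwartz_integrable \<Phi> f schwartz_measurable schwartz_fourier)
  then show "T f = (LINT x|lborel. c * inv_fourier \<Phi> x * f x)"
    by (simp add: T[OF f] mult.assoc)
qed

lemma block_functional:
  assumes "f \<in> schwartz" "\<Phi> \<in> schwartz"
  shows "dist_inv_fourier (dist_mult \<Phi> (dist_fourier u)) f = u (fourier (\<lambda>\<xi>. \<Phi> \<xi> * inv_fourier f \<xi>))"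
  using assms by (simp add: dist_inv_fourier_def dist_mult_def dist_fourier_def schwartz_inv_fourier schwartz_mult)

lemma Lp_integrable_schwartz:
  fixes g :: "real ^ 'n \<Rightarrow> complex"
  assumes g: "g \<in> schwartz" and r: "0 < r"
  shows "integrable lborel (\<lambda>x. norm (g x) powr r)"
proof -
  let ?W = "2 * CARD('n)"
  \<comment> \<open>Chosen so that even for small \<open>r\<close> the power still decays like the
    integrable weight.\<close>
  obtain k :: nat where k: "real ?W / r \<le> real k" using real_arch_simple by blast
  then have kr: "real ?W \<le> real k * r" using r by (simp add: divide_le_eq)
  obtain B where B: "B > 0" "\<And>x. norm (g x) \<le> B / (1 + norm x) ^ k"
    using sbdd_bound0[OF sbdd_of_schwartz[OF g]] by metis
  note [measurable] = schwartz_measurable[OF g]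
  show ?thesis
  proof (rule integrable_decay)
    fix x :: "real ^ 'n"
    have n1: "1 + norm x \<ge> 1" by simp
    then have n0: "0 < 1 + norm x" by linarith
    have "norm (g x) powr r \<le> (B / (1 + norm x) ^ k) powr r"
      using B r by (intro powr_mono2) auto
    also have "\<dots> = B powr r / (1 + norm x) powr (real k * r)"
      using B(1) n0 by (simp add: powr_divide powr_realpow[symmetric] powr_powr)
    also have "\<dots> \<le> B powr r / (1 + norm x) powr (real ?W)"
      using n1 kr n0 by (intro divide_left_mono powr_mono) (auto intro!: mult_pos_pos)
    also have "\<dots> = B powr r / (1 + norm x) ^ ?W"
      using n0 powr_realpow[of "1 + norm x" ?W] by simp
    finally show "norm (norm (g x) powr r) \<le> B powr r / (1 + norm x) ^ ?W" by simp
  qed measurable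
qed

context aniso_cutoff
begin

abbreviation win :: "nat \<Rightarrow> real ^ 'n \<Rightarrow> complex"
  where "win \<equiv> lp_window a \<psi>"

lemma win_0: "win 0 = dil 0"
  by (rule ext) (simp add: lp_window_def dil_def aniso_dil_def)

lemma win_pos: "0 < k \<Longrightarrow> win k = (\<lambda>x. dil (real k) x - dil (real k - 1) x)"
  by (rule ext) (simp add: lp_window_def dil_def)

lemma win_schwartz: "win k \<in> schwartz"
  by (cases "k = 0") (simp_all add: win_0 win_pos schwartz_diff test_functions_schwartz dil_test)

lemma win_zero_outside: "2 powr (real k + 1) \<le> aniso_norm a x \<Longrightarrow> win k x = 0"
proof -
  assume x: "2 powr (real k + 1) \<le> aniso_norm a x"
  have "(2::real) powr (real k - 1 + 1) \<le> 2 powr (real k + 1)" by (intro powr_mono) auto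
  with x have "2 powr (real k - 1 + 1) \<le> aniso_norm a x" by linarith
  with x show ?thesis
    by (cases "k = 0") (auto simp: win_0 win_pos dil_zero)
qed

lemma win_zero_inside: "0 < k \<Longrightarrow> aniso_norm a x \<le> 2 powr (real k - 1) \<Longrightarrow> win k x = 0"
proof -
  assume k: "0 < k" and x: "aniso_norm a x \<le> 2 powr (real k - 1)"
  have "(2::real) powr (real k - 1) \<le> 2 powr real k" by (intro powr_mono) auto
  with x have "aniso_norm a x \<le> 2 powr (real k)" by linarith
  with x k show ?thesis by (simp add: win_pos dil_one)
qed

text \<open>For positive \<open>k\<close> the window lives between
  \<open>2 powr (real k - 1)\<close> and \<open>2 powr (real k + 1)\<close>, while
  \<open>dil (real j - 1)\<close> passes from 1 to 0 between \<open>2 powr (real j - 1)\<close> and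
  \<open>2 powr real j\<close>. Hence only \<open>j = k\<close> and \<open>j = k + 1\<close> can
  distort window \<open>k\<close>, the source of the two excluded frequencies.\<close>

lemma dil_win_high: "k + 2 \<le> j \<Longrightarrow> dil (real j - 1) x * win k x = win k x"
proof (cases "2 powr (real k + 1) \<le> aniso_norm a x")
  case False
  assume "k + 2 \<le> j"
  then have "(2::real) powr (real k + 1) \<le> 2 powr (real j - 1)" by (intro powr_mono) auto
  with False have "aniso_norm a x \<le> 2 powr (real j - 1)" by linarith
  then show ?thesis by (simp only: dil_one mult_1_left)
qed (simp add: win_zero_outside)

lemma dil_win_low: "j < k \<Longrightarrow> dil (real j - 1) x * win k x = 0"
proof (cases "aniso_norm a x \<le> 2 powr (real k - 1)")
  case False
  assume "j < k"
  then have "(2::real) powr (real j - 1 + 1) \<le> 2 powr (real k - 1)" by (intro powr_mono) auto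
  with False have "2 powr (real j - 1 + 1) \<le> aniso_norm a x" by linarith
  then show ?thesis by (simp only: dil_zero mult_zero_left)
qed (simp add: win_zero_inside)

lemma represents_dirac_block:
  "represents (inv_fourier (win k)) (dist_inv_fourier (dist_mult (win k) (dist_fourier dirac)))"
proof -
  have "represents (\<lambda>x. 1 * inv_fourier (win k) x) (dist_inv_fourier (dist_mult (win k) (dist_fourier dirac)))"
  proof (rule represents_inv_fourier[OF win_schwartz])
    fix f :: "real ^ 'n \<Rightarrow> complex" assume f: "f \<in> schwartz"
    have "fourier (\<lambda>\<xi>. win k \<xi> * inv_fourier f \<xi>) \<in> schwartz"
      by (intro schwartz_fourier schwartz_mult win_schwartz schwartz_inv_fourier f)
    then show "dist_inv_fourier (dist_mult (win k) (dist_fourier dirac)) f = 1 * (LINT \<xi>|lborel. win k \<xi> * inv_fourier f \<xi>)"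
      by (simp add: block_functional[OF f win_schwartz] dirac_def fourier_def)
  qed
  then show ?thesis by simp
qed

lemma lp_block_AE:
  assumes "represents g (dist_inv_fourier (dist_mult (win k) (dist_fourier u)))"
  shows "lp_block a \<psi> k u \<in> borel_measurable borel" "AE x in lborel. lp_block a \<psi> k u x = g x"
proof -
  have r: "represents (lp_block a \<psi> k u) (dist_inv_fourier (dist_mult (win k) (dist_fourier u)))"
    unfolding lp_block_def dist_fun_def by (rule someI[of "\<lambda>h. represents h _", OF assms])
  then show "lp_block a \<psi> k u \<in> borel_measurable borel" by (simp add: represents_def)
  obtain R where "bump \<psi> R" using ex_bump by blast
  then show "AE x in lborel. lp_block a \<psi> k u x = g x" by (rule bump.represents_unique[OF _ r assms])
qed

section \<open>Lacunary superpositions of approximations to the Dirac distribution\<close>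

lemma inv_fourier_dil:
  "inv_fourier (dil r) x = of_real (2 powr (r * aniso_size a)) * inv_fourier \<psi> (aniso_dil a (2 powr r) x)"
proof -
  let ?d = "\<chi> i. (2 powr r) powr (a $ i)"
  have [measurable]: "dil r \<in> borel_measurable borel"
    by (intro schwartz_measurable test_functions_schwartz dil_test)
  have d1: "dil r (0 + diag ?d \<eta>) = \<psi> \<eta>" for \<eta>
    unfolding aniso_dil_eq_diag[symmetric] dil_def
    by (simp add: aniso_dil_aniso_dil powr_add[symmetric]) (simp add: aniso_dil_def)
  have d2: "x \<bullet> (0 + diag ?d \<eta>) = aniso_dil a (2 powr r) x \<bullet> \<eta>" for \<eta>
    by (simp add: inner_vec_def aniso_dil_def diag_def mult_ac)
  have "(LINT \<xi>|lborel. exp (\<i> * of_real (x \<bullet> \<xi>)) * dil r \<xi>) =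
    of_real (\<Prod>i\<in>UNIV. \<bar>?d $ i\<bar>) * (LINT \<eta>|lborel. exp (\<i> * of_real (x \<bullet> (0 + diag ?d \<eta>))) * dil r (0 + diag ?d \<eta>))"
    by (rule lborel_integral_diag[symmetric, where f = "\<lambda>\<xi>. exp (\<i> * of_real (x \<bullet> \<xi>)) * dil r \<xi>"])
       (simp_all add: inner_commute)
  also have "(\<Prod>i\<in>UNIV. \<bar>?d $ i\<bar>) = 2 powr (r * aniso_size a)" by (simp only: vec_lambda_beta prod_dil)
  finally show ?thesis unfolding d1 d2 by (simp add: inv_fourier_def mult_ac)
qed

lemma integral_powr_inv_fourier_dil:
  assumes p: "0 < p"
  shows "(\<integral>\<^sup>+x. ennreal (norm (inv_fourier (dil r) x) powr p) \<partial>lborel)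
    = ennreal (2 powr (r * aniso_size a * (p - 1)) * (LINT x|lborel. norm (inv_fourier \<psi> x) powr p))"
proof -
  let ?g = "inv_fourier \<psi>"
  have gS: "?g \<in> schwartz" by (intro schwartz_inv_fourier test_functions_schwartz \<psi>_test)
  note [measurable] = schwartz_measurable[OF gS]
  let ?d = "\<chi> i. (2 powr r) powr (a $ i)"
  let ?s = "2 powr (r * aniso_size a)"
  have e: "ennreal ?s * (\<integral>\<^sup>+x. ennreal (norm (?g (aniso_dil a (2 powr r) x)) powr p) \<partial>lborel) = (\<integral>\<^sup>+x. ennreal (norm (?g x) powr p) \<partial>lborel)"
    using nn_integral_diag[of ?d "\<lambda>x. ennreal (norm (?g x) powr p)" 0]
    by (simp only: vec_lambda_beta prod_dil aniso_dil_eq_diag) simp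
  have fin: "(\<integral>\<^sup>+x. ennreal (norm (?g x) powr p) \<partial>lborel) = ennreal (LINT x|lborel. norm (?g x) powr p)"
    by (intro nn_integral_eq_integral Lp_integrable_schwartz gS p) auto
  let ?I = "LINT x|lborel. norm (?g x) powr p"
  have I0: "0 \<le> ?I" by (rule Bochner_Integration.integral_nonneg) simp
  have m: "(\<lambda>x. ennreal (norm (?g (aniso_dil a (2 powr r) x)) powr p)) \<in> borel_measurable lborel"
    unfolding aniso_dil_eq_diag by measurable
  have "(\<integral>\<^sup>+x. ennreal (norm (inv_fourier (dil r) x) powr p) \<partial>lborel)
    = (\<integral>\<^sup>+x. ennreal (?s powr p) * ennreal (norm (?g (aniso_dil a (2 powr r) x)) powr p) \<partial>lborel)"
    unfolding inv_fourier_dil by (simp add: norm_mult powr_mult ennreal_mult)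
  also have "\<dots> = ennreal (?s powr p) * (\<integral>\<^sup>+x. ennreal (norm (?g (aniso_dil a (2 powr r) x)) powr p) \<partial>lborel)"
    by (rule nn_integral_cmult[OF m])
  also have "ennreal (?s powr p) = ennreal (?s powr (p - 1)) * ennreal ?s"
    by (simp add: ennreal_mult[symmetric] powr_powr powr_add[symmetric] algebra_simps)
  also have "\<dots> * (\<integral>\<^sup>+x. ennreal (norm (?g (aniso_dil a (2 powr r) x)) powr p) \<partial>lborel) = ennreal (?s powr (p - 1)) * ennreal ?I"
    by (simp only: mult.assoc e fin)
  also have "\<dots> = ennreal (2 powr (r * aniso_size a * (p - 1)) * ?I)"
    using I0 by (simp add: ennreal_mult powr_powr)
  finally show ?thesis .
qed

context
  fixes c :: "nat \<Rightarrow> real"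
  assumes c0: "\<And>j. 0 \<le> c j" and sc: "summable c"
begin

text \<open>The shift by one puts the spectrum into \<open>aniso_norm a \<xi> \<le> 2 ^ j\<close>,
  since \<open>dil r\<close> is only known to vanish from \<open>2 powr (r + 1)\<close> on.\<close>

definition approx :: "nat \<Rightarrow> real ^ 'n \<Rightarrow> complex"
  where "approx j = inv_fourier (dil (real j - 1))"

definition layer :: "nat \<Rightarrow> 'n functional"
  where "layer j = (\<lambda>f\<in>schwartz. of_real (c j) * (LINT x|lborel. approx j x * f x))"

text \<open>Sparseness is not imposed here: \<open>c\<close> is a nonnegative summable sequence, and
  its sparse support is chosen in \<open>solid_counterexample\<close>. Indexing by all frequencies
  makes \<open>layer\<close> the sequence that \<open>A_representation\<close> asks for.\<close>

definition lacunary :: "'n functional"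
  where "lacunary = (\<lambda>f\<in>schwartz. \<Sum>j. layer j f)"

lemma approx_schwartz: "approx j \<in> schwartz"
  unfolding approx_def by (intro schwartz_inv_fourier test_functions_schwartz dil_test)

text \<open>At power 1 the scaling exponent vanishes: the dilates are L1 normalised, so summability
  of \<open>c\<close> makes the superposition converge.\<close>

lemma approx_L1: "(LINT x|lborel. norm (approx j x)) = (LINT x|lborel. norm (inv_fourier \<psi> x))"
proof -
  have "ennreal (LINT x|lborel. norm (approx j x)) = (\<integral>\<^sup>+x. ennreal (norm (approx j x)) \<partial>lborel)"
    by (intro nn_integral_eq_integral[symmetric] integrable_norm schwartz_integrable approx_schwartz) auto
  also have "\<dots> = ennreal (LINT x|lborel. norm (inv_fourier \<psi> x))"
    using integral_powr_inv_fourier_dil[of 1 "real j - 1"] by (simp add: approx_def)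
  finally show ?thesis by (simp add: Bochner_Integration.integral_nonneg)
qed

lemma approx_mult_integrable: "f \<in> schwartz \<Longrightarrow> integrable lborel (\<lambda>x. approx j x * f x)"
  by (intro schwartz_integrable schwartz_mult approx_schwartz)

lemma layer_bound:
  assumes f: "f \<in> schwartz"
  shows "norm (layer j f) \<le> c j * ((LINT x|lborel. norm (inv_fourier \<psi> x)) * schwartz_seminorm 0 f)"
proof -
  have "norm (LINT x|lborel. approx j x * f x) \<le> (LINT x|lborel. norm (approx j x) * schwartz_seminorm 0 f)"
  proof (rule norm_integral_le)
    show "integrable lborel (\<lambda>x. norm (approx j x) * schwartz_seminorm 0 f)"
      by (intro integrable_mult_left integrable_norm schwartz_integrable approx_schwartz)
    show "(\<lambda>x. approx j x * f x) \<in> borel_measurable borel"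
      by (intro schwartz_measurable schwartz_mult approx_schwartz f)
    show "norm (approx j x * f x) \<le> norm (approx j x) * schwartz_seminorm 0 f" for x
      unfolding norm_mult by (intro mult_left_mono seminorm_bound_sup f) auto
  qed
  also have "\<dots> = (LINT x|lborel. norm (inv_fourier \<psi> x)) * schwartz_seminorm 0 f"
    by (simp add: approx_L1)
  finally have "c j * norm (LINT x|lborel. approx j x * f x) \<le> c j * ((LINT x|lborel. norm (inv_fourier \<psi> x)) * schwartz_seminorm 0 f)"
    by (rule mult_left_mono[OF _ c0])
  then show ?thesis using f c0[of j] by (simp add: layer_def norm_mult)
qed

lemma layer_add: "f \<in> schwartz \<Longrightarrow> g \<in> schwartz \<Longrightarrow> layer j (\<lambda>x. f x + g x) = layer j f + layer j g"
  using Bochner_Integration.integral_add[OF approx_mult_integrable[of f j] approx_mult_integrable[of g j]]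
  by (simp add: layer_def schwartz_add distrib_left)

lemma layer_cmult: "f \<in> schwartz \<Longrightarrow> layer j (\<lambda>x. b * f x) = b * layer j f"
  by (simp add: layer_def schwartz_cmult mult.left_commute[of _ b])

lemma summable_layer: "f \<in> schwartz \<Longrightarrow> summable (\<lambda>j. norm (layer j f))"
proof (rule summable_comparison_test'[of _ 0])
  show "summable (\<lambda>j. c j * ((LINT x|lborel. norm (inv_fourier \<psi> x)) * schwartz_seminorm 0 f))"
    by (intro summable_mult2 sc)
qed (use layer_bound in auto)

lemma layer_tempered: "layer j \<in> tempered"
proof -
  have "\<forall>f\<in>schwartz. norm (layer j f) \<le> (c j * (LINT x|lborel. norm (inv_fourier \<psi> x))) * schwartz_seminorm 0 f"
    using layer_bound by (simp add: mult.assoc)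
  then have "\<exists>C N. \<forall>f\<in>schwartz. norm (layer j f) \<le> C * schwartz_seminorm N f" by blast
  moreover have "layer j \<in> extensional schwartz" by (simp add: layer_def)
  ultimately show ?thesis by (simp add: tempered_def layer_add layer_cmult)
qed

lemma lacunary_tempered: "lacunary \<in> tempered"
proof -
  let ?D = "LINT x|lborel. norm (inv_fourier \<psi> x)"
  have "\<forall>f\<in>schwartz. norm (lacunary f) \<le> ((\<Sum>j. c j) * ?D) * schwartz_seminorm 0 f"
  proof
    fix f :: "real ^ 'n \<Rightarrow> complex" assume f: "f \<in> schwartz"
    have "norm (lacunary f) \<le> (\<Sum>j. norm (layer j f))"
      using f summable_norm[OF summable_layer[OF f]] by (simp add: lacunary_def)
    also have "\<dots> \<le> (\<Sum>j. c j * (?D * schwartz_seminorm 0 f))"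
      by (intro suminf_le summable_layer f layer_bound summable_mult2 sc)
    also have "\<dots> = (\<Sum>j. c j) * (?D * schwartz_seminorm 0 f)" by (rule suminf_mult2[symmetric, OF sc])
    finally show "norm (lacunary f) \<le> ((\<Sum>j. c j) * ?D) * schwartz_seminorm 0 f" by (simp add: mult.assoc)
  qed
  then have "\<exists>C N. \<forall>f\<in>schwartz. norm (lacunary f) \<le> C * schwartz_seminorm N f" by blast
  moreover have "lacunary \<in> extensional schwartz" by (simp add: lacunary_def)
  moreover have "lacunary (\<lambda>x. f x + g x) = lacunary f + lacunary g" if "f \<in> schwartz" "g \<in> schwartz" for f g
    using that suminf_add[OF summable_norm_cancel[OF summable_layer] summable_norm_cancel[OF summable_layer], of f g]
    by (simp add: lacunary_def schwartz_add layer_add)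
  moreover have "lacunary (\<lambda>x. b * f x) = b * lacunary f" if "f \<in> schwartz" for f b
    using that suminf_mult[OF summable_norm_cancel[OF summable_layer], of f b]
    by (simp add: lacunary_def schwartz_cmult layer_cmult)
  ultimately show ?thesis by (simp add: tempered_def)
qed

lemma layer_fourier:
  assumes g: "g \<in> schwartz"
  shows "layer j (fourier g) = of_real (c j) * (LINT \<xi>|lborel. dil (real j - 1) \<xi> * g \<xi>)"
proof -
  have "(LINT x|lborel. approx j x * fourier g x) = (LINT \<xi>|lborel. dil (real j - 1) \<xi> * inv_fourier (fourier g) \<xi>)"
    unfolding approx_def
    by (intro inv_fourier_integral_exchange schwartz_integrable schwartz_fourier schwartz_measurable test_functions_schwartz dil_test g)
  then show ?thesis using g by (simp add: layer_def schwartz_fourier inv_fourier_fourier)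
qed

lemma lacunary_A_representation:
  assumes p: "0 < p"
  shows "A_representation a (ennreal p) lacunary layer (\<lambda>j x. of_real (c j) * approx j x)"
    and "Lp_qnorm (ennreal p) (\<lambda>x. ennreal (norm (of_real (c j) * approx j x)))
      = ennreal (c j * (2 powr ((real j - 1) * aniso_size a * (1 - 1 / p)) * (LINT x|lborel. norm (inv_fourier \<psi> x) powr p) powr (1 / p)))"
proof -
  let ?I = "LINT x|lborel. norm (inv_fourier \<psi> x) powr p"
  have I0: "0 \<le> ?I" by (rule Bochner_Integration.integral_nonneg) simp
  show Lp: "Lp_qnorm (ennreal p) (\<lambda>x. ennreal (norm (of_real (c j) * approx j x)))
    = ennreal (c j * (2 powr ((real j - 1) * aniso_size a * (1 - 1 / p)) * ?I powr (1 / p)))" for j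
  proof -
    have [measurable]: "approx j \<in> borel_measurable borel" by (rule schwartz_measurable[OF approx_schwartz])
    have "(\<integral>\<^sup>+x. ennreal (norm (of_real (c j) * approx j x) powr p) \<partial>lborel)
      = (\<integral>\<^sup>+x. ennreal (c j powr p) * ennreal (norm (approx j x) powr p) \<partial>lborel)"
      using c0[of j] by (simp add: norm_mult powr_mult ennreal_mult)
    also have "\<dots> = ennreal (c j powr p) * (\<integral>\<^sup>+x. ennreal (norm (approx j x) powr p) \<partial>lborel)"
      by (rule nn_integral_cmult) measurable
    also have "\<dots> = ennreal (c j powr p * (2 powr ((real j - 1) * aniso_size a * (p - 1)) * ?I))"
      unfolding approx_def integral_powr_inv_fourier_dil[OF p] using I0 by (simp add: ennreal_mult)
    finally have "Lp_qnorm (ennreal p) (\<lambda>x. ennreal (norm (of_real (c j) * approx j x)))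
      = ennreal ((c j powr p * (2 powr ((real j - 1) * aniso_size a * (p - 1)) * ?I)) powr (1 / p))"
      using p I0 c0[of j] by (simp add: Lp_qnorm_def)
    also have "(c j powr p * (2 powr ((real j - 1) * aniso_size a * (p - 1)) * ?I)) powr (1 / p)
      = c j * (2 powr ((real j - 1) * aniso_size a * (1 - 1 / p)) * ?I powr (1 / p))"
    proof -
      have "t * (p - 1) / p = t * (1 - 1 / p)" for t using p by (simp add: field_simps)
      then show ?thesis using p I0 c0[of j] by (simp add: powr_mult powr_powr)
    qed
    finally show ?thesis .
  qed
  show "A_representation a (ennreal p) lacunary layer (\<lambda>j x. of_real (c j) * approx j x)"
    unfolding A_representation_def
  proof (intro conjI allI)
    fix j
    show "layer j \<in> tempered" by (rule layer_tempered)
    show "represents (\<lambda>x. of_real (c j) * approx j x) (layer j)"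
      unfolding approx_def
    proof (rule represents_inv_fourier)
      show dS: "dil (real j - 1) \<in> schwartz" by (intro test_functions_schwartz dil_test)
      fix f :: "real ^ 'n \<Rightarrow> complex" assume f: "f \<in> schwartz"
      have "(LINT x|lborel. approx j x * f x) = (LINT \<xi>|lborel. dil (real j - 1) \<xi> * inv_fourier f \<xi>)"
        unfolding approx_def by (intro inv_fourier_integral_exchange schwartz_integrable dS f schwartz_measurable schwartz_fourier)
      then show "layer j f = of_real (c j) * (LINT \<xi>|lborel. dil (real j - 1) \<xi> * inv_fourier f \<xi>)"
        using f by (simp add: layer_def)
    qed
    show "Lp_qnorm (ennreal p) (\<lambda>x. ennreal (norm (of_real (c j) * approx j x))) < \<infinity>"
      unfolding Lp by simp
    show "dist_supp (dist_fourier (layer j)) \<subseteq> {\<xi>. aniso_norm a \<xi> \<le> 2 ^ j}"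
    proof (rule ccontr)
      assume "\<not> ?thesis"
      then obtain \<xi> where \<xi>: "\<xi> \<in> dist_supp (dist_fourier (layer j))" "2 ^ j < aniso_norm a \<xi>" by force
      have "open {\<xi>. 2 ^ j < aniso_norm a \<xi>}" by (rule open_aniso_norm_gt[OF an]) simp
      with \<xi> obtain f where f: "f \<in> test_functions" "fun_supp f \<subseteq> {\<xi>. 2 ^ j < aniso_norm a \<xi>}" "dist_fourier (layer j) f \<noteq> 0"
        unfolding dist_supp_def by blast
      have fS: "f \<in> schwartz" using f(1) by (rule test_functions_schwartz)
      have z: "dil (real j - 1) x * f x = 0" for x
      proof (cases "f x = 0")
        case False
        then have "x \<in> fun_supp f" using closure_subset by (force simp: fun_supp_def)
        then have "2 ^ j < aniso_norm a x" using f(2) by blast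
        then have "dil (real j - 1) x = 0" by (intro dil_zero) (simp add: powr_realpow)
        then show ?thesis by simp
      qed simp
      have "dist_fourier (layer j) f = layer j (fourier f)" using fS by (simp add: dist_fourier_def)
      also have "\<dots> = 0" unfolding layer_fourier[OF fS] z by simp
      finally have "dist_fourier (layer j) f = 0" .
      with f(3) show False by simp
    qed
  next
    show "dist_sums layer lacunary"
      unfolding dist_sums_def
      using summable_sums[OF summable_norm_cancel[OF summable_layer]] by (simp add: lacunary_def)
  qed
qed

lemma lacunary_in_A_space:
  assumes p: "0 < p" and q: "0 < q" and scq: "summable (\<lambda>j. c j powr q)"
  shows "lacunary \<in> A_space a (aniso_size a * (1 / p - 1)) (ennreal p) (ennreal q)"
proof -
  let ?s = "aniso_size a * (1 / p - 1)"
  define K where "K = 2 powr ?s * (LINT x|lborel. norm (inv_fourier \<psi> x) powr p) powr (1 / p)"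
  have K0: "0 \<le> K" by (simp add: K_def)
  have t: "ennreal (2 powr (real j * ?s)) * Lp_qnorm (ennreal p) (\<lambda>x. ennreal (norm (of_real (c j) * approx j x))) = ennreal (c j * K)" for j
  proof -
    \<comment> \<open>Here the smoothness is critical: the weight exactly compensates the scaling of
      the quasi-norm, and the remaining constant \<open>2 powr ?s\<close> stems from the index shift
      by one.\<close>
    have "2 powr (real j * ?s) * 2 powr ((real j - 1) * aniso_size a * (1 - 1 / p)) = 2 powr ?s"
      unfolding powr_add[symmetric] by (rule arg_cong[where f = "\<lambda>x. 2 powr x"]) (simp add: algebra_simps)
    then have eq: "2 powr (real j * ?s) * (c j * (2 powr ((real j - 1) * aniso_size a * (1 - 1 / p)) * (LINT x|lborel. norm (inv_fourier \<psi> x) powr p) powr (1 / p))) = c j * K"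
      by (simp add: K_def mult_ac) 
    show ?thesis
      unfolding lacunary_A_representation(2)[OF p] eq[symmetric]
      by (rule ennreal_mult[symmetric]) (use c0[of j] in auto)
  qed
  have "A_cost ?s (ennreal p) (ennreal q) (\<lambda>j x. of_real (c j) * approx j x) = epowr (\<Sum>j. ennreal ((c j * K) powr q)) (1 / q)"
    unfolding A_cost_def t lq_qnorm_def using q K0 c0 by simp
  moreover have "summable (\<lambda>j. (c j * K) powr q)"
    using c0 K0 by (simp add: powr_mult summable_mult2[OF scq])
  then have "(\<Sum>j. ennreal ((c j * K) powr q)) = ennreal (\<Sum>j. (c j * K) powr q)"
    by (intro suminf_ennreal2) auto
  ultimately have "A_cost ?s (ennreal p) (ennreal q) (\<lambda>j x. of_real (c j) * approx j x) < \<infinity>"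
    by (simp add: epowr_def)
  then show ?thesis
    using lacunary_tempered lacunary_A_representation(1)[OF p] by (auto simp: A_space_def)
qed

text \<open>On window \<open>k\<close> the layers below \<open>k\<close> vanish, the two distorted
  layers carry coefficient 0, and every later layer acts as a multiple of the Dirac distribution.
  The block is therefore the Dirac block times the sum \<open>C\<close> of the later coefficients,
  and \<open>C\<close> is at least the single coefficient \<open>c j\<close>.\<close>

lemma lacunary_block:
  assumes gap: "c k = 0" "c (Suc k) = 0" and j: "k + 2 \<le> j"
  shows "lp_block a \<psi> k lacunary \<in> borel_measurable borel"
    and "AE x in lborel. c j * norm (lp_block a \<psi> k dirac x) \<le> norm (lp_block a \<psi> k lacunary x)"
proof -
  define b where "b i = (if k + 2 \<le> i then c i else 0)" for i
  have b0: "0 \<le> b i" for i using c0 by (simp add: b_def)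
  have sb: "summable b"
    by (rule summable_comparison_test'[OF sc, of 0]) (use c0 in \<open>simp add: b_def\<close>)
  define C where "C = (\<Sum>i. b i)"
  have "b j \<le> C"
    unfolding C_def using sum_le_suminf[OF sb, of "{j}"] b0 by simp
  then have Cj: "c j \<le> C" using j by (simp add: b_def)
  have rep: "represents (\<lambda>x. of_real C * inv_fourier (win k) x) (dist_inv_fourier (dist_mult (win k) (dist_fourier lacunary)))"
  proof (rule represents_inv_fourier[OF win_schwartz])
    fix f :: "real ^ 'n \<Rightarrow> complex" assume f: "f \<in> schwartz"
    let ?g = "\<lambda>\<xi>. win k \<xi> * inv_fourier f \<xi>"
    have g: "?g \<in> schwartz" by (intro schwartz_mult win_schwartz schwartz_inv_fourier f)
    have "layer i (fourier ?g) = of_real (b i) * (LINT \<xi>|lborel. ?g \<xi>)" for i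
    proof -
      consider "i < k" | "i = k \<or> i = Suc k" | "k + 2 \<le> i" by linarith
      then show ?thesis
      proof cases
        case 1
        have z: "dil (real i - 1) \<xi> * ?g \<xi> = 0" for \<xi>
          using dil_win_low[OF 1, of \<xi>] by (simp only: mult.assoc[symmetric] mult_zero_left)
        show ?thesis unfolding layer_fourier[OF g] z using 1 by (simp add: b_def)
      next
        case 2
        then show ?thesis using gap by (auto simp: layer_fourier[OF g] b_def)
      next
        case 3
        have z: "dil (real i - 1) \<xi> * ?g \<xi> = ?g \<xi>" for \<xi>
          using dil_win_high[OF 3, of \<xi>] by (simp only: mult.assoc[symmetric])
        show ?thesis unfolding layer_fourier[OF g] z using 3 by (simp add: b_def)
      qed
    qed
    then have "lacunary (fourier ?g) = (\<Sum>i. of_real (b i) * (LINT \<xi>|lborel. ?g \<xi>))"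
      using schwartz_fourier[OF g] by (simp add: lacunary_def)
    also have "\<dots> = of_real C * (LINT \<xi>|lborel. ?g \<xi>)"
      unfolding C_def suminf_of_real[OF sb] by (rule suminf_mult2[symmetric]) (rule summable_of_real[OF sb])
    finally show "dist_inv_fourier (dist_mult (win k) (dist_fourier lacunary)) f = of_real C * (LINT \<xi>|lborel. ?g \<xi>)"
      by (simp add: block_functional[OF f win_schwartz])
  qed
  show "lp_block a \<psi> k lacunary \<in> borel_measurable borel" by (rule lp_block_AE(1)[OF rep])
  show "AE x in lborel. c j * norm (lp_block a \<psi> k dirac x) \<le> norm (lp_block a \<psi> k lacunary x)"
    using lp_block_AE(2)[OF rep] lp_block_AE(2)[OF represents_dirac_block[of k]]
  proof eventually_elim
    fix x assume "lp_block a \<psi> k lacunary x = of_real C * inv_fourier (win k) x" "lp_block a \<psi> k dirac x = inv_fourier (win k) x"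
    then show "c j * norm (lp_block a \<psi> k dirac x) \<le> norm (lp_block a \<psi> k lacunary x)"
      using Cj c0[of j] by (simp add: norm_mult mult_right_mono)
  qed
qed

end

end

section \<open>Solidity of the Besov and Lizorkin--Triebel quasi-norms\<close>

lemma epowr_top [simp]: "epowr \<top> r = \<top>"
  by (simp add: epowr_def)

lemma epowr_zero [simp]: "epowr 0 r = 0"
  by (simp add: epowr_def)

lemma epowr_mono: "0 < r \<Longrightarrow> x \<le> y \<Longrightarrow> epowr x r \<le> epowr y r"
  by (cases x; cases y) (auto simp: powr_mono2 top_unique)

lemma epowr_mult: "0 < c \<Longrightarrow> epowr (ennreal c * x) r = ennreal (c powr r) * epowr x r"
  by (cases x) (auto simp: ennreal_mult[symmetric] powr_mult ennreal_mult_top)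

lemma epowr_epowr: "0 < r \<Longrightarrow> epowr (epowr x r) (1 / r) = x" "0 < r \<Longrightarrow> epowr (epowr x (1 / r)) r = x"
  by (cases x; auto simp: powr_powr)+

lemma epowr_lt_top_iff: "epowr x r < \<infinity> \<longleftrightarrow> x < \<infinity>"
  by (cases x) auto

lemma measurable_epowr [measurable]:
  assumes "f \<in> borel_measurable M" shows "(\<lambda>x. epowr (f x) r) \<in> borel_measurable M"
proof (rule measurable_compose[OF assms])
  have "(\<lambda>x::ennreal. ennreal (enn2real x powr r)) \<in> borel_measurable borel"
    by measurable
  moreover have "{x \<in> space (borel :: ennreal measure). x = \<infinity>} \<in> sets borel" by simp
  ultimately show "(\<lambda>x. epowr x r) \<in> borel_measurable borel"
    unfolding epowr_def by (intro measurable_If borel_measurable_const)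
qed

lemma epowr_add_le:
  assumes "0 < r" shows "epowr (x + y) r \<le> ennreal (2 powr r) * (epowr x r + epowr y r)"
proof -
  have "x + y \<le> max x y + max x y" by (intro add_mono) auto
  also have "\<dots> = ennreal 2 * max x y" by (simp add: mult_2)
  finally have "epowr (x + y) r \<le> epowr (ennreal 2 * max x y) r" by (rule epowr_mono[OF assms])
  also have "\<dots> = ennreal (2 powr r) * epowr (max x y) r" by (rule epowr_mult) simp
  also have "epowr (max x y) r \<le> epowr x r + epowr y r"
    by (auto simp: max_def)
  finally show ?thesis by (simp add: mult_left_mono)
qed

text \<open>For \<open>r > 0\<close> this power is an order isomorphism of the extended half-line,
  with the power \<open>1 / r\<close> as inverse.\<close>

lemma epowr_SUP:
  assumes "0 < r" shows "epowr (SUP L. Y L) r = (SUP L. epowr (Y L) r)"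
proof (rule antisym)
  have "Y L \<le> epowr (SUP L. epowr (Y L) r) (1 / r)" for L
  proof -
    have "epowr (epowr (Y L) r) (1 / r) \<le> epowr (SUP L. epowr (Y L) r) (1 / r)"
      by (intro epowr_mono SUP_upper) (use assms in auto)
    then show ?thesis by (simp only: epowr_epowr(1)[OF assms])
  qed
  then have "(SUP L. Y L) \<le> epowr (SUP L. epowr (Y L) r) (1 / r)" by (rule SUP_least)
  from epowr_mono[OF assms this] show "epowr (SUP L. Y L) r \<le> (SUP L. epowr (Y L) r)"
    by (simp add: epowr_epowr assms)
qed (auto intro!: SUP_least epowr_mono assms SUP_upper)

lemma ennreal_exponent_cases:
  assumes "0 < (q :: ennreal)"
  obtains "q = \<top>" | r where "0 < r" "q = ennreal r"
  using assms by (cases q) auto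

definition on :: "nat set \<Rightarrow> (nat \<Rightarrow> ennreal) \<Rightarrow> nat \<Rightarrow> ennreal"
  where "on S d k = (if k \<in> S then d k else 0)"

lemma lq_qnorm_ennreal: "0 < r \<Longrightarrow> lq_qnorm (ennreal r) d = epowr (\<Sum>k. epowr (d k) r) (1 / r)"
  by (simp add: lq_qnorm_def)

lemma lq_qnorm_top: "lq_qnorm \<top> d = (SUP k. d k)"
  by (simp add: lq_qnorm_def)

lemma lq_mono:
  assumes q: "0 < q" and le: "\<And>k. d k \<le> e k"
  shows "lq_qnorm q d \<le> lq_qnorm q e"
  using q
proof (cases rule: ennreal_exponent_cases)
  case 1
  then show ?thesis using le by (auto simp: lq_qnorm_top intro: SUP_mono)
next
  case (2 r)
  then show ?thesis
    using le by (auto simp: lq_qnorm_ennreal intro!: epowr_mono suminf_le)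
qed

lemma lq_cmult:
  assumes q: "0 < q" and c: "0 < c"
  shows "lq_qnorm q (\<lambda>k. ennreal c * d k) = ennreal c * lq_qnorm q d"
  using q
proof (cases rule: ennreal_exponent_cases)
  case 1
  then show ?thesis by (simp add: lq_qnorm_top SUP_mult_left_ennreal)
next
  case (2 r)
  have "lq_qnorm q (\<lambda>k. ennreal c * d k) = epowr (ennreal (c powr r) * (\<Sum>k. epowr (d k) r)) (1 / r)"
    by (simp add: 2 lq_qnorm_ennreal epowr_mult c ennreal_suminf_cmult)
  also have "\<dots> = ennreal c * lq_qnorm q d"
    using c 2 by (simp add: epowr_mult lq_qnorm_ennreal powr_powr)
  finally show ?thesis .
qed

lemma measurable_lq [measurable]:
  assumes q: "0 < q" and [measurable]: "\<And>k. D k \<in> borel_measurable M"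
  shows "(\<lambda>x. lq_qnorm q (\<lambda>k. D k x)) \<in> borel_measurable M"
  using q
proof (cases rule: ennreal_exponent_cases)
  case 1
  then show ?thesis unfolding 1 lq_qnorm_top by measurable
next
  case (2 r)
  then show ?thesis unfolding 2(2) lq_qnorm_ennreal[OF 2(1)] by measurable
qed

text \<open>Isolates a finite head, so that an infinite quasi-norm can be attributed to the tail.
  The tail is a supremum over finite windows \<open>{K..<L}\<close>, the form from which
  \<open>gap_selection\<close> picks its gaps.\<close>

lemma lq_split:
  assumes q: "0 < q"
  shows "\<exists>\<kappa>>0. \<forall>d. lq_qnorm q d \<le> ennreal \<kappa> * ((\<Sum>k<K. d k) + (SUP L. lq_qnorm q (on {K..<L} d)))"
  using q
proof (cases rule: ennreal_exponent_cases)
  case 1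
  have "lq_qnorm q d \<le> ennreal 1 * ((\<Sum>k<K. d k) + (SUP L. lq_qnorm q (on {K..<L} d)))" for d
    unfolding 1 lq_qnorm_top
  proof (rule SUP_least)
    fix k
    show "d k \<le> ennreal 1 * ((\<Sum>k<K. d k) + (SUP L. SUP k. on {K..<L} d k))"
    proof (cases "k < K")
      case True
      then have "d k \<le> (\<Sum>k<K. d k)" by (intro member_le_sum) auto
      then show ?thesis by (simp add: add_increasing2)
    next
      case False
      then have "d k = on {K..<Suc k} d k" by (simp add: on_def)
      also have "\<dots> \<le> (SUP L. SUP k. on {K..<L} d k)"
        by (rule SUP_upper2[of "Suc k"], simp, rule SUP_upper, simp)
      finally show ?thesis by (simp add: add_increasing)
    qed
  qed
  then show ?thesis by (intro exI[of _ 1]) auto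
next
  case (2 r)
  \<comment> \<open>The \<open>K\<close> head terms and the tail are each bounded by the power of
    the whole sum \<open>?X + ?Y\<close>, which gives \<open>K + 1\<close> equal summands before the
    root is taken.\<close>
  define \<kappa> where "\<kappa> = (real K + 1) powr (1 / r)"
  have "lq_qnorm q d \<le> ennreal \<kappa> * ((\<Sum>k<K. d k) + (SUP L. lq_qnorm q (on {K..<L} d)))" for d
  proof -
    let ?X = "\<Sum>k<K. d k" and ?Y = "SUP L. lq_qnorm q (on {K..<L} d)"
    have "(\<Sum>k<L. epowr (d k) r) \<le> ennreal (real K + 1) * epowr (?X + ?Y) r" for L
    proof -
      have "(\<Sum>k<L. epowr (d k) r) \<le> (\<Sum>k\<in>{..<K} \<union> {K..<L}. epowr (d k) r)"
        by (intro sum_mono2) auto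
      also have "\<dots> = (\<Sum>k<K. epowr (d k) r) + (\<Sum>k\<in>{K..<L}. epowr (d k) r)"
        by (intro sum.union_disjoint) auto
      also have "(\<Sum>k<K. epowr (d k) r) \<le> (\<Sum>k<K. epowr (?X + ?Y) r)"
      proof (intro sum_mono epowr_mono 2)
        fix k assume "k \<in> {..<K}"
        then have "d k \<le> ?X" by (intro member_le_sum) auto
        then show "d k \<le> ?X + ?Y" by (simp add: add_increasing2)
      qed
      also have "(\<Sum>k\<in>{K..<L}. epowr (d k) r) = (\<Sum>k. epowr (on {K..<L} d k) r)"
        by (subst suminf_finite[of "{K..<L}"]) (auto simp: on_def)
      also have "\<dots> = epowr (lq_qnorm q (on {K..<L} d)) r"
        using 2 by (simp add: lq_qnorm_ennreal epowr_epowr)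
      also have "\<dots> \<le> epowr (?X + ?Y) r"
        by (intro epowr_mono 2 add_increasing SUP_upper) auto
      also have "(\<Sum>k<K. epowr (?X + ?Y) r) + epowr (?X + ?Y) r = ennreal (real K + 1) * epowr (?X + ?Y) r"
        by (simp add: distrib_right ennreal_plus ennreal_of_nat_eq_real_of_nat)
      finally show ?thesis by (simp add: add_mono)
    qed
    then have "(\<Sum>k. epowr (d k) r) \<le> ennreal (real K + 1) * epowr (?X + ?Y) r"
      unfolding suminf_eq_SUP by (rule SUP_least)
    then have "lq_qnorm q d \<le> epowr (ennreal (real K + 1) * epowr (?X + ?Y) r) (1 / r)"
      using 2 by (simp add: lq_qnorm_ennreal epowr_mono)
    also have "\<dots> = ennreal \<kappa> * (?X + ?Y)"
      using 2 by (subst epowr_mult) (auto simp: \<kappa>_def epowr_epowr)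
    finally show ?thesis .
  qed
  moreover have "\<kappa> > 0" by (simp add: \<kappa>_def)
  ultimately show ?thesis by blast
qed

lemma Lp_qnorm_ennreal: "0 < r \<Longrightarrow> Lp_qnorm (ennreal r) g = epowr (\<integral>\<^sup>+x. epowr (g x) r \<partial>lborel) (1 / r)"
  by (simp add: Lp_qnorm_def)

lemma Lp_mono_cmult:
  fixes f g :: "real ^ 'n \<Rightarrow> ennreal"
  assumes p: "0 < p" and c: "0 < c" and [measurable]: "f \<in> borel_measurable borel"
    and le: "AE x in lborel. ennreal c * f x \<le> g x"
  shows "ennreal c * Lp_qnorm p f \<le> Lp_qnorm p g"
  using p
proof (cases rule: ennreal_exponent_cases)
  case 1
  have cc: "ennreal c * (ennreal (1 / c) * x) = x" "ennreal (1 / c) * (ennreal c * x) = x" for x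
    using c by (simp_all add: mult.assoc[symmetric] ennreal_mult[symmetric])
  have "esssup lborel f \<le> ennreal (1 / c) * esssup lborel g"
  proof (rule esssup_I)
    show "AE x in lborel. f x \<le> ennreal (1 / c) * esssup lborel g"
      using le esssup_AE[where M = lborel and f = g]
    proof eventually_elim
      fix x assume "ennreal c * f x \<le> g x" "g x \<le> esssup lborel g"
      then have "ennreal c * f x \<le> esssup lborel g" by (rule order_trans)
      from mult_left_mono[OF this, of "ennreal (1 / c)"] show "f x \<le> ennreal (1 / c) * esssup lborel g"
        by (simp add: cc)
    qed
  qed simp
  from mult_left_mono[OF this, of "ennreal c"] show ?thesis
    by (simp add: 1 Lp_qnorm_def cc)
next
  case (2 r)
  have "ennreal c * Lp_qnorm p f = epowr (\<integral>\<^sup>+x. epowr (ennreal c * f x) r \<partial>lborel) (1 / r)"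
    using c 2 by (simp add: Lp_qnorm_ennreal epowr_mult nn_integral_cmult powr_powr)
  also have "\<dots> \<le> Lp_qnorm p g"
    unfolding 2(2) Lp_qnorm_ennreal[OF 2(1)] using le 2
    by (intro epowr_mono nn_integral_mono_AE) (auto elim!: eventually_mono intro: epowr_mono)
  finally show ?thesis .
qed

section \<open>The Dirac distribution against lacunary superpositions\<close>

text \<open>The sets \<open>{j m + 1..<L m}\<close> are the gaps between consecutive frequencies \<open>j m\<close>; the two
  frequencies on which a block would be distorted are excluded by \<open>L m < j (m + 1)\<close>.\<close>

lemma gap_selection:
  fixes N :: "nat \<Rightarrow> nat \<Rightarrow> ennreal"
  assumes "\<And>K. (SUP L. N K L) = \<infinity>"
  obtains j L :: "nat \<Rightarrow> nat" where "strict_mono j" "\<And>m. L m < j (Suc m)"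
    "\<And>m. ennreal (4 ^ Suc m) \<le> N (Suc (j m)) (L m)"
proof -
  have ex: "\<exists>L. ennreal (4 ^ Suc m) \<le> N K L" for K m
  proof -
    have "ennreal (4 ^ Suc m) < (SUP L. N K L)" by (simp add: assms)
    then show ?thesis by (auto simp: less_SUP_iff intro: less_imp_le)
  qed
  define l where "l K m = (SOME L. ennreal (4 ^ Suc m) \<le> N K L)" for K m
  have l: "ennreal (4 ^ Suc m) \<le> N K (l K m)" for K m
    unfolding l_def by (rule someI_ex[OF ex])
  \<comment> \<open>The search for the next gap starts at \<open>Suc J\<close>. The maximum with
    \<open>J\<close> forces \<open>j\<close> to increase even where \<open>l\<close> is small, and
    the \<open>+ 1\<close> gives the strict inequality between \<open>L m\<close> and
    \<open>j (Suc m)\<close>.\<close>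
  define j where "j = rec_nat 0 (\<lambda>m J. max (l (Suc J) m) J + 1)"
  have jS: "j (Suc m) = max (l (Suc (j m)) m) (j m) + 1" for m by (simp add: j_def)
  show thesis
  proof (rule that[of j "\<lambda>m. l (Suc (j m)) m"])
    show "strict_mono j" unfolding strict_mono_Suc_iff by (simp add: jS less_Suc_eq_le)
  qed (auto simp: jS l simp del: power_Suc)
qed

context aniso_cutoff
begin

text \<open>\<open>Q\<close> stands for either of the two quasi-norms, as a functional of the sequence of blocks.\<close>

lemma solid_counterexample:
  fixes Q :: "(nat \<Rightarrow> real ^ 'n \<Rightarrow> ennreal) \<Rightarrow> ennreal"
  assumes q: "0 < q" and p: "0 < p"
    and mono: "\<And>S c E. finite S \<Longrightarrow> 0 < c \<Longrightarrow>
      (\<And>k. k \<in> S \<Longrightarrow> AE x in lborel. ennreal c * ennreal (norm (lp_block a \<psi> k dirac x)) \<le> E k x) \<Longrightarrow>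
      ennreal c * Q (\<lambda>k x. on S (\<lambda>k. ennreal (norm (lp_block a \<psi> k dirac x))) k) \<le> Q E"
    and tail: "\<And>K. (SUP L. Q (\<lambda>k x. on {K..<L} (\<lambda>k. ennreal (norm (lp_block a \<psi> k dirac x))) k)) = \<infinity>"
  shows "\<exists>u\<in>A_space a (aniso_size a * (1 / p - 1)) (ennreal p) (ennreal q).
    Q (\<lambda>k x. ennreal (norm (lp_block a \<psi> k u x))) = \<infinity>"
proof -
  let ?B = "\<lambda>x k. ennreal (norm (lp_block a \<psi> k dirac x))"
  obtain j L where j: "strict_mono j" and L: "\<And>m. L m < j (Suc m)"
    and N: "\<And>m. ennreal (4 ^ Suc m) \<le> Q (\<lambda>k x. on {Suc (j m)..<L m} (?B x) k)"
    using gap_selection[of "\<lambda>K L. Q (\<lambda>k x. on {K..<L} (?B x) k)", OF tail] by blast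
  \<comment> \<open>The coefficient is \<open>2 ^ (-m)\<close> at frequency \<open>j m\<close> and 0
    elsewhere: a geometric sequence is summable in every positive power.\<close>
  define c where "c i = (if i \<in> range j then (1 / 2) ^ (inv j i) else (0::real))" for i
  have injj: "inj j" using j by (rule strict_mono_imp_inj_on)
  have cj: "c (j m) = (1 / 2) ^ m" for m by (simp add: c_def inv_f_f[OF injj])
  have c_out: "c i = 0" if "i \<notin> range j" for i using that by (simp add: c_def)
  have c0: "0 \<le> c i" for i by (simp add: c_def)
  have "summable (\<lambda>m. c (j m))" unfolding cj by (rule summable_geometric) simp
  then have sc: "summable c" by (subst (asm) summable_mono_reindex[OF j]) (auto simp: c_out)
  have "(c (j m)) powr q = ((1 / 2) powr q) ^ m" for m
    unfolding cj by (simp add: powr_realpow[symmetric] powr_powr mult.commute)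
  moreover have "(1 / 2 :: real) powr q < 1" using powr_less_mono2[of q "1 / 2" 1] q by simp
  ultimately have "summable (\<lambda>m. (c (j m)) powr q)" by (simp add: summable_geometric)
  then have scq: "summable (\<lambda>i. c i powr q)"
    by (subst (asm) summable_mono_reindex[OF j, where f = "\<lambda>i. c i powr q"]) (auto simp: c_out)
  let ?u = "lacunary c"
  have u: "?u \<in> A_space a (aniso_size a * (1 / p - 1)) (ennreal p) (ennreal q)"
    by (rule lacunary_in_A_space[OF c0 sc p q scq])
  have "ennreal (2 ^ Suc m) \<le> Q (\<lambda>k x. ennreal (norm (lp_block a \<psi> k ?u x)))" for m
  proof -
    let ?S = "{Suc (j m)..<L m}"
    \<comment> \<open>This is \<open>c (j (Suc m))\<close>, the coefficient of the next active
      frequency above the gap; it bounds the factor between the blocks from below.\<close>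
    let ?c = "(1 / 2 :: real) ^ Suc m"
    have blk: "AE x in lborel. ennreal ?c * ?B x k \<le> ennreal (norm (lp_block a \<psi> k ?u x))" if k: "k \<in> ?S" for k
    proof -
      have mid: "i \<notin> range j" if "j m < i" "i < j (Suc m)" for i
      proof
        assume "i \<in> range j"
        then obtain l where "i = j l" by auto
        then have "m < l" "l < Suc m" using that j by (auto simp: strict_mono_less)
        then show False by simp
      qed
      \<comment> \<open>From \<open>k < L m\<close> and \<open>L m < j (Suc m)\<close> even
        \<open>Suc k\<close> stays below the next active frequency, so both distorted layers have
        coefficient 0.\<close>
      have "k \<notin> range j" "Suc k \<notin> range j"
        by (rule mid; use k L[of m] in simp)+
      then have "c k = 0" "c (Suc k) = 0" by (simp_all add: c_out)
      moreover have "k + 2 \<le> j (Suc m)" using k L[of m] by auto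
      ultimately have "AE x in lborel. c (j (Suc m)) * norm (lp_block a \<psi> k dirac x) \<le> norm (lp_block a \<psi> k ?u x)"
        by (rule lacunary_block(2)[OF c0 sc])
      then show ?thesis
        unfolding cj
        by eventually_elim (subst ennreal_mult[symmetric], auto intro!: ennreal_leI)
    qed
    have "ennreal (2 ^ Suc m) = ennreal ?c * ennreal (4 ^ Suc m)"
      by (subst ennreal_mult[symmetric]) (auto simp: power_mult_distrib[symmetric])
    also have "\<dots> \<le> ennreal ?c * Q (\<lambda>k x. on ?S (?B x) k)"
      by (intro mult_left_mono N) simp
    also have "\<dots> \<le> Q (\<lambda>k x. ennreal (norm (lp_block a \<psi> k ?u x)))"
      by (rule mono) (use blk in auto)
    finally show ?thesis .
  qed
  moreover have "(SUP m. ennreal (2 ^ Suc m)) = \<infinity>"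
  proof (rule ccontr)
    assume "(SUP m. ennreal (2 ^ Suc m)) \<noteq> \<infinity>"
    then obtain B where B: "0 \<le> B" "(SUP m. ennreal (2 ^ Suc m)) = ennreal B"
      by (cases "SUP m. ennreal (2 ^ Suc m)") auto
    obtain m where "B < 2 ^ m" using real_arch_pow[of 2 B] by auto
    then have "ennreal B < ennreal (2 ^ Suc m)" using B(1) by (intro ennreal_lessI) auto
    also have "\<dots> \<le> (SUP m. ennreal (2 ^ Suc m))" by (rule SUP_upper) simp
    finally show False using B by simp
  qed
  ultimately have "\<infinity> \<le> Q (\<lambda>k x. ennreal (norm (lp_block a \<psi> k ?u x)))"
    by (metis SUP_least)
  then show ?thesis using u by (auto simp: top_unique)
qed

section \<open>Application to the Besov and Lizorkin--Triebel quasi-norms\<close>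

abbreviation dblock :: "nat \<Rightarrow> real ^ 'n \<Rightarrow> real"
  where "dblock k x \<equiv> norm (lp_block a \<psi> k dirac x)"

lemma dblock_measurable [measurable]: "lp_block a \<psi> k dirac \<in> borel_measurable borel"
  by (rule lp_block_AE(1)[OF represents_dirac_block])

lemma dblock_AE: "AE x in lborel. lp_block a \<psi> k dirac x = inv_fourier (win k) x"
  by (rule lp_block_AE(2)[OF represents_dirac_block])

lemma dblock_Lp_integral: "0 < r \<Longrightarrow> (\<integral>\<^sup>+x. epowr (ennreal (dblock k x)) r \<partial>lborel) < \<infinity>"
proof -
  assume r: "0 < r"
  have "(\<integral>\<^sup>+x. epowr (ennreal (dblock k x)) r \<partial>lborel) = (\<integral>\<^sup>+x. ennreal (norm (inv_fourier (win k) x) powr r) \<partial>lborel)"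
    by (rule nn_integral_cong_AE) (use dblock_AE[of k] in eventually_elim, simp)
  also have "\<dots> < \<infinity>"
    using Lp_integrable_schwartz[OF schwartz_inv_fourier[OF win_schwartz] r, of k]
    by (simp add: integrable_iff_bounded)
  finally show ?thesis .
qed

lemma dblock_Lp_finite:
  assumes "0 < p'" shows "Lp_qnorm p' (\<lambda>x. ennreal (dblock k x)) < \<infinity>"
  using assms
proof (cases rule: ennreal_exponent_cases)
  case 1
  obtain C where C: "\<And>x. norm (inv_fourier (win k) x) \<le> C / (1 + norm x) ^ 0"
    using sbdd_bound0[OF sbdd_of_schwartz[OF schwartz_inv_fourier[OF win_schwartz]]] by metis
  have "esssup lborel (\<lambda>x. ennreal (dblock k x)) \<le> ennreal C"
  proof (rule esssup_I)
    show "AE x in lborel. ennreal (dblock k x) \<le> ennreal C"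
      using dblock_AE[of k] by eventually_elim (use C in \<open>auto intro!: ennreal_leI\<close>)
  qed simp
  then show ?thesis by (simp add: 1 Lp_qnorm_def) (metis ennreal_less_top le_less_trans)
next
  case (2 r)
  then show ?thesis using dblock_Lp_integral[OF 2(1), of k] by (simp add: Lp_qnorm_ennreal epowr_lt_top_iff[unfolded infinity_ennreal_def])
qed

text \<open>Integration is done block by block, so a truncated quasi-norm is \<open>lq_qnorm\<close>
  of a truncated numerical sequence (\<open>Qon\<close>); the two conditions of
  \<open>solid_counterexample\<close> then come from \<open>lq_mono\<close> and
  \<open>lq_split\<close>.\<close>

lemma besov_alternative:
  assumes p: "0 < p" "p < 1" and q: "0 < q" "q \<le> 1" and p': "0 < p'" and q': "0 < q'"
  shows "A_space a (aniso_size a * (1 / p - 1)) (ennreal p) (ennreal q) \<noteq> besov_space a \<psi> s' p' q'"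
proof (cases "besov_qnorm a \<psi> s' p' q' dirac < \<infinity>")
  case True
  then have "dirac \<in> besov_space a \<psi> s' p' q'" by (simp add: besov_space_def dirac_tempered)
  then show ?thesis using dirac_notin_A_space[OF p q] by auto
next
  case False
  let ?Q = "\<lambda>E. lq_qnorm q' (\<lambda>k. ennreal (2 powr (real k * s')) * Lp_qnorm p' (E k))"
  let ?d = "\<lambda>k. ennreal (2 powr (real k * s')) * Lp_qnorm p' (\<lambda>x. ennreal (dblock k x))"
  have Lp0: "Lp_qnorm p' (\<lambda>x::real ^ 'n. 0) = 0"
    using p' by (cases rule: ennreal_exponent_cases) (auto simp: Lp_qnorm_ennreal Lp_qnorm_def esssup_const)
  have Qon: "?Q (\<lambda>k x. on S (\<lambda>k. ennreal (dblock k x)) k) = lq_qnorm q' (on S ?d)" for S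
    by (rule arg_cong[where f = "lq_qnorm q'"]) (auto simp: on_def Lp0)
  have "\<exists>u\<in>A_space a (aniso_size a * (1 / p - 1)) (ennreal p) (ennreal q).
    ?Q (\<lambda>k x. ennreal (norm (lp_block a \<psi> k u x))) = \<infinity>"
  proof (rule solid_counterexample[OF q(1) p(1)])
    fix S :: "nat set" and c :: real and E :: "nat \<Rightarrow> real ^ 'n \<Rightarrow> ennreal"
    assume c: "0 < c" and le: "\<And>k. k \<in> S \<Longrightarrow> AE x in lborel. ennreal c * ennreal (dblock k x) \<le> E k x"
    have "ennreal c * lq_qnorm q' (on S ?d) = lq_qnorm q' (\<lambda>k. ennreal c * on S ?d k)"
      by (rule lq_cmult[OF q' c, symmetric])
    also have "\<dots> \<le> ?Q E"
    proof (rule lq_mono[OF q'])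
      fix k
      show "ennreal c * on S ?d k \<le> ennreal (2 powr (real k * s')) * Lp_qnorm p' (E k)"
      proof (cases "k \<in> S")
        case True
        have "ennreal c * Lp_qnorm p' (\<lambda>x. ennreal (dblock k x)) \<le> Lp_qnorm p' (E k)"
          by (rule Lp_mono_cmult[OF p' c _ le[OF True]]) measurable
        from mult_left_mono[OF this, of "ennreal (2 powr (real k * s'))"] True show ?thesis
          by (simp add: on_def mult_ac)
      qed (simp add: on_def)
    qed
    finally show "ennreal c * ?Q (\<lambda>k x. on S (\<lambda>k. ennreal (dblock k x)) k) \<le> ?Q E" unfolding Qon .
  next
    fix K
    obtain \<kappa> where \<kappa>: "lq_qnorm q' ?d \<le> ennreal \<kappa> * ((\<Sum>k<K. ?d k) + (SUP L. lq_qnorm q' (on {K..<L} ?d)))"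
      using lq_split[OF q', of K] by blast
    have "lq_qnorm q' ?d = \<infinity>" using False by (simp add: besov_qnorm_def less_top[symmetric])
    then have "(\<Sum>k<K. ?d k) + (SUP L. lq_qnorm q' (on {K..<L} ?d)) = \<infinity>"
      using \<kappa> by (auto simp: top_unique ennreal_mult_eq_top_iff)
    \<comment> \<open>Each Dirac block agrees almost everywhere with a Schwartz function, so a
      finite head is finite for every \<open>p'\<close>.\<close>
    moreover have "(\<Sum>k<K. ?d k) \<noteq> \<infinity>"
      using dblock_Lp_finite[OF p', THEN less_imp_neq] by (auto simp: ennreal_mult_eq_top_iff)
    ultimately show "(SUP L. ?Q (\<lambda>k x. on {K..<L} (\<lambda>k. ennreal (dblock k x)) k)) = \<infinity>"
      unfolding Qon by auto
  qed
  then obtain u where "u \<in> A_space a (aniso_size a * (1 / p - 1)) (ennreal p) (ennreal q)" "besov_qnorm a \<psi> s' p' q' u = \<infinity>"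
    unfolding besov_qnorm_def by blast
  then show ?thesis by (auto simp: besov_space_def)
qed

text \<open>The sequence quasi-norm sits inside the integral, so head and tail are separated
  pointwise, raised to the power \<open>r\<close> and then integrated; finiteness of
  \<open>p'\<close> provides this real exponent. After raising to the power,
  \<open>epowr_add_le\<close> and additivity of the integral replace a triangle inequality.\<close>

lemma triebel_alternative:
  assumes p: "0 < p" "p < 1" and q: "0 < q" "q \<le> 1" and p': "0 < p'" "p' < \<infinity>" and q': "0 < q'"
  shows "A_space a (aniso_size a * (1 / p - 1)) (ennreal p) (ennreal q) \<noteq> triebel_space a \<psi> s' p' q'"
proof (cases "triebel_qnorm a \<psi> s' p' q' dirac < \<infinity>")
  case True
  then have "dirac \<in> triebel_space a \<psi> s' p' q'" by (simp add: triebel_space_def dirac_tempered)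
  then show ?thesis using dirac_notin_A_space[OF p q] by auto
next
  case False
  obtain r where r: "0 < r" "p' = ennreal r"
    using p' by (cases rule: ennreal_exponent_cases[OF p'(1)]) auto
  let ?Q = "\<lambda>E. Lp_qnorm p' (\<lambda>x. lq_qnorm q' (\<lambda>k. ennreal (2 powr (real k * s')) * E k x))"
  let ?d = "\<lambda>x k. ennreal (2 powr (real k * s')) * ennreal (dblock k x)"
  have Qon: "?Q (\<lambda>k x. on S (\<lambda>k. ennreal (dblock k x)) k) = Lp_qnorm p' (\<lambda>x. lq_qnorm q' (on S (?d x)))" for S
    by (rule arg_cong[where f = "Lp_qnorm p'"], rule ext, rule arg_cong[where f = "lq_qnorm q'"]) (auto simp: on_def)
  have m [measurable]: "(\<lambda>x. lq_qnorm q' (on S (?d x))) \<in> borel_measurable borel" for S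
    by (rule measurable_lq[OF q']) (cases rule: case_split, auto simp: on_def)
  have "\<exists>u\<in>A_space a (aniso_size a * (1 / p - 1)) (ennreal p) (ennreal q).
    ?Q (\<lambda>k x. ennreal (norm (lp_block a \<psi> k u x))) = \<infinity>"
  proof (rule solid_counterexample[OF q(1) p(1)])
    fix S :: "nat set" and c :: real and E :: "nat \<Rightarrow> real ^ 'n \<Rightarrow> ennreal"
    assume S: "finite S" and c: "0 < c" and le: "\<And>k. k \<in> S \<Longrightarrow> AE x in lborel. ennreal c * ennreal (dblock k x) \<le> E k x"
    \<comment> \<open>Finiteness of \<open>S\<close> is used here: the exceptional sets of the
      single blocks are merged into one null set before the sequences are compared
      pointwise.\<close>
    have "AE x in lborel. \<forall>k\<in>S. ennreal c * ennreal (dblock k x) \<le> E k x"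
      by (rule AE_finite_allI[OF S le])
    then have "AE x in lborel. ennreal c * lq_qnorm q' (on S (?d x)) \<le> lq_qnorm q' (\<lambda>k. ennreal (2 powr (real k * s')) * E k x)"
    proof eventually_elim
      fix x assume x: "\<forall>k\<in>S. ennreal c * ennreal (dblock k x) \<le> E k x"
      have "ennreal c * lq_qnorm q' (on S (?d x)) = lq_qnorm q' (\<lambda>k. ennreal c * on S (?d x) k)"
        by (rule lq_cmult[OF q' c, symmetric])
      also have "\<dots> \<le> lq_qnorm q' (\<lambda>k. ennreal (2 powr (real k * s')) * E k x)"
      proof (rule lq_mono[OF q'])
        fix k
        show "ennreal c * on S (?d x) k \<le> ennreal (2 powr (real k * s')) * E k x"
          using mult_left_mono[OF x[rule_format, of k], of "ennreal (2 powr (real k * s'))"]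
          by (cases "k \<in> S") (simp_all add: on_def mult_ac)
      qed
      finally show "ennreal c * lq_qnorm q' (on S (?d x)) \<le> lq_qnorm q' (\<lambda>k. ennreal (2 powr (real k * s')) * E k x)" .
    qed
    then show "ennreal c * ?Q (\<lambda>k x. on S (\<lambda>k. ennreal (dblock k x)) k) \<le> ?Q E"
      unfolding Qon by (rule Lp_mono_cmult[OF p'(1) c m])
  next
    fix K
    obtain \<kappa> where \<kappa>: "\<kappa> > 0" "\<And>d. lq_qnorm q' d \<le> ennreal \<kappa> * ((\<Sum>k<K. d k) + (SUP L. lq_qnorm q' (on {K..<L} d)))"
      using lq_split[OF q', of K] by blast
    let ?X = "\<lambda>x. \<Sum>k<K. ?d x k" and ?Y = "\<lambda>L x. lq_qnorm q' (on {K..<L} (?d x))"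
    let ?C = "ennreal (\<kappa> powr r) * ennreal (2 powr r)"
    have "(\<integral>\<^sup>+x. epowr (\<Sum>k<J. ?d x k) r \<partial>lborel) < \<infinity>" for J
    \<comment> \<open>Induction on the length of the head: each further block costs a finite factor
      from \<open>epowr_add_le\<close> and adds a finite integral.\<close>
    proof (induct J)
      case (Suc J)
      have "(\<integral>\<^sup>+x. epowr (\<Sum>k<Suc J. ?d x k) r \<partial>lborel)
        \<le> (\<integral>\<^sup>+x. ennreal (2 powr r) * (epowr (\<Sum>k<J. ?d x k) r + ennreal ((2 powr (real J * s')) powr r) * epowr (ennreal (dblock J x)) r) \<partial>lborel)"
        using epowr_add_le[OF r(1)] by (intro nn_integral_mono) (simp add: epowr_mult[symmetric] del: epowr_ennreal)
      also have "\<dots> = ennreal (2 powr r) * ((\<integral>\<^sup>+x. epowr (\<Sum>k<J. ?d x k) r \<partial>lborel)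
          + ennreal ((2 powr (real J * s')) powr r) * (\<integral>\<^sup>+x. epowr (ennreal (dblock J x)) r \<partial>lborel))"
        by (subst nn_integral_cmult, measurable, subst nn_integral_add, measurable, subst nn_integral_cmult, measurable)
      also have "\<dots> < \<infinity>"
        using Suc dblock_Lp_integral[OF r(1), of J] by (simp add: ennreal_mult_less_top del: epowr_ennreal)
      finally show ?case .
    qed simp
    then have X: "(\<integral>\<^sup>+x. epowr (?X x) r \<partial>lborel) < \<infinity>" .
    \<comment> \<open>Monotonicity in \<open>L\<close> lets the supremum over windows leave the
      integral by monotone convergence, as the tail condition of \<open>solid_counterexample\<close>
      requires.\<close>
    have inc: "incseq (\<lambda>L x. epowr (?Y L x) r)"
      by (auto simp: incseq_def le_fun_def on_def intro!: epowr_mono r lq_mono q')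
    have "(\<integral>\<^sup>+x. epowr (lq_qnorm q' (?d x)) r \<partial>lborel) \<le> (\<integral>\<^sup>+x. ?C * (epowr (?X x) r + (SUP L. epowr (?Y L x) r)) \<partial>lborel)"
    proof (rule nn_integral_mono)
      fix x
      have "epowr (lq_qnorm q' (?d x)) r \<le> epowr (ennreal \<kappa> * (?X x + (SUP L. ?Y L x))) r"
        by (intro epowr_mono r \<kappa>)
      also have "\<dots> = ennreal (\<kappa> powr r) * epowr (?X x + (SUP L. ?Y L x)) r" by (rule epowr_mult[OF \<kappa>(1)])
      also have "\<dots> \<le> ennreal (\<kappa> powr r) * (ennreal (2 powr r) * (epowr (?X x) r + epowr (SUP L. ?Y L x) r))"
        by (intro mult_left_mono epowr_add_le r) simp
      finally show "epowr (lq_qnorm q' (?d x)) r \<le> ?C * (epowr (?X x) r + (SUP L. epowr (?Y L x) r))"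
        by (simp add: epowr_SUP[OF r(1)] mult.assoc)
    qed
    also have "\<dots> = ?C * ((\<integral>\<^sup>+x. epowr (?X x) r \<partial>lborel) + (\<integral>\<^sup>+x. (SUP L. epowr (?Y L x) r) \<partial>lborel))"
      by (subst nn_integral_cmult, measurable, subst nn_integral_add, measurable)
    also have "(\<integral>\<^sup>+x. (SUP L. epowr (?Y L x) r) \<partial>lborel) = (SUP L. \<integral>\<^sup>+x. epowr (?Y L x) r \<partial>lborel)"
      by (rule nn_integral_monotone_convergence_SUP[OF inc]) measurable
    finally have le: "(\<integral>\<^sup>+x. epowr (lq_qnorm q' (?d x)) r \<partial>lborel) \<le>
      ?C * ((\<integral>\<^sup>+x. epowr (?X x) r \<partial>lborel) + (SUP L. \<integral>\<^sup>+x. epowr (?Y L x) r \<partial>lborel))" .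
    have "Lp_qnorm p' (\<lambda>x. lq_qnorm q' (?d x)) = \<infinity>" using False by (simp add: triebel_qnorm_def less_top[symmetric])
    then have "(\<integral>\<^sup>+x. epowr (lq_qnorm q' (?d x)) r \<partial>lborel) = \<infinity>"
      using r by (simp add: Lp_qnorm_ennreal epowr_eq_top_iff[unfolded infinity_ennreal_def])
    with le have "(\<integral>\<^sup>+x. epowr (?X x) r \<partial>lborel) + (SUP L. \<integral>\<^sup>+x. epowr (?Y L x) r \<partial>lborel) = \<infinity>"
      by (auto simp: top_unique ennreal_mult_eq_top_iff)
    with X have "(SUP L. \<integral>\<^sup>+x. epowr (?Y L x) r \<partial>lborel) = \<infinity>" by auto
    moreover have "(SUP L. Lp_qnorm p' (?Y L)) = epowr (SUP L. \<integral>\<^sup>+x. epowr (?Y L x) r \<partial>lborel) (1 / r)"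
      unfolding r(2) Lp_qnorm_ennreal[OF r(1)] by (rule epowr_SUP[symmetric]) (use r(1) in simp)
    ultimately have "(SUP L. Lp_qnorm p' (?Y L)) = \<infinity>" by (simp only: infinity_ennreal_def epowr_top)
    then show "(SUP L. ?Q (\<lambda>k x. on {K..<L} (\<lambda>k. ennreal (dblock k x)) k)) = \<infinity>"
      unfolding Qon .
  qed
  then obtain u where "u \<in> A_space a (aniso_size a * (1 / p - 1)) (ennreal p) (ennreal q)" "triebel_qnorm a \<psi> s' p' q' u = \<infinity>"
    unfolding triebel_qnorm_def by blast
  then show ?thesis by (auto simp: triebel_space_def)
qed

end

theorem proposition3:
  fixes a :: "real ^ 'n" and \<psi> :: "real ^ 'n \<Rightarrow> complex" and p q :: real
  assumes "anisotropy a"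
    and "cutoff a \<psi>"
    and "0 < p" "p < 1"
    and "0 < q" "q \<le> 1"
  shows "(\<forall>(s' :: real) (p' :: ennreal) (q' :: ennreal). 0 < p' \<and> 0 < q' \<longrightarrow>
            A_space a (aniso_size a * (1 / p - 1)) (ennreal p) (ennreal q)
              \<noteq> besov_space a \<psi> s' p' q') \<and>
         (\<forall>(s' :: real) (p' :: ennreal) (q' :: ennreal). 0 < p' \<and> p' < \<infinity> \<and> 0 < q' \<longrightarrow>
            A_space a (aniso_size a * (1 / p - 1)) (ennreal p) (ennreal q)
              \<noteq> triebel_space a \<psi> s' p' q')"
proof -
  interpret aniso_cutoff a \<psi> by standard fact+
  show ?thesis
    using besov_alternative[OF assms(3-6)] triebel_alternative[OF assms(3-6)] by blast
qed

end
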